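(* Let $K$ be a finite field. There is an algorithm which, given an ideal $I \subseteq K[x_1, \dots, x_n]$ (by a finite list of generators) and a positive integer $k$, decides whether $\mathsf{t}(I) \le k$.
   Context: For an ideal $I \subseteq K[x_1,\dots,x_n]$, $\mathsf{t}(I) = \min\{|\operatorname{supp}(f)| : 0 \neq f \in I\}$ and $\mathsf{t}(0) = \infty$, where $\operatorname{supp}(f) \subseteq \mathbb{N}^n$ is the set of exponent vectors occurring in $f$ with nonzero coefficient. *)

theory Defs
  imports
    "HOL-Algebra.Ideal"
    "HOL-Library.Poly_Mapping"
    "HOL-Library.Extended_Nat"
    "HOL-Library.Nat_Bijection"
begin

section \<open>Algorithms: programs for partial recursive functions\<close>

datatype prog =
    Zero_Prog
  | Succ_Prog
  | Proj_Prog nat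
  | Comp_Prog prog "prog list"
  | Rec_Prog prog prog
  | Min_Prog prog

text \<open>
  The proposition \<open>prog_eval p xs y\<close> says that the program \<open>p\<close>, started on the inputs \<open>xs\<close>,
  halts with output \<open>y\<close>. Recursion and minimization act on the first argument; the minimization
  operator diverges if the body diverges before its first zero is reached.
\<close>

inductive prog_eval :: "prog \<Rightarrow> nat list \<Rightarrow> nat \<Rightarrow> bool" where
  Zero: "prog_eval Zero_Prog xs 0"
| Succ: "prog_eval Succ_Prog [x] (Suc x)"
| Proj: "i < length xs \<Longrightarrow> prog_eval (Proj_Prog i) xs (xs ! i)"
| Comp: "list_all2 (\<lambda>q y. prog_eval q xs y) qs ys \<Longrightarrow> prog_eval p ys z
         \<Longrightarrow> prog_eval (Comp_Prog p qs) xs z"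
| Rec_0: "prog_eval p xs y \<Longrightarrow> prog_eval (Rec_Prog p q) (0 # xs) y"
| Rec_Suc: "prog_eval (Rec_Prog p q) (m # xs) y \<Longrightarrow> prog_eval q (m # y # xs) z
         \<Longrightarrow> prog_eval (Rec_Prog p q) (Suc m # xs) z"
| Min: "prog_eval p (m # xs) 0 \<Longrightarrow> (\<And>i. i < m \<Longrightarrow> \<exists>y>0. prog_eval p (i # xs) y)
         \<Longrightarrow> prog_eval (Min_Prog p) xs m"
monos list_all2_mono

inductive_cases prog_eval_ZeroE: "prog_eval Zero_Prog xs y"
inductive_cases prog_eval_SuccE: "prog_eval Succ_Prog xs y"
inductive_cases prog_eval_ProjE: "prog_eval (Proj_Prog i) xs y"
inductive_cases prog_eval_CompE: "prog_eval (Comp_Prog p qs) xs y"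
inductive_cases prog_eval_Rec_0E: "prog_eval (Rec_Prog p q) (0 # xs) y"
inductive_cases prog_eval_Rec_SucE: "prog_eval (Rec_Prog p q) (Suc m # xs) y"
inductive_cases prog_eval_MinE: "prog_eval (Min_Prog p) xs y"

lemma prog_eval_deterministic:
  assumes "prog_eval p xs y" "prog_eval p xs z"
  shows "y = z"
  using assms
proof (induction arbitrary: z rule: prog_eval.induct)
  case Zero
  then show ?case by (elim prog_eval_ZeroE) simp
next
  case Succ
  then show ?case by (elim prog_eval_SuccE) simp
next
  case Proj
  then show ?case by (elim prog_eval_ProjE) simp
next
  case (Comp xs qs ys p w)
  from Comp.prems obtain ys' where
    ys': "list_all2 (\<lambda>q y. prog_eval q xs y) qs ys'" "prog_eval p ys' z"
    by (elim prog_eval_CompE)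
  have "ys = ys'"
  proof (rule nth_equalityI)
    show "length ys = length ys'"
      using Comp.IH(1) ys'(1) by (auto dest!: list_all2_lengthD)
    show "ys ! i = ys' ! i" if "i < length ys" for i
      using Comp.IH(1) ys'(1) that by (auto simp: list_all2_conv_all_nth)
  qed
  with Comp.IH(2) ys'(2) show ?case by blast
next
  case Rec_0
  then show ?case by (elim prog_eval_Rec_0E) blast
next
  case (Rec_Suc p q m xs y w)
  from Rec_Suc.prems obtain y' where
    "prog_eval (Rec_Prog p q) (m # xs) y'" "prog_eval q (m # y' # xs) z"
    by (elim prog_eval_Rec_SucE)
  with Rec_Suc.IH show ?case by blast
next
  case (Min p m xs)
  from Min.prems have z: "prog_eval p (z # xs) 0"
    "\<And>i. i < z \<Longrightarrow> \<exists>y>0. prog_eval p (i # xs) y"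
    by (elim prog_eval_MinE; blast)+
  have "\<not> m < z"
    using Min.IH(1) z(2) by fastforce
  moreover have "\<not> z < m"
    using Min.IH(2) z(1) by fastforce
  ultimately show ?case by simp
qed

section \<open>Polynomial rings, ideals and shortest polynomials\<close>

text \<open>
  A polynomial in countably many variables (indexed by \<open>nat\<close>) is a finitely supported map from
  exponent vectors to coefficients, so that \<open>Poly_Mapping.keys f\<close> is its support. The ring
  \<open>K[x_1, ..., x_n]\<close> consists of those polynomials that only involve the variables with index below \<open>n\<close>.
\<close>

type_synonym 'k mpoly = "(nat \<Rightarrow>\<^sub>0 nat) \<Rightarrow>\<^sub>0 'k"

definition mpoly_ring :: "nat \<Rightarrow> 'k::comm_ring_1 mpoly ring" where
  "mpoly_ring n =
    \<lparr>carrier = {f. \<forall>e\<in>Poly_Mapping.keys f. Poly_Mapping.keys e \<subseteq> {..<n}},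
     mult = (*), one = 1, zero = 0, add = (+)\<rparr>"

lemma cring_mpoly_ring: "cring (mpoly_ring n :: 'k::comm_ring_1 mpoly ring)"
proof (rule cringI)
  show "abelian_group (mpoly_ring n :: 'k mpoly ring)"
  proof (rule abelian_groupI)
    fix f :: "'k mpoly"
    assume "f \<in> carrier (mpoly_ring n)"
    then show "\<exists>g\<in>carrier (mpoly_ring n). g \<oplus>\<^bsub>mpoly_ring n\<^esub> f = \<zero>\<^bsub>mpoly_ring n\<^esub>"
      by (intro bexI[of _ "- f"]) (auto simp: mpoly_ring_def)
  next
    fix f g :: "'k mpoly"
    assume "f \<in> carrier (mpoly_ring n)" "g \<in> carrier (mpoly_ring n)"
    then show "f \<oplus>\<^bsub>mpoly_ring n\<^esub> g \<in> carrier (mpoly_ring n)"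
      using keys_add[of f g] by (fastforce simp: mpoly_ring_def)
  qed (auto simp: mpoly_ring_def add_ac)
  show "comm_monoid (mpoly_ring n :: 'k mpoly ring)"
  proof (rule comm_monoidI)
    fix f g :: "'k mpoly"
    assume fg: "f \<in> carrier (mpoly_ring n)" "g \<in> carrier (mpoly_ring n)"
    have "Poly_Mapping.keys e \<subseteq> {..<n}" if "e \<in> Poly_Mapping.keys (f * g)" for e
    proof -
      from that obtain a b where "e = a + b" "a \<in> Poly_Mapping.keys f" "b \<in> Poly_Mapping.keys g"
        using keys_mult[of f g] by blast
      with fg keys_add[of a b] show ?thesis
        by (force simp: mpoly_ring_def)
    qed
    then show "f \<otimes>\<^bsub>mpoly_ring n\<^esub> g \<in> carrier (mpoly_ring n)"
      by (auto simp: mpoly_ring_def)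
  qed (auto simp: mpoly_ring_def mult_ac)
qed (auto simp: mpoly_ring_def distrib_right)

text \<open>The infimum of the empty set in \<open>enat\<close> is \<open>\<infinity>\<close>, which covers the zero ideal.\<close>

definition shortest_length :: "'k::zero mpoly set \<Rightarrow> enat" where
  "shortest_length I = (INF f\<in>I - {0}. enat (card (Poly_Mapping.keys f)))"

lemma shortest_length_zero_ideal: "shortest_length {0} = \<infinity>"
  by (simp add: shortest_length_def top_enat_def)

lemma shortest_length_attained:
  assumes "f \<in> I" "f \<noteq> 0"
  shows "\<exists>f\<in>I. f \<noteq> 0 \<and> shortest_length I = enat (card (Poly_Mapping.keys f))"
proof -
  have "shortest_length I \<in> (\<lambda>f. enat (card (Poly_Mapping.keys f))) ` (I - {0})"
    unfolding shortest_length_def using assms by (intro wellorder_InfI) auto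
  then show ?thesis by auto
qed

section \<open>Input format\<close>

text \<open>
  A polynomial in \<open>n\<close> variables is presented by a list of terms, each consisting of an exponent
  vector of length \<open>n\<close> and a coefficient; the polynomial is the sum of these terms (repeated
  exponent vectors and zero coefficients are permitted).
\<close>

type_synonym 'k terms = "(nat list \<times> 'k) list"

definition valid_terms :: "nat \<Rightarrow> 'k terms \<Rightarrow> bool" where
  "valid_terms n ts \<longleftrightarrow> (\<forall>(e, c)\<in>set ts. length e = n)"

definition poly_of_terms :: "'k::comm_ring_1 terms \<Rightarrow> 'k mpoly" where
  "poly_of_terms ts = (\<Sum>(e, c)\<leftarrow>ts. Poly_Mapping.single (Poly_Mapping.nth e) c)"

definition encode_terms :: "('k \<Rightarrow> nat) \<Rightarrow> 'k terms \<Rightarrow> nat" where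
  "encode_terms enc ts = list_encode (map (\<lambda>(e, c). prod_encode (list_encode e, enc c)) ts)"

definition encode_generators :: "('k \<Rightarrow> nat) \<Rightarrow> 'k terms list \<Rightarrow> nat" where
  "encode_generators enc gs = list_encode (map (encode_terms enc) gs)"

lemma poly_mapping_sum_single:
  "(\<Sum>e\<in>Poly_Mapping.keys f. Poly_Mapping.single e (Poly_Mapping.lookup f e)) = f"
  by (rule poly_mapping_eqI)
     (auto simp: lookup_sum lookup_single when_def in_keys_iff)

lemma poly_of_terms_image:
  "poly_of_terms ` {ts. valid_terms n ts} = carrier (mpoly_ring n :: 'k::comm_ring_1 mpoly ring)"
proof (intro equalityI subsetI)
  fix f :: "'k mpoly"
  assume "f \<in> poly_of_terms ` {ts. valid_terms n ts}"
  then obtain ts where ts: "f = poly_of_terms ts" "valid_terms n ts" by blast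
  have "poly_of_terms ts \<in> carrier (mpoly_ring n :: 'k mpoly ring)"
    if "valid_terms n ts" for ts :: "'k terms"
    using that
  proof (induction ts)
    case Nil
    then show ?case by (simp add: poly_of_terms_def mpoly_ring_def)
  next
    case (Cons t ts)
    interpret R: cring "mpoly_ring n :: 'k mpoly ring" by (rule cring_mpoly_ring)
    obtain a c where t: "t = (a, c)" by (cases t)
    have "length a = n"
      using Cons.prems by (simp add: t valid_terms_def)
    then have "i < n" if "i \<in> Poly_Mapping.keys (Poly_Mapping.nth a)" for i
      using that unfolding in_keys_iff lookup_nth by (auto simp: nth_default_def split: if_splits)
    then have "Poly_Mapping.keys (Poly_Mapping.nth a) \<subseteq> {..<n}"
      by blast
    then have "Poly_Mapping.single (Poly_Mapping.nth a) c \<in> carrier (mpoly_ring n)"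
      by (simp add: mpoly_ring_def del: keys_nth)
    moreover have "poly_of_terms ts \<in> carrier (mpoly_ring n)"
      using Cons by (simp add: valid_terms_def)
    ultimately have
      "Poly_Mapping.single (Poly_Mapping.nth a) c \<oplus>\<^bsub>mpoly_ring n\<^esub> poly_of_terms ts \<in> carrier (mpoly_ring n)"
      by (rule R.a_closed)
    then show ?case
      by (simp add: t poly_of_terms_def mpoly_ring_def)
  qed
  with ts show "f \<in> carrier (mpoly_ring n)" by simp
next
  fix f :: "'k mpoly"
  assume f: "f \<in> carrier (mpoly_ring n)"
  obtain es where es: "set es = Poly_Mapping.keys f" "distinct es"
    using finite_distinct_list[OF finite_keys[of f]] by auto
  define v where "v e = map (Poly_Mapping.lookup e) [0..<n]" for e :: "nat \<Rightarrow>\<^sub>0 nat"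
  have v: "Poly_Mapping.nth (v e) = e" if "e \<in> Poly_Mapping.keys f" for e
  proof (rule poly_mapping_eqI)
    fix i
    show "Poly_Mapping.lookup (Poly_Mapping.nth (v e)) i = Poly_Mapping.lookup e i"
    proof (cases "i < n")
      case False
      with f that have "i \<notin> Poly_Mapping.keys e"
        by (auto simp: mpoly_ring_def)
      with False show ?thesis
        by (simp add: v_def nth_default_def in_keys_iff)
    qed (simp add: v_def nth_default_def)
  qed
  have "poly_of_terms (map (\<lambda>e. (v e, Poly_Mapping.lookup f e)) es)
      = (\<Sum>e\<leftarrow>es. Poly_Mapping.single (Poly_Mapping.nth (v e)) (Poly_Mapping.lookup f e))"
    by (simp add: poly_of_terms_def o_def)
  also have "\<dots> = (\<Sum>e\<in>Poly_Mapping.keys f. Poly_Mapping.single (Poly_Mapping.nth (v e)) (Poly_Mapping.lookup f e))"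
    unfolding es(1)[symmetric] using es(2) by (rule sum_list_distinct_conv_sum_set)
  also have "\<dots> = (\<Sum>e\<in>Poly_Mapping.keys f. Poly_Mapping.single e (Poly_Mapping.lookup f e))"
    by (intro sum.cong) (auto simp: v)
  also have "\<dots> = f"
    by (simp add: poly_mapping_sum_single)
  finally show "f \<in> poly_of_terms ` {ts. valid_terms n ts}"
    by (intro image_eqI[of _ _ "map (\<lambda>e. (v e, Poly_Mapping.lookup f e)) es"]) (auto simp: valid_terms_def v_def)
qed

end

theory Submission
  imports Defs "HOL-Computational_Algebra.Fraction_Field" "HOL-Computational_Algebra.Primes"
begin

text \<open>
  The question and its negation are both semidecidable, so a search for a proof of either kind always
  succeeds. If \<open>t(I) \<le> k\<close>, then a short polynomial together with its coefficients with respect to the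
  generators is a proof. For the converse, let \<open>q > 1\<close> be such that \<open>f \<mapsto> f ^ q\<close> is \<open>K\<close>-linear on polynomials.
  Every ideal is a finite intersection of kernels of maps \<open>f \<mapsto> f(X_1, ..., X_n) v\<close>, where the \<open>X_j\<close> are
  commuting matrices over \<open>E = K(x_1, ..., x_n)\<close> and \<open>v \<in> E^m\<close>. Moreover there is a matrix \<open>U\<close> with
  \<open>U v' = v\<close> and \<open>U X_j' = X_j ^ q U\<close>, where the prime raises all entries to the power \<open>q\<close>. These
  identities make the vectors \<open>X^(a_1) v, ..., X^(a_k) v\<close> computable, up to what matters for
  \<open>K\<close>-linear relations between them, by a finite automaton that reads the digits of the exponents in
  base \<open>q\<close>. By pumping, if the intersection of the kernels contains a short polynomial, then it
  contains one whose exponents are below an explicit bound. Hence a family of such matrices whose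
  kernels contain the generators, but no nonzero short polynomial with exponents below the bound, proves
  \<open>t(I) > k\<close>; such a family exists whenever \<open>t(I) > k\<close>.
\<close>

section \<open>Computable functions\<close>

text \<open>No degree bound for a short polynomial is derived from the generators themselves: the
  pumping bound is read off from a certificate, namely from the number, the dimensions and the entry
  degrees of its matrices. So the matrices are searched for. Their existence rests on
  non-constructive choices, whereas checking a certificate takes finitely many polynomial
  identities. Fractions enter because K[x]/I is in general infinite-dimensional over K; modulo
  torsion it becomes finite-dimensional over the fractions in a maximal set of variables independent
  modulo I, and the torsion is what forces a whole family of matrices. Pumping changes exponents but
  must keep the coefficients of a relation, hence the demand that \<open>c ^ q = c\<close> on K. The
  obstacle to a finite automaton is that vectors over K(x) form an infinite set, with degrees
  growing as digits are read. The remedy is to record only the linear forms of bounded degree that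
  vanish at them: pulling a form back along a digit raises its degree by a fixed amount, and the
  q-th root then divides it by q, so some degree bound is self-reproducing.\<close>

definition recn :: "nat \<Rightarrow> (nat list \<Rightarrow> nat) \<Rightarrow> bool" where
  "recn k f \<longleftrightarrow> (\<exists>p. \<forall>xs. length xs = k \<longrightarrow> prog_eval p xs (f xs))"

text \<open>Values on lists of other lengths are irrelevant to \<open>recn k\<close>. Hence HOL
  expressions such as \<open>xs ! i\<close> or \<open>drop 2 zs\<close> can stand for functions of
  fixed arity and be exchanged when they agree at that length.\<close>

lemma recn_cong:
  assumes "recn k f" "\<And>xs. length xs = k \<Longrightarrow> f xs = g xs"
  shows "recn k g"
  using assms unfolding recn_def by metis

lemma recn_nth: "i < k \<Longrightarrow> recn k (\<lambda>xs. xs ! i)"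
  unfolding recn_def by (auto intro!: exI[of _ "Proj_Prog i"] prog_eval.Proj)

lemma recn_comp:
  assumes "recn (length fs) g" "\<forall>f\<in>set fs. recn k f"
  shows "recn k (\<lambda>xs. g (map (\<lambda>f. f xs) fs))"
proof -
  obtain p where p: "\<forall>xs. length xs = length fs \<longrightarrow> prog_eval p xs (g xs)"
    using assms(1) by (auto simp: recn_def)
  obtain q where q: "\<forall>f\<in>set fs. \<forall>xs. length xs = k \<longrightarrow> prog_eval (q f) xs (f xs)"
    using assms(2) unfolding recn_def by metis
  have "prog_eval (Comp_Prog p (map q fs)) xs (g (map (\<lambda>f. f xs) fs))" if "length xs = k" for xs
  proof (rule prog_eval.Comp)
    show "list_all2 (\<lambda>q y. prog_eval q xs y) (map q fs) (map (\<lambda>f. f xs) fs)"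
      using q that by (auto simp: list_all2_conv_all_nth)
    show "prog_eval p (map (\<lambda>f. f xs) fs) (g (map (\<lambda>f. f xs) fs))"
      using p by simp
  qed
  then show ?thesis
    unfolding recn_def by blast
qed

lemma recn_comp1: "recn 1 g \<Longrightarrow> recn k a \<Longrightarrow> recn k (\<lambda>xs. g [a xs])"
  using recn_comp[of "[a]" g k] by simp

lemma recn_comp2: "recn 2 g \<Longrightarrow> recn k a \<Longrightarrow> recn k b \<Longrightarrow> recn k (\<lambda>xs. g [a xs, b xs])"
  using recn_comp[of "[a, b]" g k] by (simp add: numeral_2_eq_2)

lemma recn_zero: "recn k (\<lambda>xs. 0)"
  unfolding recn_def by (auto intro!: exI[of _ Zero_Prog] prog_eval.Zero)

lemma recn_Suc:
  assumes "recn k a"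
  shows "recn k (\<lambda>xs. Suc (a xs))"
proof -
  have "prog_eval Succ_Prog xs (Suc (hd xs))" if "length xs = 1" for xs
    using that by (cases xs) (auto intro: prog_eval.Succ)
  then have "recn 1 (\<lambda>xs. Suc (hd xs))"
    unfolding recn_def by blast
  from recn_comp1[OF this assms] show ?thesis
    by simp
qed

lemma recn_const: "recn k (\<lambda>xs. c)"
  by (induction c) (auto intro: recn_zero recn_Suc)

lemma recn_rec_base:
  assumes "recn k f" "recn (Suc (Suc k)) g"
  shows "recn (Suc k) (\<lambda>xs. rec_nat (f (tl xs)) (\<lambda>i y. g (i # y # tl xs)) (hd xs))"
proof -
  obtain p q where p: "\<And>xs. length xs = k \<Longrightarrow> prog_eval p xs (f xs)"
    and q: "\<And>xs. length xs = Suc (Suc k) \<Longrightarrow> prog_eval q xs (g xs)"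
    using assms by (auto simp: recn_def)
  have "prog_eval (Rec_Prog p q) (m # xs) (rec_nat (f xs) (\<lambda>i y. g (i # y # xs)) m)"
    if "length xs = k" for m xs
    using that by (induction m) (auto intro!: prog_eval.Rec_0 prog_eval.Rec_Suc p q)
  then have "prog_eval (Rec_Prog p q) xs (rec_nat (f (tl xs)) (\<lambda>i y. g (i # y # tl xs)) (hd xs))"
    if "length xs = Suc k" for xs
    using that by (cases xs) auto
  then show ?thesis
    unfolding recn_def by blast
qed

text \<open>\<open>Rec_Prog\<close> recurses on its first input. Composition with \<open>h\<close>
  followed by all projections puts the iteration count \<open>h xs\<close> in front of the unchanged
  inputs, so count and start value may be arbitrary functions.\<close>

lemma recn_rec:
  assumes "recn k a" "recn k h"
    and "recn (Suc (Suc k)) (\<lambda>zs. g (zs ! 0) (zs ! 1) (drop 2 zs))"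
  shows "recn k (\<lambda>xs. rec_nat (a xs) (\<lambda>i y. g i y xs) (h xs))"
proof -
  have "recn (length (h # map (\<lambda>i xs. xs ! i) [0..<k]))
      (\<lambda>xs. rec_nat (a (tl xs)) (\<lambda>i y. g i y (tl xs)) (hd xs))"
    using recn_rec_base[OF assms(1,3)] by (simp add: numeral_2_eq_2)
  moreover have "\<forall>f\<in>set (h # map (\<lambda>i xs. xs ! i) [0..<k]). recn k f"
    using assms(2) by (auto intro: recn_nth)
  ultimately have "recn k (\<lambda>xs. (\<lambda>xs. rec_nat (a (tl xs)) (\<lambda>i y. g i y (tl xs)) (hd xs))
      (map (\<lambda>f. f xs) (h # map (\<lambda>i xs. xs ! i) [0..<k])))"
    by (rule recn_comp)
  then show ?thesis
  proof (rule recn_cong)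
    fix xs :: "nat list"
    assume "length xs = k"
    then have "map (\<lambda>f. f xs) (map (\<lambda>i xs. xs ! i) [0..<k]) = xs"
      by (auto simp: list_eq_iff_nth_eq)
    then show "(\<lambda>xs. rec_nat (a (tl xs)) (\<lambda>i y. g i y (tl xs)) (hd xs))
        (map (\<lambda>f. f xs) (h # map (\<lambda>i xs. xs ! i) [0..<k])) =
        rec_nat (a xs) (\<lambda>i y. g i y xs) (h xs)"
      by simp
  qed
qed

lemma recn_add:
  assumes "recn k a" "recn k b"
  shows "recn k (\<lambda>xs. a xs + b xs)"
proof -
  have "recn k (\<lambda>xs. rec_nat (a xs) (\<lambda>i y. Suc y) (b xs))"
    using assms by (intro recn_rec recn_Suc recn_nth) auto
  moreover have "rec_nat m (\<lambda>i y. Suc y) n = m + n" for m n :: nat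
    by (induction n) auto
  ultimately show ?thesis
    by simp
qed

lemma recn_diff:
  assumes "recn k a" "recn k b"
  shows "recn k (\<lambda>xs. a xs - b xs)"
proof -
  have pred: "recn j (\<lambda>xs. c xs - 1)" if "recn j c" for j c
  proof -
    have "recn j (\<lambda>xs. rec_nat 0 (\<lambda>i y. i) (c xs))"
      using that by (intro recn_rec recn_zero recn_nth) auto
    moreover have "rec_nat 0 (\<lambda>i y. i) n = n - 1" for n :: nat
      by (cases n) auto
    ultimately show ?thesis
      by simp
  qed
  have "recn k (\<lambda>xs. rec_nat (a xs) (\<lambda>i y. y - 1) (b xs))"
    using assms by (intro recn_rec pred recn_nth) auto
  moreover have "rec_nat m (\<lambda>i y. y - 1) n = m - n" for m n :: nat
    by (induction n) auto
  ultimately show ?thesis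
    by simp
qed

lemma recn_triangle:
  assumes "recn k a"
  shows "recn k (\<lambda>xs. triangle (a xs))"
proof -
  have "recn k (\<lambda>xs. rec_nat 0 (\<lambda>i y. y + Suc i) (a xs))"
    using assms by (intro recn_rec recn_add recn_Suc recn_zero recn_nth) auto
  moreover have "rec_nat 0 (\<lambda>i y. y + Suc i) n = triangle n" for n :: nat
    by (induction n) auto
  ultimately show ?thesis
    by simp
qed

lemma recn_prod_encode:
  assumes "recn k a" "recn k b"
  shows "recn k (\<lambda>xs. prod_encode (a xs, b xs))"
  unfolding prod_encode_def prod.case by (intro recn_add recn_triangle assms)

lemma recn_if_zero:
  assumes "recn k a" "recn k b" "recn k c"
  shows "recn k (\<lambda>xs. if c xs = 0 then a xs else b xs)"
proof -
  have b: "recn (Suc (Suc k)) (\<lambda>zs. b (drop 2 zs))"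
  proof -
    have "recn (Suc (Suc k)) (\<lambda>zs. b (map (\<lambda>f. f zs) (map (\<lambda>i zs. zs ! (i + 2)) [0..<k])))"
      using assms(2) by (intro recn_comp) (auto intro!: recn_nth)
    then show ?thesis
    proof (rule recn_cong)
      fix zs :: "nat list"
      assume "length zs = Suc (Suc k)"
      then have "map (\<lambda>f. f zs) (map (\<lambda>i zs. zs ! (i + 2)) [0..<k]) = drop 2 zs"
        by (auto simp: list_eq_iff_nth_eq add.commute)
      then show "b (map (\<lambda>f. f zs) (map (\<lambda>i zs. zs ! (i + 2)) [0..<k])) = b (drop 2 zs)"
        by (simp only:)
    qed
  qed
  have "recn k (\<lambda>xs. rec_nat (a xs) (\<lambda>i y. b xs) (c xs))"
    by (rule recn_rec[OF assms(1,3) b])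
  moreover have "rec_nat m (\<lambda>i y. n) l = (if l = 0 then m else n)" for m n l :: nat
    by (cases l) auto
  ultimately show ?thesis
    by simp
qed

text \<open>The index of the diagonal on which the Cantor enumeration visits a number.\<close>

definition diag :: "nat \<Rightarrow> nat" where
  "diag n = fst (prod_decode n) + snd (prod_decode n)"

text \<open>The codes on diagonal \<open>d\<close> are the numbers from \<open>triangle d\<close> up
  to \<open>triangle (Suc d) - 1\<close>, so the diagonal advances exactly when the successor
  reaches \<open>triangle (Suc d)\<close>; truncated subtraction expresses that comparison. This
  makes unpairing primitive recursive.\<close>

lemma diag_Suc: "diag (Suc n) = (if triangle (Suc (diag n)) - Suc n = 0 then Suc (diag n) else diag n)"
proof -
  obtain a b where ab: "prod_decode n = (a, b)" by force
  then have n: "n = prod_encode (a, b)" by (metis prod_decode_inverse)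
  show ?thesis
  proof (cases b)
    case 0
    then have "Suc n = prod_encode (0, Suc a)"
      by (simp add: n prod_encode_def)
    then have "prod_decode (Suc n) = (0, Suc a)"
      by simp
    moreover have "triangle (Suc a) - Suc n = 0"
      using 0 by (simp add: n prod_encode_def)
    ultimately show ?thesis
      using 0 ab by (simp add: diag_def)
  next
    case (Suc b')
    then have "Suc n = prod_encode (Suc a, b')"
      by (simp add: n prod_encode_def)
    then have "prod_decode (Suc n) = (Suc a, b')"
      by simp
    moreover have "triangle (Suc (a + b)) - Suc n \<noteq> 0"
      using Suc by (simp add: n prod_encode_def)
    ultimately show ?thesis
      using Suc ab by (simp add: diag_def del: triangle_Suc)
  qed
qed

lemma diag_rec: "diag n = rec_nat 0 (\<lambda>i y. if triangle (Suc y) - Suc i = 0 then Suc y else y) n"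
proof (induction n)
  case 0
  have "prod_encode (0, 0) = 0"
    by (simp add: prod_encode_def)
  then have "prod_decode 0 = (0, 0)"
    by (metis prod_encode_inverse)
  then show ?case
    by (simp add: diag_def)
next
  case (Suc n)
  then show ?case
    by (simp only: diag_Suc old.nat.simps)
qed

lemma recn_diag:
  assumes "recn k a"
  shows "recn k (\<lambda>xs. diag (a xs))"
  unfolding diag_rec
  using assms
  by (intro recn_rec recn_if_zero recn_diff recn_triangle recn_Suc recn_nth recn_zero) auto

lemma recn_fst_decode:
  assumes "recn k a"
  shows "recn k (\<lambda>xs. fst (prod_decode (a xs)))"
proof -
  have "fst (prod_decode n) = n - triangle (diag n)" for n
  proof -
    have "n = prod_encode (prod_decode n)" by simp
    also have "\<dots> = triangle (diag n) + fst (prod_decode n)"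
      by (cases "prod_decode n") (simp add: prod_encode_def diag_def)
    finally show ?thesis by simp
  qed
  then show ?thesis
    using recn_diff[OF assms recn_triangle[OF recn_diag[OF assms]]] by simp
qed

lemma recn_snd_decode:
  assumes "recn k a"
  shows "recn k (\<lambda>xs. snd (prod_decode (a xs)))"
  using recn_diff[OF recn_diag[OF assms] recn_fst_decode[OF assms]] by (simp add: diag_def)

text \<open>A bijection rather than an injection: every number is the code of something, so a search
  through all numbers is a search through all witnesses. Finite types cannot be instances, which is
  why field elements appear in computations only as numbers.\<close>

class coded =
  fixes code :: "'a \<Rightarrow> nat"
  assumes bij_code: "bij code"

lemma code_eq_iff [simp]: "code x = code y \<longleftrightarrow> x = y"
  using bij_code by (metis bij_is_inj inj_eq)

lemma code_surj: obtains x where "code x = n"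
  using bij_code by (metis bij_pointE)

instantiation nat :: coded
begin
definition code_nat :: "nat \<Rightarrow> nat" where [simp]: "code_nat n = n"
instance by standard (simp add: code_nat_def[abs_def] bij_def surj_def)
end

instantiation prod :: (coded, coded) coded
begin
definition code_prod :: "'a \<times> 'b \<Rightarrow> nat" where "code_prod z = prod_encode (map_prod code code z)"
instance
proof
  have "bij (map_prod (code :: 'a \<Rightarrow> nat) (code :: 'b \<Rightarrow> nat))"
    by (intro bijI prod.inj_map map_prod_surj bij_is_inj[OF bij_code] bij_is_surj[OF bij_code])
  then have "bij (prod_encode \<circ> map_prod (code :: 'a \<Rightarrow> nat) (code :: 'b \<Rightarrow> nat))"
    by (intro bij_comp bij_prod_encode)
  then show "bij (code :: 'a \<times> 'b \<Rightarrow> nat)"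
    by (simp add: code_prod_def[abs_def] o_def)
qed
end

instantiation list :: (coded) coded
begin
definition code_list :: "'a list \<Rightarrow> nat" where "code_list xs = list_encode (map code xs)"
instance
proof
  have "surj (map (code :: 'a \<Rightarrow> nat))"
    by (rule surjI[of _ "map (inv_into UNIV code)"])
       (simp add: o_def surj_f_inv_f[OF bij_is_surj[OF bij_code]])
  then have "bij (map (code :: 'a \<Rightarrow> nat))"
    using bij_is_inj[OF bij_code] by (intro bijI list.inj_map)
  then have "bij (list_encode \<circ> map (code :: 'a \<Rightarrow> nat))"
    by (intro bij_comp bij_list_encode)
  then show "bij (code :: 'a list \<Rightarrow> nat)"
    by (simp add: code_list_def[abs_def] o_def)
qed
end

lemma code_Pair: "code (a, b) = prod_encode (code a, code b)"
  by (simp add: code_prod_def)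

lemma code_Nil: "code [] = 0"
  by (simp add: code_list_def)

lemma code_Cons: "code (x # xs) = Suc (code (x, xs))"
  by (simp add: code_list_def code_Pair)

text \<open>The code of a list thereby serves as an iteration count that is certain to exhaust the
  list.\<close>

lemma length_le_code: "length xs \<le> code xs"
proof (induction xs)
  case (Cons x xs)
  then show ?case
    using le_prod_encode_2[of "code xs" "code x"] by (simp add: code_Cons code_Pair)
qed simp

section \<open>Computability of functions between coded types\<close>

definition computable :: "('a::coded \<Rightarrow> 'b::coded) \<Rightarrow> bool" where
  "computable f \<longleftrightarrow> (\<exists>p. \<forall>x. prog_eval p [code x] (code (f x)))"

definition decidable :: "('a::coded \<Rightarrow> bool) \<Rightarrow> bool" where
  "decidable P \<longleftrightarrow> computable (\<lambda>x. if P x then 1 else 0 :: nat)"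

text \<open>As \<open>code\<close> is onto, the program halts on every number, and determinism turns
  its output into a function on all numbers, to which the closure properties of \<open>recn\<close>
  apply.\<close>

lemma computable_recn:
  assumes "computable f"
  obtains F where "recn 1 F" "\<And>x. F [code x] = code (f x)"
proof -
  obtain p where p: "\<forall>x. prog_eval p [code x] (code (f x))"
    using assms by (auto simp: computable_def)
  define F where "F xs = (THE y. prog_eval p xs y)" for xs
  have F: "prog_eval p [n] y \<Longrightarrow> F [n] = y" for n y
    unfolding F_def by (rule the_equality) (auto dest: prog_eval_deterministic)
  have "prog_eval p xs (F xs)" if len: "length xs = 1" for xs
  proof -
    obtain n where "xs = [n]" using len by (cases xs) auto
    moreover obtain x where "code (x :: 'a) = n" by (rule code_surj)
    ultimately show ?thesis using p F by metis
  qed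
  then have "recn 1 F" by (auto simp: recn_def)
  moreover have "F [code x] = code (f x)" for x
    using p F by blast
  ultimately show ?thesis by (rule that)
qed

lemma recn_computable:
  assumes "recn 1 F" "\<And>x. code (f x) = F [code x]"
  shows "computable f"
proof -
  obtain p where "\<And>xs. length xs = 1 \<Longrightarrow> prog_eval p xs (F xs)"
    using assms(1) by (auto simp: recn_def)
  then show ?thesis
    unfolding computable_def assms(2) by (intro exI[of _ p]) simp
qed

lemma computable_cong: "computable f \<Longrightarrow> (\<And>z. f z = g z) \<Longrightarrow> computable g"
  by (simp add: computable_def)

named_theorems computable_intros

lemma computable_id [computable_intros]: "computable (\<lambda>z. z)"
  by (rule recn_computable[OF recn_nth[of 0]]) auto

lemma computable_const [computable_intros]: "computable (\<lambda>z. c)"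
  by (rule recn_computable[OF recn_const]) auto

lemma computable_lift1:
  assumes "recn 1 G" "\<And>x. code (g x) = G [code x]" "computable a"
  shows "computable (\<lambda>z. g (a z))"
proof -
  obtain A where A: "recn 1 A" "\<And>x. A [code x] = code (a x)"
    using computable_recn[OF assms(3)] by blast
  show ?thesis
    by (rule recn_computable[OF recn_comp1[OF assms(1) A(1)]]) (simp add: A assms)
qed

lemma computable_lift2:
  assumes "recn 2 G" "\<And>x y. code (g x y) = G [code x, code y]" "computable a" "computable b"
  shows "computable (\<lambda>z. g (a z) (b z))"
proof -
  obtain A where A: "recn 1 A" "\<And>x. A [code x] = code (a x)"
    using computable_recn[OF assms(3)] by blast
  obtain B where B: "recn 1 B" "\<And>x. B [code x] = code (b x)"
    using computable_recn[OF assms(4)] by blast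
  show ?thesis
    by (rule recn_computable[OF recn_comp2[OF assms(1) A(1) B(1)]]) (simp add: A B assms)
qed

lemma computable_compose:
  assumes "computable g" "computable a"
  shows "computable (\<lambda>z. g (a z))"
proof -
  obtain G where G: "recn 1 G" "\<And>x. G [code x] = code (g x)"
    using computable_recn[OF assms(1)] by blast
  show ?thesis
    by (rule computable_lift1[OF G(1) _ assms(2)]) (simp add: G)
qed

lemma computable_Pair [computable_intros]:
  "computable a \<Longrightarrow> computable b \<Longrightarrow> computable (\<lambda>z. (a z, b z))"
  by (rule computable_lift2[where g = "Pair" and G = "\<lambda>xs. prod_encode (xs ! 0, xs ! 1)"])
     (auto intro!: recn_prod_encode recn_nth simp: code_prod_def)

lemma computable_fst [computable_intros]: "computable a \<Longrightarrow> computable (\<lambda>z. fst (a z))"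
  by (rule computable_lift1[where g = "fst" and G = "\<lambda>xs. fst (prod_decode (xs ! 0))"])
     (auto intro!: recn_fst_decode recn_nth simp: code_prod_def)

lemma computable_snd [computable_intros]: "computable a \<Longrightarrow> computable (\<lambda>z. snd (a z))"
  by (rule computable_lift1[where g = "snd" and G = "\<lambda>xs. snd (prod_decode (xs ! 0))"])
     (auto intro!: recn_snd_decode recn_nth simp: code_prod_def)

lemma computable_Suc [computable_intros]: "computable a \<Longrightarrow> computable (\<lambda>z. Suc (a z))"
  by (rule computable_lift1[where g = "Suc" and G = "\<lambda>xs. Suc (xs ! 0)"])
     (auto intro!: recn_Suc recn_nth simp: code_prod_def)

lemma computable_add [computable_intros]:
  "computable a \<Longrightarrow> computable b \<Longrightarrow> computable (\<lambda>z. a z + b z :: nat)"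
  by (rule computable_lift2[where g = "(+)" and G = "\<lambda>xs. xs ! 0 + xs ! 1"])
     (auto intro!: recn_add recn_nth simp: code_prod_def)

lemma computable_diff [computable_intros]:
  "computable a \<Longrightarrow> computable b \<Longrightarrow> computable (\<lambda>z. a z - b z :: nat)"
  by (rule computable_lift2[where g = "(-)" and G = "\<lambda>xs. xs ! 0 - xs ! 1"])
     (auto intro!: recn_diff recn_nth simp: code_prod_def)

lemma computable_code [computable_intros]: "computable a \<Longrightarrow> computable (\<lambda>z. code (a z))"
  by (rule computable_lift1[where g = "code" and G = "\<lambda>xs. xs ! 0"])
     (auto intro!:  recn_nth simp: code_prod_def)

lemma computable_from_code: "computable (\<lambda>z. code (a z)) \<Longrightarrow> computable a"
  by (simp add: computable_def)

text \<open>The step function is uncurried in the hypothesis so that it may mention the context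
  \<open>z\<close>. All rules for binding operators have this shape, which lets
  \<open>intro computable_intros\<close> descend through nested abstractions.\<close>

lemma computable_rec_nat [computable_intros]:
  assumes "computable a" "computable (\<lambda>w. g (fst w) (fst (snd w)) (snd (snd w)))" "computable h"
  shows "computable (\<lambda>z. rec_nat (a z) (\<lambda>i y. g z i y) (h z))"
proof -
  obtain A where A: "recn 1 A" "\<And>x. A [code x] = code (a x)"
    using computable_recn[OF assms(1)] by blast
  obtain G where G: "recn 1 G"
    "\<And>x. G [code x] = code (g (fst x) (fst (snd x)) (snd (snd x)))"
    using computable_recn[OF assms(2)] by blast
  obtain H where H: "recn 1 H" "\<And>x. H [code x] = code (h x)"
    using computable_recn[OF assms(3)] by blast
  have "recn 1 (\<lambda>xs. rec_nat (A [xs ! 0])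
      (\<lambda>i y. G [prod_encode (xs ! 0, prod_encode (i, y))]) (H [xs ! 0]))"
  proof (intro recn_rec recn_comp1[OF A(1)] recn_comp1[OF H(1)] recn_comp1[OF G(1)]
      recn_prod_encode recn_nth)
    show "recn (Suc (Suc 1)) (\<lambda>zs. drop 2 zs ! 0)"
      by (rule recn_cong[OF recn_nth[of 2]]) auto
  qed auto
  then show ?thesis
  proof (rule recn_computable)
    fix z
    have "code (rec_nat (a z) (\<lambda>i y. g z i y) n) =
        rec_nat (A [code z]) (\<lambda>i y. G [prod_encode (code z, prod_encode (i, y))]) n" for n
    proof (induction n)
      case (Suc n)
      have "G [prod_encode (code z, prod_encode (n, code y))] = code (g z n y)" for y
        using G(2)[of "(z, n, y)"] by (simp add: code_Pair)
      with Suc show ?case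
        by (metis (no_types, lifting) old.nat.simps(7))
    qed (simp add: A)
    then show "code (rec_nat (a z) (\<lambda>i y. g z i y) (h z)) =
        rec_nat (A [[code z] ! 0])
          (\<lambda>i y. G [prod_encode ([code z] ! 0, prod_encode (i, y))]) (H [[code z] ! 0])"
      by (simp add: H)
  qed
qed

lemma computable_if [computable_intros]:
  assumes "decidable P" "computable a" "computable b"
  shows "computable (\<lambda>z. if P z then a z else b z)"
proof -
  have "computable (\<lambda>z. rec_nat (b z) (\<lambda>i y. a z) (if P z then 1 else 0))"
    using assms by (intro computable_rec_nat computable_compose[OF assms(2)] computable_intros) (auto simp: decidable_def)
  moreover have "rec_nat (b z) (\<lambda>i y. a z) (if P z then 1 else 0) = (if P z then a z else b z)" for z
    by simp
  ultimately show ?thesis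
    by (rule computable_cong)
qed

lemma decidable_compose: "decidable P \<Longrightarrow> computable a \<Longrightarrow> decidable (\<lambda>z. P (a z))"
  unfolding decidable_def by (rule computable_compose)

lemma decidable_const [computable_intros]: "decidable (\<lambda>z. c)"
  unfolding decidable_def by (rule computable_const)

lemma decidable_not [computable_intros]:
  assumes "decidable P"
  shows "decidable (\<lambda>z. \<not> P z)"
proof -
  have "computable (\<lambda>z. if P z then 0 else 1 :: nat)"
    by (intro computable_intros assms)
  then show ?thesis
    unfolding decidable_def by (rule back_subst[of computable]) auto
qed

lemma decidable_conj [computable_intros]:
  assumes "decidable P" "decidable Q"
  shows "decidable (\<lambda>z. P z \<and> Q z)"
proof -
  have "computable (\<lambda>z. if P z then (if Q z then 1 else 0) else 0 :: nat)"
    by (intro computable_intros assms)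
  moreover have "(\<lambda>z. if P z then (if Q z then 1 else 0) else 0 :: nat) = (\<lambda>z. if P z \<and> Q z then 1 else 0)"
    by auto
  ultimately show ?thesis
    unfolding decidable_def by simp
qed

lemma decidable_imp [computable_intros]:
  assumes "decidable P" "decidable Q"
  shows "decidable (\<lambda>z. P z \<longrightarrow> Q z)"
  using decidable_not[OF decidable_conj[OF assms(1) decidable_not[OF assms(2)]]] by simp

lemma decidable_disj [computable_intros]:
  assumes "decidable P" "decidable Q"
  shows "decidable (\<lambda>z. P z \<or> Q z)"
  using decidable_imp[OF decidable_not[OF assms(1)] assms(2)] by (simp add: disj_imp)

lemma decidable_le [computable_intros]:
  assumes "computable a" "computable b"
  shows "decidable (\<lambda>z. a z \<le> (b z :: nat))"
proof -
  have "computable (\<lambda>z. 1 - (a z - b z))"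
    by (intro computable_intros assms)
  moreover have "1 - (m - n) = (if m \<le> n then 1 else 0)" for m n :: nat
    by auto
  ultimately show ?thesis
    by (simp add: decidable_def)
qed

lemma decidable_less [computable_intros]:
  assumes "computable a" "computable b"
  shows "decidable (\<lambda>z. a z < (b z :: nat))"
  using decidable_le[OF computable_Suc[OF assms(1)] assms(2)] by (simp add: Suc_le_eq)

lemma decidable_eq [computable_intros]:
  assumes "computable a" "computable b"
  shows "decidable (\<lambda>z. a z = b z)"
proof -
  have "decidable (\<lambda>z. code (a z) \<le> code (b z) \<and> code (b z) \<le> code (a z))"
    by (intro computable_intros assms)
  moreover have "code (a z) \<le> code (b z) \<and> code (b z) \<le> code (a z) \<longleftrightarrow> a z = b z" for z
    by (metis antisym code_eq_iff order_refl)
  ultimately show ?thesis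
    by simp
qed

section \<open>Lists, iteration and bounded enumeration\<close>

lemma computable_Cons [computable_intros]:
  assumes "computable a" "computable b"
  shows "computable (\<lambda>z. a z # b z)"
  by (rule computable_from_code, unfold code_Cons) (intro computable_intros assms)

text \<open>A nonempty list has code \<open>Suc (code (y, ys))\<close>. A recursion of that length
  that ignores its accumulator therefore returns its step function at the last index, which is
  \<open>code (y, ys)\<close>. The function \<open>b''\<close> is the second branch transported to
  codes.\<close>

lemma computable_case_list [computable_intros]:
  assumes "computable l" "computable a" "computable (\<lambda>w. b (fst w) (fst (snd w)) (snd (snd w)))"
  shows "computable (\<lambda>z. case l z of [] \<Rightarrow> a z | y # ys \<Rightarrow> b z y ys)"
proof -
  define b' where "b' w = code (b (fst w) (fst (snd w)) (snd (snd w)))" for w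
  define b'' where "b'' v = (let u = inv_into UNIV code v in b' u)" for v :: nat
  have inv: "inv_into UNIV code (code x) = x" for x :: "'a \<times> 'b \<times> 'b list"
    by (rule inv_f_f) (use bij_code bij_is_inj in blast)
  have surj: "code (inv_into UNIV code n :: 'a \<times> 'b \<times> 'b list) = n" for n
    by (rule surj_f_inv_f) (use bij_code bij_is_surj in blast)
  have "computable (\<lambda>w. b' w)"
    unfolding b'_def by (intro computable_intros assms)
  then obtain p where p: "prog_eval p [code w] (b' w)" for w
    by (auto simp: computable_def)
  have "prog_eval p [n] (b'' n)" for n
    using p[of "inv_into UNIV code n"] by (simp add: surj b''_def)
  then have "computable b''"
    by (auto simp: computable_def)
  have c: "computable (\<lambda>z. b'' (code (a z)))" if "computable a" for a :: "'x::coded \<Rightarrow> 'y::coded"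
    by (rule computable_compose[OF \<open>computable b''\<close> computable_code[OF that]])
  have "computable (\<lambda>z. rec_nat (code (a z)) (\<lambda>i y. b'' (code (code z, i))) (code (l z)))"
    by (intro computable_intros assms c)
  then have "computable (\<lambda>z. code (case l z of [] \<Rightarrow> a z | y # ys \<Rightarrow> b z y ys))"
  proof (rule back_subst[of computable], intro ext)
    fix z
    show "rec_nat (code (a z)) (\<lambda>i y. b'' (code (code z, i))) (code (l z)) =
        code (case l z of [] \<Rightarrow> a z | y # ys \<Rightarrow> b z y ys)"
    proof (cases "l z")
      case (Cons y ys)
      have "code (code z, code (y, ys)) = code (z, y, ys)"
        by (simp add: code_Pair)
      with Cons show ?thesis
        by (simp add: code_Cons b''_def inv b'_def)
    qed (simp add: code_Nil)
  qed
  then show ?thesis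
    by (rule computable_from_code)
qed

text \<open>The iteration runs on pairs of accumulator and remaining list. A pair with empty
  remainder is a fixed point, so the surplus iterations caused by counting up to the code of the
  list do no harm.\<close>

lemma computable_foldl [computable_intros]:
  assumes "computable (\<lambda>w. s (fst w) (fst (snd w)) (snd (snd w)))" "computable a" "computable l"
  shows "computable (\<lambda>z. foldl (\<lambda>acc y. s z acc y) (a z) (l z))"
proof -
  define t where "t z w = (case snd w of [] \<Rightarrow> w | y # ys \<Rightarrow> (s z (fst w) y, ys))" for z w
  have s: "computable (\<lambda>w. s (f w) (g w) (h w))"
    if "computable f" "computable g" "computable h" for f g h
    using computable_compose[OF assms(1), of "\<lambda>w. (f w, g w, h w)"] that
    by (simp add: computable_intros)
  have "computable (\<lambda>z. fst (rec_nat (a z, l z) (\<lambda>i w. t z w) (code (l z))))"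
    unfolding t_def by (intro computable_intros assms s)
  moreover have "fst (rec_nat (x, xs) (\<lambda>i w. t z w) n) = foldl (s z) x xs" if "length xs \<le> n" for x xs z n
  proof -
    have shift: "rec_nat w (\<lambda>i w. t z w) (Suc n) = rec_nat (t z w) (\<lambda>i w. t z w) n" for w n
      by (induction n) auto
    show ?thesis
      using that
    proof (induction xs arbitrary: x n)
      case Nil
      have "rec_nat (x, []) (\<lambda>i w. t z w) n = (x, [])"
        by (induction n) (auto simp: t_def)
      then show ?case by simp
    next
      case (Cons y ys)
      then obtain n' where "n = Suc n'" "length ys \<le> n'"
        by (cases n) auto
      moreover have "t z (x, y # ys) = (s z x y, ys)"
        by (simp add: t_def)
      ultimately show ?case
        using Cons.IH by (simp only: shift foldl_Cons)
    qed
  qed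
  then have "fst (rec_nat (a z, l z) (\<lambda>i w. t z w) (code (l z))) = foldl (\<lambda>acc y. s z acc y) (a z) (l z)" for z
    using length_le_code by blast
  ultimately show ?thesis
    by (rule computable_cong)
qed

lemma computable_mult [computable_intros]:
  assumes "computable a" "computable b"
  shows "computable (\<lambda>z. a z * b z :: nat)"
proof -
  have a: "computable (\<lambda>z. a (f z))" if "computable f" for f :: "'c::coded \<Rightarrow> 'a"
    by (rule computable_compose[OF assms(1) that])
  have "computable (\<lambda>z. rec_nat 0 (\<lambda>i y. a z + y) (b z))"
    by (intro computable_intros assms a)
  moreover have "rec_nat 0 (\<lambda>i y. m + y) n = m * n" for m n :: nat
    by (induction n) auto
  ultimately show ?thesis
    by (rule computable_cong)
qed

lemma computable_power [computable_intros]: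
  assumes "computable a" "computable b"
  shows "computable (\<lambda>z. a z ^ b z :: nat)"
proof -
  have a: "computable (\<lambda>z. a (f z))" if "computable f" for f :: "'c::coded \<Rightarrow> 'a"
    by (rule computable_compose[OF assms(1) that])
  have "computable (\<lambda>z. rec_nat 1 (\<lambda>i y. a z * y) (b z))"
    by (intro computable_intros assms a)
  moreover have "rec_nat 1 (\<lambda>i y. m * y) n = m ^ n" for m n :: nat
    by (induction n) auto
  ultimately show ?thesis
    by (rule computable_cong)
qed

lemma computable_rev [computable_intros]:
  assumes "computable l"
  shows "computable (\<lambda>z. rev (l z))"
proof -
  have "computable (\<lambda>z. foldl (\<lambda>acc y. y # acc) [] (l z))"
    by (intro computable_intros assms)
  moreover have "foldl (\<lambda>acc y. y # acc) ys xs = rev xs @ ys" for xs ys :: "'b list"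
    by (induction xs arbitrary: ys) auto
  ultimately show ?thesis
    by (simp add: computable_def)
qed

lemma computable_append [computable_intros]:
  assumes "computable l" "computable m"
  shows "computable (\<lambda>z. l z @ m z)"
proof -
  have "computable (\<lambda>z. foldl (\<lambda>acc y. y # acc) (m z) (rev (l z)))"
    by (intro computable_intros assms)
  moreover have "foldl (\<lambda>acc y. y # acc) ys (rev xs) = xs @ ys" for xs ys :: "'b list"
    by (induction xs) auto
  ultimately show ?thesis
    by (rule computable_cong)
qed

lemma computable_map [computable_intros]:
  assumes "computable (\<lambda>w. f (fst w) (snd w))" "computable l"
  shows "computable (\<lambda>z. map (\<lambda>y. f z y) (l z))"
proof -
  have f: "computable (\<lambda>w. f (a w) (b w))" if "computable a" "computable b" for a b
    using computable_compose[OF assms(1) computable_Pair[OF that]] by simp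
  have "computable (\<lambda>z. rev (foldl (\<lambda>acc y. f z y # acc) [] (l z)))"
    by (intro computable_intros assms(2) f)
  moreover have "foldl (\<lambda>acc y. f z y # acc) ys xs = rev (map (f z) xs) @ ys" for z xs ys
    by (induction xs arbitrary: ys) auto
  ultimately show ?thesis
    by (simp add: computable_def)
qed

lemma computable_concat [computable_intros]:
  assumes "computable l"
  shows "computable (\<lambda>z. concat (l z))"
proof -
  have "computable (\<lambda>z. foldl (\<lambda>acc y. acc @ y) [] (l z))"
    by (intro computable_intros assms)
  moreover have "foldl (\<lambda>acc y. acc @ y) ys xs = ys @ concat xs" for xs and ys :: "'b list"
    by (induction xs arbitrary: ys) auto
  ultimately show ?thesis
    by (simp add: computable_def)
qed

lemma computable_length [computable_intros]:
  assumes "computable l"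
  shows "computable (\<lambda>z. length (l z))"
proof -
  have "computable (\<lambda>z. foldl (\<lambda>acc y. Suc acc) 0 (l z))"
    by (intro computable_intros assms)
  moreover have "foldl (\<lambda>acc y. Suc acc) n xs = n + length xs" for xs :: "'b list" and n
    by (induction xs arbitrary: n) auto
  ultimately show ?thesis
    by (simp add: computable_def)
qed

lemma computable_sum_list [computable_intros]:
  assumes "computable l"
  shows "computable (\<lambda>z. sum_list (l z) :: nat)"
proof -
  have "computable (\<lambda>z. foldl (\<lambda>acc y. acc + y) 0 (l z))"
    by (intro computable_intros assms)
  moreover have "foldl (\<lambda>acc y. acc + y) n xs = n + sum_list xs" for xs :: "nat list" and n
    by (induction xs arbitrary: n) auto
  ultimately show ?thesis
    by (simp add: computable_def)
qed

lemma decidable_Ball [computable_intros]: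
  assumes "decidable (\<lambda>w. P (fst w) (snd w))" "computable l"
  shows "decidable (\<lambda>z. \<forall>y\<in>set (l z). P z y)"
proof -
  have P: "decidable (\<lambda>w. P (a w) (b w))" if "computable a" "computable b" for a b
    using decidable_compose[OF assms(1) computable_Pair[OF that]] by simp
  have "computable (\<lambda>z. foldl (\<lambda>acc y. if P z y then acc else 0) (1::nat) (l z))"
    by (intro computable_intros assms(2) P)
  moreover have "foldl (\<lambda>acc y. if P z y then acc else 0) n xs =
      (if \<forall>y\<in>set xs. P z y then n else 0)" for z xs and n :: nat
    by (induction xs arbitrary: n) auto
  ultimately show ?thesis
    unfolding decidable_def by (rule computable_cong)
qed

lemma computable_upt [computable_intros]:
  assumes "computable a"
  shows "computable (\<lambda>z. [0..<a z])"
proof -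
  have "computable (\<lambda>z. rec_nat [] (\<lambda>i acc. acc @ [i]) (a z))"
    by (intro computable_intros assms)
  moreover have "rec_nat [] (\<lambda>i acc. acc @ [i]) n = [0..<n]" for n
    by (induction n) auto
  ultimately show ?thesis
    by (rule computable_cong)
qed

lemma computable_replicate [computable_intros]:
  assumes "computable a" "computable b"
  shows "computable (\<lambda>z. replicate (a z) (b z))"
proof -
  have b: "computable (\<lambda>z. b (f z))" if "computable f" for f :: "'c::coded \<Rightarrow> 'a"
    by (rule computable_compose[OF assms(2) that])
  have "computable (\<lambda>z. rec_nat [] (\<lambda>i acc. b z # acc) (a z))"
    by (intro computable_intros assms b)
  moreover have "rec_nat [] (\<lambda>i acc. x # acc) n = replicate n x" for n and x :: 'b
    by (induction n) auto
  ultimately show ?thesis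
    by (rule computable_cong)
qed

lemma computable_funpow [computable_intros]:
  fixes f :: "'a::coded \<Rightarrow> 'b::coded \<Rightarrow> 'b"
  assumes "computable (\<lambda>w. f (fst w) (snd w))" "computable a" "computable b"
  shows "computable (\<lambda>z. ((\<lambda>y. f z y) ^^ a z) (b z))"
proof -
  have f: "computable (\<lambda>w. f (a w) (b w))" if "computable a" "computable b"
    for a :: "'x::coded \<Rightarrow> 'a" and b
    using computable_compose[OF assms(1) computable_Pair[OF that]] by simp
  have "computable (\<lambda>z. rec_nat (b z) (\<lambda>i y. f z y) (a z))"
    by (intro computable_intros assms(2,3) f)
  moreover have "rec_nat x (\<lambda>i y. f z y) n = (f z ^^ n) x" for n x z
    by (induction n) auto
  ultimately show ?thesis
    by (simp add: computable_def)
qed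

lemma computable_nth_default [computable_intros]:
  assumes "computable d" "computable l" "computable a"
  shows "computable (\<lambda>z. nth_default (d z) (l z) (a z))"
proof -
  have "computable (\<lambda>z. case ((\<lambda>xs. case xs of [] \<Rightarrow> [] | y # ys \<Rightarrow> ys) ^^ a z) (l z) of
      [] \<Rightarrow> d z | y # ys \<Rightarrow> y)"
    by (intro computable_intros assms)
  moreover have "(case ((\<lambda>xs. case xs of [] \<Rightarrow> [] | y # ys \<Rightarrow> ys) ^^ n) xs of
      [] \<Rightarrow> d | y # ys \<Rightarrow> y) = nth_default d xs n" for d n and xs :: "'b list"
  proof (induction n arbitrary: xs)
    case 0
    then show ?case by (cases xs) auto
  next
    case (Suc n)
    have Nil: "((\<lambda>xs. case xs of [] \<Rightarrow> [] | y # ys \<Rightarrow> ys) ^^ i) [] = []" for i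
      by (induction i) auto
    show ?case
      using Suc.IH by (cases xs) (simp_all add: funpow_Suc_right Nil del: funpow.simps(2))
  qed
  ultimately show ?thesis
    by (rule computable_cong)
qed

definition tuples :: "nat \<Rightarrow> 'a list \<Rightarrow> 'a list list" where
  "tuples n xs = ((\<lambda>ys. concat (map (\<lambda>x. map (\<lambda>y. x # y) ys) xs)) ^^ n) [[]]"

lemma set_tuples: "set (tuples n xs) = {ys. length ys = n \<and> set ys \<subseteq> set xs}"
proof (induction n)
  case (Suc n)
  have "set (tuples (Suc n) xs) = (\<Union>x\<in>set xs. (#) x ` set (tuples n xs))"
    by (simp add: tuples_def)
  also have "\<dots> = {ys. length ys = Suc n \<and> set ys \<subseteq> set xs}"
    unfolding Suc.IH by (fastforce simp: length_Suc_conv image_iff)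
  finally show ?case .
qed (auto simp: tuples_def)

lemma computable_tuples [computable_intros]:
  assumes "computable a" "computable l"
  shows "computable (\<lambda>z. tuples (a z) (l z))"
proof -
  have l: "computable (\<lambda>z. l (f z))" if "computable f" for f :: "'c::coded \<Rightarrow> 'a"
    by (rule computable_compose[OF assms(2) that])
  show ?thesis
    unfolding tuples_def by (intro computable_intros assms(1) l)
qed

text \<open>Post's theorem.\<close>

lemma post_program:
  assumes "decidable (\<lambda>w. Y (fst w) (snd w))" "decidable (\<lambda>w. N (fst w) (snd w))"
  obtains p where "\<And>x :: 'a::coded.
    (\<And>w :: 'w::coded. Y x w \<Longrightarrow> P x) \<Longrightarrow> (\<And>w :: 'v::coded. N x w \<Longrightarrow> \<not> P x) \<Longrightarrow>
    (\<exists>w. Y x w) \<or> (\<exists>w. N x w) \<Longrightarrow> prog_eval p [code x] (if P x then 1 else 0)"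
proof -
  define dw :: "nat \<Rightarrow> 'w" where "dw = inv_into UNIV code"
  define dv :: "nat \<Rightarrow> 'v" where "dv = inv_into UNIV code"
  have dw: "code (dw n) = n" "dw (code w) = w" for n w
    unfolding dw_def using bij_code[where ?'a = 'w] by (auto simp: bij_def surj_f_inv_f)
  have dv: "code (dv n) = n" "dv (code v) = v" for n v
    unfolding dv_def using bij_code[where ?'a = 'v] by (auto simp: bij_def surj_f_inv_f)
  have cdw: "computable dw"
    unfolding computable_def dw by (auto intro!: exI[of _ "Proj_Prog 0"] prog_eval.Proj[of 0 "[_]", simplified])
  have cdv: "computable dv"
    unfolding computable_def dv by (auto intro!: exI[of _ "Proj_Prog 0"] prog_eval.Proj[of 0 "[_]", simplified])
  have Y: "decidable (\<lambda>z. Y (a z) (dw (b z)))" if "computable a" "computable b"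
    for a :: "'b::coded \<Rightarrow> 'a" and b
    using decidable_compose[OF assms(1) computable_Pair[OF that(1) computable_compose[OF cdw that(2)]]]
    by simp
  have N: "decidable (\<lambda>z. N (a z) (dv (b z)))" if "computable a" "computable b"
    for a :: "'b::coded \<Rightarrow> 'a" and b
    using decidable_compose[OF assms(2) computable_Pair[OF that(1) computable_compose[OF cdv that(2)]]]
    by simp
  have "computable (\<lambda>z. if Y (snd z) (dw (fst z)) \<or> N (snd z) (dv (fst z)) then 0 else 1 :: nat)"
    by (intro computable_intros Y N)
  then obtain p where p: "\<And>w x. prog_eval p [prod_encode (w, code x)]
      (if Y x (dw w) \<or> N x (dv w) then 0 else 1)"
    by (auto simp: computable_def code_Pair)
  have "computable (\<lambda>z. if Y (snd z) (dw (fst z)) then 1 else 0 :: nat)"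
    by (intro computable_intros Y)
  then obtain r where r: "\<And>w x. prog_eval r [prod_encode (w, code x)] (if Y x (dw w) then 1 else 0)"
    by (auto simp: computable_def code_Pair)
  obtain e where e: "\<And>xs. length xs = 2 \<Longrightarrow> prog_eval e xs (prod_encode (xs ! 0, xs ! 1))"
    using recn_prod_encode[OF recn_nth[of 0 2] recn_nth[of 1 2]] by (auto simp: recn_def)
  have pe: "prog_eval (Comp_Prog p' [e]) [w, m] y" if "prog_eval p' [prod_encode (w, m)] y" for p' w m y
    by (rule prog_eval.Comp[OF _ that]) (use e[of "[w, m]"] in simp)
  \<comment> \<open>Every number is read both as a candidate for \<open>Y\<close> and as a candidate
    for \<open>N\<close>, so one minimization searches for both. The program \<open>t\<close> then
    tests \<open>Y\<close> again at the number found to learn the answer.\<close>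
  define s where "s = Min_Prog (Comp_Prog p [e])"
  define t where "t = Comp_Prog (Comp_Prog r [e]) [s, Proj_Prog 0]"
  show ?thesis
  proof (rule that)
    fix x
    assume YP: "\<And>w. Y x w \<Longrightarrow> P x" and NP: "\<And>w. N x w \<Longrightarrow> \<not> P x"
      and ex: "(\<exists>w. Y x w) \<or> (\<exists>w. N x w)"
    define w where "w = (LEAST w. Y x (dw w) \<or> N x (dv w))"
    have "\<exists>w. Y x (dw w) \<or> N x (dv w)"
      using ex dw dv by metis
    then have w: "Y x (dw w) \<or> N x (dv w)"
      unfolding w_def by (rule LeastI_ex)
    have least: "\<not> (Y x (dw i) \<or> N x (dv i))" if "i < w" for i
      using not_less_Least that unfolding w_def by blast
    have "prog_eval s [code x] w"
      unfolding s_def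
    proof (rule prog_eval.Min)
      show "prog_eval (Comp_Prog p [e]) [w, code x] 0"
        using pe[OF p[of w x]] w by simp
      show "\<exists>y>0. prog_eval (Comp_Prog p [e]) [i, code x] y" if "i < w" for i
        using pe[OF p[of i x]] least[OF that] by auto
    qed
    moreover have "prog_eval (Proj_Prog 0) [code x] (code x)"
      using prog_eval.Proj[of 0 "[code x]"] by simp
    ultimately have "prog_eval t [code x] (if Y x (dw w) then 1 else 0)"
      unfolding t_def by (intro prog_eval.Comp[of _ _ "[w, code x]"] pe r) auto
    moreover have "Y x (dw w) \<longleftrightarrow> P x"
      using w YP NP by blast
    ultimately show "prog_eval t [code x] (if P x then 1 else 0)"
      by simp
  qed
qed

lemma decidable_finite_mem:
  assumes "finite S" "computable a"
  shows "decidable (\<lambda>z. a z \<in> S)"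
  using assms(1)
proof induction
  case (insert s S)
  have "decidable (\<lambda>z. a z = s \<or> a z \<in> S)"
    by (intro computable_intros assms(2) insert.IH)
  then show ?case by simp
qed (simp add: computable_intros)

text \<open>The case distinction also covers the numbers that are not codes of elements of \<open>'k\<close>:
  on these \<open>inv_into\<close> has a fixed value.\<close>

lemma computable_finite_case:
  fixes enc :: "'k::finite \<Rightarrow> nat"
  assumes "computable a" "\<And>c. computable (\<lambda>z. F c z)"
  shows "computable (\<lambda>z. F (inv_into UNIV enc (a z)) z)"
proof -
  let ?dec = "inv_into UNIV enc"
  have dec: "decidable (\<lambda>z. ?dec (a z) = c)" for c
  proof -
    obtain m where m: "\<And>d. enc d < m"
      using finite_nat_set_iff_bounded[of "range enc"] by auto
    define u where "u = (SOME x::'k. False)"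
    have u: "?dec i = u" if "i \<notin> range enc" for i
    proof -
      have "(\<lambda>x. enc x = i) = (\<lambda>x. False)" using that by auto
      then show ?thesis by (simp add: inv_into_def u_def)
    qed
    have "?dec i = c \<longleftrightarrow> i \<in> {j. j < m \<and> ?dec j = c} \<or> m \<le> i \<and> u = c" for i
    proof (cases "i < m")
      case False
      then have "i \<notin> range enc" using m by auto
      with False u show ?thesis by auto
    qed auto
    moreover have "decidable (\<lambda>z. a z \<in> {j. j < m \<and> ?dec j = c} \<or> m \<le> a z \<and> u = c)"
      by (intro computable_intros decidable_finite_mem assms(1)) auto
    ultimately show ?thesis by simp
  qed
  \<comment> \<open>The fixed value \<open>F c z\<close> outside \<open>C\<close> makes the claim
    suitable for induction over finite sets; \<open>C = UNIV\<close> gives the lemma.\<close>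
  have "computable (\<lambda>z. if ?dec (a z) \<in> C then F (?dec (a z)) z else F c z)" if "finite C" for C c
    using that
  proof induction
    case (insert d C)
    have "computable (\<lambda>z. if ?dec (a z) = d then F d z
        else if ?dec (a z) \<in> C then F (?dec (a z)) z else F c z)"
      by (intro computable_if dec insert.IH assms(2))
    then show ?case
      by (rule computable_cong) auto
  qed (simp add: assms(2))
  from this[of UNIV] show ?thesis by simp
qed

section \<open>Polynomials in finitely many variables\<close>

text \<open>Besides \<open>{..<n}\<close>, the set \<open>S\<close> will be a set of variables that
  are independent modulo an ideal.\<close>

definition polys_in :: "nat set \<Rightarrow> 'k::comm_ring_1 mpoly set" where
  "polys_in S = {f. \<forall>e\<in>Poly_Mapping.keys f. Poly_Mapping.keys e \<subseteq> S}"

abbreviation pvar :: "nat \<Rightarrow> 'k::comm_ring_1 mpoly" where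
  "pvar j \<equiv> Poly_Mapping.single (Poly_Mapping.single j 1) 1"

abbreviation pconst :: "'k \<Rightarrow> 'k::comm_ring_1 mpoly" where
  "pconst c \<equiv> Poly_Mapping.single 0 c"

lemma carrier_mpoly_ring: "carrier (mpoly_ring n) = polys_in {..<n}"
  by (simp add: mpoly_ring_def polys_in_def)

lemma polys_in_mono: "S \<subseteq> T \<Longrightarrow> polys_in S \<subseteq> polys_in T"
  by (auto simp: polys_in_def)

lemma polys_in_0 [simp]: "0 \<in> polys_in S"
  by (simp add: polys_in_def)

lemma polys_in_single: "Poly_Mapping.keys e \<subseteq> S \<Longrightarrow> Poly_Mapping.single e c \<in> polys_in S"
  by (auto simp: polys_in_def)

lemma polys_in_pconst [simp]: "pconst c \<in> polys_in S"
  by (rule polys_in_single) simp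

lemma polys_in_1 [simp]: "1 \<in> polys_in S"
  using polys_in_pconst[of 1] by (simp del: polys_in_pconst)

lemma polys_in_pvar: "j \<in> S \<Longrightarrow> pvar j \<in> polys_in S"
  by (rule polys_in_single) simp

lemma polys_in_add: "f \<in> polys_in S \<Longrightarrow> g \<in> polys_in S \<Longrightarrow> f + g \<in> polys_in S"
  using keys_add[of f g] unfolding polys_in_def by blast

lemma polys_in_uminus: "f \<in> polys_in S \<Longrightarrow> - f \<in> polys_in S"
  by (simp add: polys_in_def)

lemma polys_in_diff: "f \<in> polys_in S \<Longrightarrow> g \<in> polys_in S \<Longrightarrow> f - g \<in> polys_in S"
  using polys_in_add[OF _ polys_in_uminus, of f S g] by simp

lemma polys_in_mult:
  assumes "f \<in> polys_in S" "g \<in> polys_in S"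
  shows "f * g \<in> polys_in S"
  unfolding polys_in_def
proof safe
  fix e i
  assume "e \<in> Poly_Mapping.keys (f * g)" and i: "i \<in> Poly_Mapping.keys e"
  then obtain a b where "e = a + b" "a \<in> Poly_Mapping.keys f" "b \<in> Poly_Mapping.keys g"
    using keys_mult[of f g] by blast
  with assms i keys_add[of a b] show "i \<in> S"
    unfolding polys_in_def by blast
qed

lemma polys_in_power: "f \<in> polys_in S \<Longrightarrow> f ^ k \<in> polys_in S"
  by (induction k) (auto intro: polys_in_mult)

lemma polys_in_sum: "(\<And>i. i \<in> A \<Longrightarrow> f i \<in> polys_in S) \<Longrightarrow> sum f A \<in> polys_in S"
  by (induction A rule: infinite_finite_induct) (auto intro: polys_in_add)

lemma polys_in_prod: "(\<And>i. i \<in> A \<Longrightarrow> f i \<in> polys_in S) \<Longrightarrow> prod f A \<in> polys_in S"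
  by (induction A rule: infinite_finite_induct) (auto intro: polys_in_mult)

lemmas polys_in_intros = polys_in_0 polys_in_1 polys_in_pconst polys_in_pvar polys_in_add
  polys_in_diff polys_in_mult polys_in_power polys_in_sum polys_in_prod

lemma polys_in_induct [consumes 1, case_names zero single add]:
  assumes "f \<in> polys_in S" "P 0"
    and "\<And>e c. Poly_Mapping.keys e \<subseteq> S \<Longrightarrow> P (Poly_Mapping.single e c)"
    and "\<And>f g. P f \<Longrightarrow> P g \<Longrightarrow> P (f + g)"
  shows "P f"
proof -
  have "P (\<Sum>e\<in>A. Poly_Mapping.single e (Poly_Mapping.lookup f e))"
    if "finite A" "A \<subseteq> Poly_Mapping.keys f" for A
    using that
  proof induction
    case (insert e A)
    then show ?case using assms(1,3,4) by (auto simp: polys_in_def)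
  qed (simp add: assms(2))
  from this[of "Poly_Mapping.keys f"] show ?thesis
    by (simp add: poly_mapping_sum_single)
qed

lemma monomial_induct [consumes 1, case_names zero add]:
  fixes e :: "nat \<Rightarrow>\<^sub>0 nat"
  assumes "Poly_Mapping.keys e \<subseteq> S" "P 0"
    and "\<And>e j. Poly_Mapping.keys e \<subseteq> S \<Longrightarrow> j \<in> S \<Longrightarrow> P e \<Longrightarrow> P (Poly_Mapping.single j 1 + e)"
  shows "P e"
  using assms(1)
proof (induction "\<Sum>i\<in>Poly_Mapping.keys e. Poly_Mapping.lookup e i" arbitrary: e)
  case 0
  then have "e = 0"
    by (intro poly_mapping_eqI) (auto simp: in_keys_iff)
  then show ?case using assms(2) by simp
next
  case (Suc d e)
  then obtain j where j: "j \<in> Poly_Mapping.keys e"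
    by (metis Zero_not_Suc sum.empty equals0I)
  define e' where "e' = e - Poly_Mapping.single j 1"
  have e: "e = Poly_Mapping.single j 1 + e'"
    using j by (intro poly_mapping_eqI)
      (auto simp: e'_def lookup_add lookup_minus lookup_single when_def in_keys_iff)
  have keys: "Poly_Mapping.keys e' \<subseteq> Poly_Mapping.keys e"
    by (auto simp: e'_def in_keys_iff lookup_minus)
  have "(\<Sum>i\<in>Poly_Mapping.keys e. Poly_Mapping.lookup e i) =
      (\<Sum>i\<in>Poly_Mapping.keys e. Poly_Mapping.lookup (Poly_Mapping.single j 1) i + Poly_Mapping.lookup e' i)"
    by (subst e) (simp add: lookup_add)
  also have "\<dots> = 1 + (\<Sum>i\<in>Poly_Mapping.keys e. Poly_Mapping.lookup e' i)"
    using j by (simp add: sum.distrib lookup_single when_def)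
  also have "(\<Sum>i\<in>Poly_Mapping.keys e. Poly_Mapping.lookup e' i) =
      (\<Sum>i\<in>Poly_Mapping.keys e'. Poly_Mapping.lookup e' i)"
    using keys by (intro sum.mono_neutral_right) (auto simp: in_keys_iff)
  finally have "d = (\<Sum>i\<in>Poly_Mapping.keys e'. Poly_Mapping.lookup e' i)"
    using Suc.hyps(2) by simp
  then have "P e'"
    using Suc keys by blast
  with assms(3) j keys Suc.prems show ?case
    unfolding e by (metis e subset_iff subset_trans)
qed

lemma single_mult_conv_sum:
  "Poly_Mapping.single s c * f =
    (\<Sum>e\<in>Poly_Mapping.keys f. Poly_Mapping.single (s + e) (c * Poly_Mapping.lookup f e))"
  by (subst poly_mapping_sum_single[of f, symmetric]) (simp add: sum_distrib_left mult_single)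

lemma lookup_single_mult:
  fixes s :: "'a::cancel_comm_monoid_add"
  shows "Poly_Mapping.lookup (Poly_Mapping.single s c * f) (s + e) = c * Poly_Mapping.lookup f e"
  by (auto simp: single_mult_conv_sum lookup_sum lookup_single when_def in_keys_iff)

lemma keys_single_mult:
  "Poly_Mapping.keys (Poly_Mapping.single s c * f) \<subseteq> (+) s ` Poly_Mapping.keys f"
  using keys_mult[of "Poly_Mapping.single s c" f] by (auto split: if_splits)

subsection \<open>The ascending chain condition\<close>

text \<open>Some subsequence is monotone. If it decreases, it is constant from the place where it
  attains its minimum, and its tail is increasing after all.\<close>

lemma incseq_subseq_nat:
  fixes s :: "nat \<Rightarrow> nat"
  shows "\<exists>g. strict_mono g \<and> incseq (\<lambda>i. s (g i))"
proof -
  obtain g where g: "strict_mono g" "monoseq (\<lambda>i. s (g i))"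
    using seq_monosub by blast
  show ?thesis
  proof (cases "incseq (\<lambda>i. s (g i))")
    case False
    with g(2) have dec: "decseq (\<lambda>i. s (g i))"
      by (auto simp: monoseq_iff)
    define m where "m = (LEAST m. \<exists>i. s (g i) = m)"
    have "\<exists>i. s (g i) = m"
      unfolding m_def by (rule LeastI_ex) blast
    then obtain N where N: "s (g N) = m" by blast
    have le: "m \<le> s (g i)" for i
      unfolding m_def by (rule Least_le) blast
    have "s (g (N + i)) = m" for i
      using decseqD[OF dec, of N "N + i"] N le[of "N + i"] by simp
    then have "incseq (\<lambda>i. s ((g \<circ> (\<lambda>i. N + i)) i))"
      by (simp add: incseq_def)
    moreover have "strict_mono (g \<circ> (\<lambda>i. N + i))"
      using g(1) by (auto simp: strict_mono_def)
    ultimately show ?thesis by blast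
  qed (use g in blast)
qed

text \<open>One coordinate is treated at a time; the earlier ones remain monotone along any further
  subsequence.\<close>

lemma dickson:
  fixes s :: "nat \<Rightarrow> nat \<Rightarrow> nat"
  shows "\<exists>g. strict_mono g \<and> (\<forall>x<n. incseq (\<lambda>i. s (g i) x))"
proof (induction n)
  case 0
  then show ?case by (intro exI[of _ id]) (simp add: strict_mono_def)
next
  case (Suc n)
  then obtain g where g: "strict_mono g" "\<forall>x<n. incseq (\<lambda>i. s (g i) x)" by blast
  obtain h where h: "strict_mono h" "incseq (\<lambda>i. s (g (h i)) n)"
    using incseq_subseq_nat[of "\<lambda>i. s (g i) n"] by blast
  have "incseq (\<lambda>i. s (g (h i)) x)" if "x < Suc n" for x
  proof (cases "x = n")
    case False
    then have "incseq (\<lambda>i. s (g i) x)" using g(2) that by simp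
    then show ?thesis
      using strict_mono_mono[OF h(1)] unfolding incseq_def mono_def by blast
  qed (use h in simp)
  moreover have "strict_mono (g \<circ> h)"
    using g(1) h(1) by (rule strict_mono_o)
  ultimately show ?case by (intro exI[of _ "g \<circ> h"]) (simp add: o_def)
qed

text \<open>The linear order on \<open>nat \<Rightarrow>\<^sub>0 nat\<close> is lexicographic by
  index. With infinitely many variables it has infinite descending chains (each variable exceeds the
  next one); the bound \<open>n\<close> on the variables reduces it to the well-founded order
  \<open>lexn\<close>.\<close>

lemma min_exponent:
  fixes A :: "(nat \<Rightarrow>\<^sub>0 nat) set"
  assumes "A \<noteq> {}" "\<And>e. e \<in> A \<Longrightarrow> Poly_Mapping.keys e \<subseteq> {..<n}"
  shows "\<exists>m\<in>A. \<forall>e\<in>A. m \<le> e"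
proof -
  define v where "v e = map (Poly_Mapping.lookup e) [0..<n]" for e :: "nat \<Rightarrow>\<^sub>0 nat"
  obtain e0 where "e0 \<in> A"
    using assms(1) by blast
  have "wf (inv_image (lexn less_than n) v)"
    by (intro wf_inv_image wf_lexn wf_less_than)
  from wfE_min[OF this \<open>e0 \<in> A\<close>] obtain m where
    m: "m \<in> A" "\<And>e. (v e, v m) \<in> lexn less_than n \<Longrightarrow> e \<notin> A"
    by (metis in_inv_image)
  have "m \<le> e" if "e \<in> A" for e
  proof (rule ccontr)
    assume "\<not> m \<le> e"
    then have "e < m" by simp
    then have "less_fun (Poly_Mapping.lookup e) (Poly_Mapping.lookup m)"
      by transfer
    then obtain k where k: "Poly_Mapping.lookup e k < Poly_Mapping.lookup m k"
      "\<forall>i<k. Poly_Mapping.lookup e i = Poly_Mapping.lookup m i"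
      by (auto simp: less_fun_def)
    have "k \<in> Poly_Mapping.keys m"
      using k(1) by (simp add: in_keys_iff)
    then have "k < n"
      using assms(2)[OF m(1)] by blast
    have split: "v x = map (Poly_Mapping.lookup x) [0..<k] @ Poly_Mapping.lookup x k #
        map (Poly_Mapping.lookup x) [Suc k..<n]" for x
    proof -
      have "[0..<n] = [0..<k] @ k # [Suc k..<n]"
        using \<open>k < n\<close> upt_add_eq_append[of 0 k "n - k"] by (simp add: upt_conv_Cons)
      then show ?thesis by (simp only: v_def map_append list.map)
    qed
    have pre: "map (Poly_Mapping.lookup e) [0..<k] = map (Poly_Mapping.lookup m) [0..<k]"
      using k(2) by simp
    have "(v e, v m) \<in> lexn less_than n"
      unfolding lexn_conv
    proof (intro CollectI case_prodI exI conjI)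
      show "length (v e) = n" "length (v m) = n"
        by (simp_all add: v_def)
      show "v e = map (Poly_Mapping.lookup m) [0..<k] @ Poly_Mapping.lookup e k #
        map (Poly_Mapping.lookup e) [Suc k..<n]"
        using split[of e] pre by simp
      show "v m = map (Poly_Mapping.lookup m) [0..<k] @ Poly_Mapping.lookup m k #
        map (Poly_Mapping.lookup m) [Suc k..<n]"
        by (rule split)
    qed (use k in simp)
    with m(2) that show False by blast
  qed
  with m(1) show ?thesis by blast
qed

text \<open>Free of ring records, so that arguments can use the type class operations on
  polynomials. \<open>is_ideal_iff\<close> identifies it with \<open>ideal\<close> in
  \<open>mpoly_ring n\<close>.\<close>

definition is_ideal :: "nat \<Rightarrow> 'k::comm_ring_1 mpoly set \<Rightarrow> bool" where
  "is_ideal n I \<longleftrightarrow> I \<subseteq> polys_in {..<n} \<and> 0 \<in> I \<and> (\<forall>f\<in>I. \<forall>g\<in>I. f + g \<in> I) \<and>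
    (\<forall>f\<in>polys_in {..<n}. \<forall>g\<in>I. f * g \<in> I)"

lemma is_idealD:
  assumes "is_ideal n I"
  shows "f \<in> I \<Longrightarrow> f \<in> polys_in {..<n}" "0 \<in> I" "f \<in> I \<Longrightarrow> g \<in> I \<Longrightarrow> f + g \<in> I"
    "f \<in> polys_in {..<n} \<Longrightarrow> g \<in> I \<Longrightarrow> f * g \<in> I"
  using assms unfolding is_ideal_def by blast+

lemma is_ideal_uminus:
  assumes "is_ideal n I" "f \<in> I"
  shows "- f \<in> I"
  using is_idealD(4)[OF assms(1) polys_in_uminus[OF polys_in_1] assms(2)] by simp

lemma is_ideal_diff:
  assumes "is_ideal n I" "f \<in> I" "g \<in> I"
  shows "f - g \<in> I"
  using is_idealD(3)[OF assms(1,2) is_ideal_uminus[OF assms(1,3)]] by simp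

lemma is_ideal_sum:
  assumes "is_ideal n I" "\<And>i. i \<in> A \<Longrightarrow> f i \<in> I"
  shows "sum f A \<in> I"
  using assms(2) by (induction A rule: infinite_finite_induct) (auto intro: is_idealD(2,3)[OF assms(1)])

text \<open>Hilbert's basis theorem by way of Dickson's lemma. From each step of a strictly
  ascending chain an element \<open>f i\<close> outside \<open>I i\<close> with least leading
  monomial is taken. For some \<open>i < j\<close> the leading monomial of \<open>f i\<close>
  divides that of \<open>f j\<close>.\<close>

lemma wf_ideals:
  "wf {(J, I :: 'k::field mpoly set). is_ideal n I \<and> is_ideal n J \<and> I \<subset> J}"
  unfolding wf_iff_no_infinite_down_chain
proof clarify
  fix I :: "nat \<Rightarrow> 'k mpoly set"
  assume "\<forall>i. (I (Suc i), I i) \<in> {(J, I). is_ideal n I \<and> is_ideal n J \<and> I \<subset> J}"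
  then have id: "is_ideal n (I i)" and sub: "I i \<subset> I (Suc i)" for i
    by auto
  have mono: "I i \<subseteq> I j" if "i \<le> j" for i j
    by (rule lift_Suc_mono_le[of I, OF _ that]) (use sub in blast)
  define lm where "lm f = Max (Poly_Mapping.keys f)" for f :: "'k mpoly"
  have lm: "lm f \<in> Poly_Mapping.keys f" "e \<in> Poly_Mapping.keys f \<Longrightarrow> e \<le> lm f" if "f \<noteq> 0" for f e
    using that unfolding lm_def by (auto intro!: Max_in)
  have "\<exists>f. f \<in> I (Suc i) - I i \<and> (\<forall>g \<in> I (Suc i) - I i. lm f \<le> lm g)" for i
  proof -
    have ne: "lm ` (I (Suc i) - I i) \<noteq> {}"
      using sub[of i] by blast
    have "Poly_Mapping.keys e \<subseteq> {..<n}" if e: "e \<in> lm ` (I (Suc i) - I i)" for e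
    proof -
      obtain f where f: "f \<in> I (Suc i)" "f \<notin> I i" "e = lm f"
        using e by blast
      then have "f \<noteq> 0" "f \<in> polys_in {..<n}"
        using is_idealD(1,2)[OF id] by metis+
      with lm f show ?thesis
        by (auto simp: polys_in_def)
    qed
    from min_exponent[OF ne this] show ?thesis by auto
  qed
  then obtain f where f': "\<forall>i. f i \<in> I (Suc i) - I i \<and> (\<forall>g \<in> I (Suc i) - I i. lm (f i) \<le> lm g)"
    using choice[of "\<lambda>i f. f \<in> I (Suc i) - I i \<and> (\<forall>g \<in> I (Suc i) - I i. lm f \<le> lm g)"] by auto
  then have f: "\<And>i. f i \<in> I (Suc i)" "\<And>i. f i \<notin> I i"
    "\<And>i g. g \<in> I (Suc i) \<Longrightarrow> g \<notin> I i \<Longrightarrow> lm (f i) \<le> lm g"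
    by simp_all
  obtain g where g: "strict_mono g" "\<forall>x<n. incseq (\<lambda>i. Poly_Mapping.lookup (lm (f (g i))) x)"
    using dickson[of n "\<lambda>i. Poly_Mapping.lookup (lm (f i))"] by blast
  define i j where "i = g 0" and "j = g 1"
  have ij: "i < j"
    using g(1) by (simp add: i_def j_def strict_mono_def)
  have f0: "f i \<noteq> 0" for i
    using f(2)[of i] is_idealD(2)[OF id] by metis
  have keys_lm: "Poly_Mapping.keys (lm (f i)) \<subseteq> {..<n}" for i
    using lm(1)[OF f0] f(1)[of i] is_idealD(1)[OF id] by (auto simp: polys_in_def)
  have le: "Poly_Mapping.lookup (lm (f i)) x \<le> Poly_Mapping.lookup (lm (f j)) x" for x
  proof (cases "x < n")
    case True
    then show ?thesis
      using g(2) unfolding i_def j_def incseq_def by simp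
  next
    case False
    then have "x \<notin> Poly_Mapping.keys (lm (f i))"
      using keys_lm by blast
    then show ?thesis
      by (simp add: in_keys_iff)
  qed
  define s where "s = lm (f j) - lm (f i)"
  have s: "s + lm (f i) = lm (f j)"
    by (intro poly_mapping_eqI) (simp add: s_def lookup_add lookup_minus le)
  define c where "c = Poly_Mapping.lookup (f j) (lm (f j)) / Poly_Mapping.lookup (f i) (lm (f i))"
  \<comment> \<open>Cancelling the leading term of \<open>f j\<close> leaves an element of
    \<open>I (Suc j)\<close> outside \<open>I j\<close> with a smaller leading monomial, against the
    choice of \<open>f j\<close>.\<close>
  define h where "h = f j - Poly_Mapping.single s c * f i"
  have lc: "Poly_Mapping.lookup (f i) (lm (f i)) \<noteq> 0"
    using lm(1)[OF f0] by (simp add: in_keys_iff)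
  have "Poly_Mapping.keys s \<subseteq> {..<n}"
    using keys_lm[of j] by (fastforce simp: s_def subset_iff in_keys_iff lookup_minus)
  then have mem: "Poly_Mapping.single s c * f i \<in> I j"
    using f(1)[of i] mono[of "Suc i" j] ij
    by (intro is_idealD(4)[OF id]) (auto intro: polys_in_single)
  have h: "h \<in> I (Suc j)" "h \<notin> I j"
  proof -
    show "h \<in> I (Suc j)"
      unfolding h_def using mem mono[of j "Suc j"] f(1) by (intro is_ideal_diff[OF id]) auto
    show "h \<notin> I j"
    proof
      assume "h \<in> I j"
      from is_idealD(3)[OF id this mem] show False
        using f(2)[of j] by (simp add: h_def)
    qed
  qed
  then have "h \<noteq> 0"
    using is_idealD(2)[OF id] by metis
  have "Poly_Mapping.lookup (Poly_Mapping.single s c * f i) (lm (f j)) =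
      Poly_Mapping.lookup (f j) (lm (f j))"
    using lookup_single_mult[of s c "f i" "lm (f i)"] lc by (simp add: s c_def)
  then have "lm h \<noteq> lm (f j)"
    using lm(1)[OF \<open>h \<noteq> 0\<close>] by (auto simp: h_def in_keys_iff lookup_minus)
  moreover have "lm h \<le> lm (f j)"
  proof -
    have "lm h \<in> Poly_Mapping.keys (f j) \<union> Poly_Mapping.keys (Poly_Mapping.single s c * f i)"
      using lm(1)[OF \<open>h \<noteq> 0\<close>] by (auto simp: h_def in_keys_iff lookup_minus)
    then consider "lm h \<in> Poly_Mapping.keys (f j)" | e where "e \<in> Poly_Mapping.keys (f i)" "lm h = s + e"
      using keys_single_mult by blast
    then show ?thesis
    proof cases
      case 2
      then have "s + e \<le> s + lm (f i)"
        using lm(2)[OF f0] by (intro add_left_mono) auto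
      with 2 s show ?thesis by simp
    qed (use lm(2)[OF f0] in blast)
  qed
  ultimately have "lm h < lm (f j)"
    by simp
  with f(3)[OF h] show False
    by simp
qed

section \<open>Spanning sets up to torsion\<close>

lemma pvar_power: "pvar j ^ t = Poly_Mapping.single (Poly_Mapping.single j t) (1 :: 'k::comm_ring_1)"
  by (induction t) (simp_all add: mult_single flip: single_add)

lemma polys_in_insert_conv_sum:
  fixes p :: "'k::comm_ring_1 mpoly"
  assumes "p \<in> polys_in (insert j S)"
  shows "\<exists>N a. (\<forall>s. a s \<in> polys_in S) \<and> (\<forall>s\<ge>N. a s = 0) \<and> p = (\<Sum>s<N. a s * pvar j ^ s)"
  using assms
proof (induction rule: polys_in_induct)
  case zero
  show ?case by (intro exI[of _ 0] exI[of _ "\<lambda>_. 0"]) simp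
next
  case (single e c)
  define t where "t = Poly_Mapping.lookup e j"
  define e' where "e' = e - Poly_Mapping.single j t"
  have e: "e = e' + Poly_Mapping.single j t"
    by (intro poly_mapping_eqI)
      (auto simp: e'_def t_def lookup_add lookup_minus lookup_single when_def)
  have "Poly_Mapping.lookup e' i = (if i = j then 0 else Poly_Mapping.lookup e i)" for i
    by (simp add: e'_def t_def lookup_minus lookup_single when_def)
  then have "Poly_Mapping.keys e' \<subseteq> Poly_Mapping.keys e - {j}"
    by (auto simp: in_keys_iff split: if_splits simp del: lookup_not_eq_zero_eq_in_keys)
  then have "Poly_Mapping.keys e' \<subseteq> S"
    using single by blast
  then have "Poly_Mapping.single e' c \<in> polys_in S"
    by (rule polys_in_single)
  moreover have "Poly_Mapping.single e c = Poly_Mapping.single e' c * pvar j ^ t"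
    unfolding pvar_power by (simp add: mult_single e)
  ultimately show ?case
    by (intro exI[of _ "Suc t"] exI[of _ "\<lambda>s. if s = t then Poly_Mapping.single e' c else 0"])
      (auto simp: if_distrib[of "\<lambda>x. x * _"] cong: if_cong)
next
  case (add f g)
  then obtain N a M b where
    a: "\<forall>s. a s \<in> polys_in S" "\<forall>s\<ge>N. a s = 0" "f = (\<Sum>s<N. a s * pvar j ^ s)" and
    b: "\<forall>s. b s \<in> polys_in S" "\<forall>s\<ge>M. b s = 0" "g = (\<Sum>s<M. b s * pvar j ^ s)"
    by blast
  have "f = (\<Sum>s<max N M. a s * pvar j ^ s)"
    unfolding a(3) using a(2) by (intro sum.mono_neutral_left) auto
  moreover have "g = (\<Sum>s<max N M. b s * pvar j ^ s)"
    unfolding b(3) using b(2) by (intro sum.mono_neutral_left) auto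
  ultimately have "f + g = (\<Sum>s<max N M. (a s + b s) * pvar j ^ s)"
    by (simp add: sum.distrib distrib_right)
  with a b show ?case
    by (intro exI[of _ "max N M"] exI[of _ "\<lambda>s. a s + b s"]) (auto intro: polys_in_add)
qed

lemma monomial_conv_prod:
  assumes "Poly_Mapping.keys e \<subseteq> {..<n}"
  shows "Poly_Mapping.single e (1 :: 'k::comm_ring_1) = (\<Prod>j<n. pvar j ^ Poly_Mapping.lookup e j)"
  using assms
proof (induction rule: monomial_induct)
  case (add e j)
  have "Poly_Mapping.single (Poly_Mapping.single j 1 + e) (1 :: 'k) = pvar j * Poly_Mapping.single e 1"
    by (simp add: mult_single)
  also have "pvar j = (\<Prod>i<n. pvar i ^ Poly_Mapping.lookup (Poly_Mapping.single j 1) i :: 'k mpoly)"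
  proof -
    have "(\<Prod>i<n. pvar i ^ Poly_Mapping.lookup (Poly_Mapping.single j 1) i) =
        (\<Prod>i<n. if i = j then pvar j else 1 :: 'k mpoly)"
      by (intro prod.cong) (auto simp: lookup_single when_def)
    with add(2) show ?thesis by simp
  qed
  finally show ?case
    by (simp add: add.IH lookup_add power_add prod.distrib)
qed simp

text \<open>\<open>IS\<close> says that the variables in \<open>S\<close> are algebraically
  independent modulo \<open>I\<close>, so K[x_S] embeds into K[x]/I and its nonzero elements can be
  inverted there without collapse.\<close>

locale torsion_ideal =
  fixes n :: nat and I :: "'k::field mpoly set" and S :: "nat set"
  assumes id: "is_ideal n I" and S: "S \<subseteq> {..<n}" and IS: "I \<inter> polys_in S \<subseteq> {0}"
begin

lemma SD: "f \<in> polys_in S \<Longrightarrow> f \<in> polys_in {..<n}"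
  using polys_in_mono[OF S] by blast

text \<open>Membership in the span of \<open>B\<close> over the field of fractions of K[x_S], taken
  in the corresponding localization of K[x]/I; \<open>h\<close> is the denominator that has been
  cleared.\<close>

definition sp :: "'k mpoly set \<Rightarrow> 'k mpoly \<Rightarrow> bool" where
  "sp B f \<longleftrightarrow> (\<exists>h p. h \<in> polys_in S \<and> h \<noteq> 0 \<and> (\<forall>b. p b \<in> polys_in S) \<and> h * f - (\<Sum>b\<in>B. p b * b) \<in> I)"

lemma spI:
  "h \<in> polys_in S \<Longrightarrow> h \<noteq> 0 \<Longrightarrow> (\<And>b. p b \<in> polys_in S) \<Longrightarrow> h * f - (\<Sum>b\<in>B. p b * b) \<in> I \<Longrightarrow> sp B f"
  unfolding sp_def by blast

lemma sp_base:
  assumes "finite B" "b \<in> B"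
  shows "sp B b"
proof (rule spI)
  have "(\<Sum>c\<in>B. (if c = b then 1 else 0) * c) = (\<Sum>c\<in>B. if c = b then b else 0)"
    by (intro sum.cong) auto
  with assms show "1 * b - (\<Sum>c\<in>B. (if c = b then 1 else 0) * c) \<in> I"
    using is_idealD(2)[OF id] by simp
qed auto

lemma sp_ideal: "f \<in> I \<Longrightarrow> sp B f"
  by (rule spI[of 1 "\<lambda>_. 0"]) auto

lemma sp_add:
  assumes "sp B f" "sp B g"
  shows "sp B (f + g)"
proof -
  obtain h p where h: "h \<in> polys_in S" "h \<noteq> 0" "\<forall>b. p b \<in> polys_in S" "h * f - (\<Sum>b\<in>B. p b * b) \<in> I"
    using assms(1) by (auto simp: sp_def)
  obtain h' p' where h': "h' \<in> polys_in S" "h' \<noteq> 0" "\<forall>b. p' b \<in> polys_in S" "h' * g - (\<Sum>b\<in>B. p' b * b) \<in> I"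
    using assms(2) by (auto simp: sp_def)
  have "h * h' * (f + g) - (\<Sum>b\<in>B. (h' * p b + h * p' b) * b) =
      h' * (h * f - (\<Sum>b\<in>B. p b * b)) + h * (h' * g - (\<Sum>b\<in>B. p' b * b))"
    by (simp add: algebra_simps sum.distrib sum_distrib_left)
  also have "\<dots> \<in> I"
    using h h' by (intro is_idealD(3,4)[OF id] SD) auto
  finally show ?thesis
    using h h' by (intro spI[of "h * h'" "\<lambda>b. h' * p b + h * p' b"]) (auto intro: polys_in_intros)
qed

lemma sp_mult:
  assumes "sp B f" "a \<in> polys_in S"
  shows "sp B (a * f)"
proof -
  obtain h p where h: "h \<in> polys_in S" "h \<noteq> 0" "\<forall>b. p b \<in> polys_in S" "h * f - (\<Sum>b\<in>B. p b * b) \<in> I"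
    using assms(1) by (auto simp: sp_def)
  have "h * (a * f) - (\<Sum>b\<in>B. (a * p b) * b) = a * (h * f - (\<Sum>b\<in>B. p b * b))"
    by (simp add: algebra_simps sum_distrib_left)
  also have "\<dots> \<in> I"
    using h assms by (intro is_idealD(4)[OF id] SD) auto
  finally show ?thesis
    using h assms by (intro spI[of h "\<lambda>b. a * p b"]) (auto intro: polys_in_intros)
qed

lemma sp_div:
  assumes "sp B (a * f)" "a \<in> polys_in S" "a \<noteq> 0"
  shows "sp B f"
proof -
  obtain h p where h: "h \<in> polys_in S" "h \<noteq> 0" "\<forall>b. p b \<in> polys_in S" "h * (a * f) - (\<Sum>b\<in>B. p b * b) \<in> I"
    using assms(1) by (auto simp: sp_def)
  then show ?thesis
    using assms by (intro spI[of "h * a" p]) (auto intro: polys_in_intros simp: mult.assoc)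
qed

lemma sp_sum: "(\<And>i. i \<in> A \<Longrightarrow> sp B (f i)) \<Longrightarrow> sp B (sum f A)"
  by (induction A rule: infinite_finite_induct) (auto intro: sp_add sp_ideal is_idealD(2)[OF id])

lemma sp_trans:
  assumes "sp B f" "\<And>b. b \<in> B \<Longrightarrow> sp C b"
  shows "sp C f"
proof -
  obtain h p where h: "h \<in> polys_in S" "h \<noteq> 0" "\<forall>b. p b \<in> polys_in S" "h * f - (\<Sum>b\<in>B. p b * b) \<in> I"
    using assms(1) by (auto simp: sp_def)
  have "sp C ((h * f - (\<Sum>b\<in>B. p b * b)) + (\<Sum>b\<in>B. p b * b))"
    using h assms(2) by (intro sp_add[OF sp_ideal] sp_sum sp_mult) auto
  then have "sp C (h * f)" by simp
  with h show ?thesis by (rule_tac sp_div)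
qed

text \<open>The leading coefficient of \<open>p\<close> as a polynomial in \<open>pvar j\<close>
  becomes \<open>h\<close>. The degree \<open>d\<close> is positive, since otherwise
  \<open>p\<close> would be a nonzero element of \<open>I\<close> in K[x_S].\<close>

lemma algebraic_variable:
  assumes "p \<in> I" "p \<noteq> 0" "p \<in> polys_in (insert j S)"
  shows "\<exists>d>0. \<exists>h a. h \<in> polys_in S \<and> h \<noteq> 0 \<and> (\<forall>s. a s \<in> polys_in S) \<and>
    h * pvar j ^ d - (\<Sum>s<d. a s * pvar j ^ s) \<in> I"
proof -
  obtain N a where a: "\<forall>s. a s \<in> polys_in S" "\<forall>s\<ge>N. a s = 0" "p = (\<Sum>s<N. a s * pvar j ^ s)"
    using polys_in_insert_conv_sum[OF assms(3)] by blast
  have ex: "\<exists>s. a s \<noteq> 0"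
    using assms(2) a(3) by (metis (no_types, lifting) mult_zero_left sum.neutral)
  define d where "d = Max {s. a s \<noteq> 0}"
  have fin: "finite {s. a s \<noteq> 0}"
    by (rule finite_subset[of _ "{..<N}"]) (use a(2) not_less in auto)
  have d: "a d \<noteq> 0"
    unfolding d_def using Max_in[OF fin] ex by auto
  have zero: "a s = 0" if "d < s" for s
    using Max_ge[OF fin, of s] that by (auto simp: d_def)
  have "p = (\<Sum>s<Suc d. a s * pvar j ^ s)"
    unfolding a(3) using a(2) zero by (intro sum.mono_neutral_cong) (auto simp: not_less)
  then have p: "p = a d * pvar j ^ d - (\<Sum>s<d. - a s * pvar j ^ s)"
    by (simp add: sum_negf)
  have "d > 0"
  proof (rule ccontr)
    assume "\<not> d > 0"
    then have "p \<in> polys_in S"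
      using p a(1) by simp
    with IS assms(1,2) show False by blast
  qed
  show ?thesis
  proof (intro exI[of _ d] conjI exI[of _ "a d"] exI[of _ "\<lambda>s. - a s"] allI)
    show "a d * pvar j ^ d - (\<Sum>s<d. - a s * pvar j ^ s) \<in> I"
      using assms(1) unfolding p[symmetric] .
  qed (simp_all add: a(1) d \<open>d > 0\<close> polys_in_uminus)
qed

text \<open>By maximality of \<open>S\<close>, every other variable is algebraic over the fractions
  in the variables of \<open>S\<close>. As for finite field extensions, the monomials in the other
  variables with exponents below the degrees \<open>d j\<close> span everything.\<close>

lemma finite_spanning_set:
  assumes max: "\<And>j. j < n \<Longrightarrow> j \<notin> S \<Longrightarrow> \<exists>p\<in>I. p \<noteq> 0 \<and> p \<in> polys_in (insert j S)"
  shows "\<exists>B. finite B \<and> B \<subseteq> polys_in {..<n} \<and> (\<forall>f\<in>polys_in {..<n}. sp B f)"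
proof -
  define T where "T = {..<n} - S"
  define rel where "rel j d \<longleftrightarrow> (\<exists>h a. h \<in> polys_in S \<and> h \<noteq> 0 \<and> (\<forall>s. a s \<in> polys_in S) \<and>
      h * pvar j ^ d - (\<Sum>s<d. a s * pvar j ^ s) \<in> I)" for j d
  have "\<exists>d>0. rel j d" if j: "j \<in> T" for j
  proof -
    obtain p where "p \<in> I" "p \<noteq> 0" "p \<in> polys_in (insert j S)"
      using max[of j] j by (auto simp: T_def)
    then show ?thesis
      unfolding rel_def by (rule algebraic_variable)
  qed
  then obtain d where d: "\<And>j. j \<in> T \<Longrightarrow> d j > 0" "\<And>j. j \<in> T \<Longrightarrow> rel j (d j)"
    by metis
  define E where "E = {e. Poly_Mapping.keys e \<subseteq> T \<and> (\<forall>j\<in>T. Poly_Mapping.lookup e j < d j)}"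
  define B where "B = (\<lambda>e. Poly_Mapping.single e (1::'k)) ` E"
  have "finite E"
  proof (rule inj_on_finite)
    show "inj_on (\<lambda>e. restrict (Poly_Mapping.lookup e) T) E"
    proof (rule inj_onI, rule poly_mapping_eqI)
      fix e e' i
      assume "e \<in> E" "e' \<in> E" and eq: "restrict (Poly_Mapping.lookup e) T = restrict (Poly_Mapping.lookup e') T"
      then have "i \<notin> T \<Longrightarrow> Poly_Mapping.lookup e i = 0 \<and> Poly_Mapping.lookup e' i = 0"
        unfolding E_def by (auto simp: in_keys_iff)
      with fun_cong[OF eq, of i] show "Poly_Mapping.lookup e i = Poly_Mapping.lookup e' i"
        by (cases "i \<in> T") auto
    qed
    show "(\<lambda>e. restrict (Poly_Mapping.lookup e) T) ` E \<subseteq> (\<Pi>\<^sub>E j\<in>T. {..<d j})"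
      by (auto simp: E_def)
    show "finite (\<Pi>\<^sub>E j\<in>T. {..<d j})"
      by (intro finite_PiE) (auto simp: T_def)
  qed
  then have finB: "finite B" by (simp add: B_def)
  have BP: "B \<subseteq> polys_in {..<n}"
    unfolding B_def E_def T_def by (auto intro!: polys_in_single)
  have step: "sp B (pvar j * f)" if f: "sp B f" and j: "j < n" for f j
  proof (cases "j \<in> S")
    case True
    then show ?thesis by (intro sp_mult f polys_in_pvar)
  next
    case False
    with j have jT: "j \<in> T" by (simp add: T_def)
    have base: "sp B (pvar j * b)" if b: "b \<in> B" for b
    proof -
      obtain e where e: "e \<in> E" "b = Poly_Mapping.single e 1"
        using b by (auto simp: B_def)
      show ?thesis
      proof (cases "Suc (Poly_Mapping.lookup e j) < d j")
        case True
        have "Poly_Mapping.single j 1 + e \<in> E"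
          using e(1) True jT keys_add[of "Poly_Mapping.single j 1" e]
          by (auto simp: E_def lookup_add lookup_single when_def)
        then show ?thesis
          by (intro sp_base finB) (auto simp: B_def e mult_single)
      next
        case False
        then have dj: "Suc (Poly_Mapping.lookup e j) = d j"
          using e(1) jT by (fastforce simp: E_def)
        \<comment> \<open>The exponent of \<open>j\<close> in \<open>b\<close> is already maximal.
          So \<open>b\<close> is \<open>u\<close> times \<open>pvar j ^ (d j - 1)\<close>, and
          multiplying the relation for \<open>pvar j ^ d j\<close> by \<open>u\<close> expresses
          \<open>pvar j * b\<close> through the elements \<open>u * pvar j ^ s\<close> of
          \<open>B\<close>.\<close>
        define e' where "e' = e - Poly_Mapping.single j (Poly_Mapping.lookup e j)"
        have lookup_e': "Poly_Mapping.lookup (e' + Poly_Mapping.single j s) i =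
            (if i = j then s else Poly_Mapping.lookup e i)" for i s
          by (simp add: e'_def lookup_add lookup_minus lookup_single when_def)
        have e'E: "e' + Poly_Mapping.single j s \<in> E" if "s < d j" for s
        proof -
          have "Poly_Mapping.keys (e' + Poly_Mapping.single j s) \<subseteq> insert j (Poly_Mapping.keys e)"
            by (auto simp: in_keys_iff lookup_e' split: if_splits simp del: lookup_not_eq_zero_eq_in_keys)
          moreover have "Poly_Mapping.lookup (e' + Poly_Mapping.single j s) i < d i" if "i \<in> T" for i
            using \<open>s < d j\<close> that e(1) unfolding lookup_e' by (auto simp: E_def)
          ultimately show ?thesis
            using e(1) jT unfolding E_def by blast
        qed
        define u where "u = Poly_Mapping.single e' (1::'k)"
        have u: "u * pvar j ^ s \<in> B" if "s < d j" for s
          unfolding u_def pvar_power B_def using e'E[OF that] by (auto simp: mult_single)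
        have uP: "u \<in> polys_in {..<n}"
          using u[of 0] BP d(1)[OF jT] by auto
        obtain h a where h: "h \<in> polys_in S" "h \<noteq> 0" "\<forall>s. a s \<in> polys_in S"
          "h * pvar j ^ d j - (\<Sum>s<d j. a s * pvar j ^ s) \<in> I"
          using d(2)[OF jT] by (auto simp: rel_def)
        have "Poly_Mapping.single j 1 + e = e' + Poly_Mapping.single j (d j)"
          by (intro poly_mapping_eqI)
            (auto simp: e'_def lookup_add lookup_minus lookup_single when_def simp flip: dj)
        then have "pvar j * b = u * pvar j ^ d j"
          unfolding pvar_power by (simp add: u_def e(2) mult_single)
        then have "h * (pvar j * b) = u * (h * pvar j ^ d j - (\<Sum>s<d j. a s * pvar j ^ s)) +
            (\<Sum>s<d j. a s * (u * pvar j ^ s))"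
          by (simp add: algebra_simps sum_distrib_left)
        moreover have "sp B \<dots>"
          using h u finB uP
          by (intro sp_add[OF sp_ideal] is_idealD(4)[OF id] sp_sum sp_mult sp_base) auto
        ultimately have "sp B (h * (pvar j * b))" by simp
        with h show ?thesis by (rule_tac sp_div)
      qed
    qed
    obtain h p where h: "h \<in> polys_in S" "h \<noteq> 0" "\<forall>b. p b \<in> polys_in S" "h * f - (\<Sum>b\<in>B. p b * b) \<in> I"
      using f by (auto simp: sp_def)
    have eq: "h * (pvar j * f) = pvar j * (h * f - (\<Sum>b\<in>B. p b * b)) + (\<Sum>b\<in>B. p b * (pvar j * b))"
      by (simp add: algebra_simps sum_distrib_left)
    have "sp B (\<Sum>b\<in>B. p b * (pvar j * b))"
      by (rule sp_sum, rule sp_mult) (use h base in auto)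
    moreover have "pvar j * (h * f - (\<Sum>b\<in>B. p b * b)) \<in> I"
      using h j by (intro is_idealD(4)[OF id] polys_in_pvar) auto
    ultimately have "sp B (h * (pvar j * f))"
      unfolding eq by (intro sp_add[OF sp_ideal])
    with h show ?thesis by (rule_tac sp_div)
  qed
  have mono: "sp B (Poly_Mapping.single e 1)" if "Poly_Mapping.keys e \<subseteq> {..<n}" for e
    using that
  proof (induction rule: monomial_induct)
    case zero
    have "0 \<in> E" using d(1) by (auto simp: E_def)
    then show ?case by (intro sp_base finB) (auto simp: B_def intro!: image_eqI[of _ _ 0])
  next
    case (add e j)
    then show ?case using step[of "Poly_Mapping.single e 1" j] by (simp add: mult_single)
  qed
  have "sp B f" if "f \<in> polys_in {..<n}" for f
    using that
  proof (induction rule: polys_in_induct)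
    case (single e c)
    have "sp B (pconst c * Poly_Mapping.single e 1)"
      using mono[OF single] by (intro sp_mult) auto
    then show ?case by (simp add: mult_single)
  qed (auto intro: sp_add sp_ideal is_idealD(2)[OF id])
  with finB BP show ?thesis by blast
qed

text \<open>A spanning set of least cardinality is independent: a relation with nonzero coefficient
  at \<open>b\<close> would put \<open>b\<close> into the span of the others, and
  \<open>B - {b}\<close> would still span.\<close>

lemma torsion_basis:
  assumes max: "\<And>j. j < n \<Longrightarrow> j \<notin> S \<Longrightarrow> \<exists>p\<in>I. p \<noteq> 0 \<and> p \<in> polys_in (insert j S)"
  shows "\<exists>m b. (\<forall>s<m. b s \<in> polys_in {..<n}) \<and>
    (\<forall>f\<in>polys_in {..<n}. \<exists>h p. h \<in> polys_in S \<and> h \<noteq> 0 \<and> (\<forall>s. p s \<in> polys_in S) \<and>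
      h * f - (\<Sum>s<m. p s * b s) \<in> I) \<and>
    (\<forall>p s. (\<forall>s. p s \<in> polys_in S) \<longrightarrow> (\<Sum>s<m. p s * b s) \<in> I \<longrightarrow> s < (m::nat) \<longrightarrow> p s = 0)"
proof -
  define good where "good B \<longleftrightarrow> finite B \<and> B \<subseteq> polys_in {..<n} \<and> (\<forall>f\<in>polys_in {..<n}. sp B f)" for B
  have "\<exists>B. good B" using finite_spanning_set[OF max] by (simp add: good_def)
  then obtain B where B: "good B" and least: "\<And>C. good C \<Longrightarrow> card B \<le> card C"
    using ex_has_least_nat[of good _ card] by blast
  have indep: "p b = 0" if p: "\<And>b. p b \<in> polys_in S" "(\<Sum>b\<in>B. p b * b) \<in> I" and b: "b \<in> B" for p b
  proof (rule ccontr)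
    assume nz: "p b \<noteq> 0"
    have "p b * b - (\<Sum>c\<in>B - {b}. - p c * c) = (\<Sum>b\<in>B. p b * b)"
      using B b by (simp add: good_def sum.remove sum_negf)
    then have b': "sp (B - {b}) b"
      using p nz by (intro spI[of "p b" "\<lambda>c. - p c"]) (auto intro: polys_in_uminus)
    have "good (B - {b})"
      unfolding good_def
    proof (intro conjI ballI)
      fix f :: "'k mpoly"
      assume "f \<in> polys_in {..<n}"
      then have "sp B f" using B by (simp add: good_def)
      then show "sp (B - {b}) f"
      proof (rule sp_trans)
        fix c assume "c \<in> B"
        then show "sp (B - {b}) c"
          using b' B by (cases "c = b") (auto simp: good_def intro!: sp_base)
      qed
    qed (use B in \<open>auto simp: good_def\<close>)
    from least[OF this] show False
      using B b card_gt_0_iff[of B] by (auto simp: good_def)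
  qed
  obtain b where b: "bij_betw b {..<card B} B"
    using ex_bij_betw_nat_finite[of B] B by (auto simp: good_def atLeast0LessThan)
  let ?i = "the_inv_into {..<card B} b"
  have i: "?i (b s) = s" if "s < card B" for s
    using b that by (simp add: bij_betw_def the_inv_into_f_f)
  have reindex: "(\<Sum>c\<in>B. p c * c) = (\<Sum>s<card B. p (b s) * b s)" for p
    using sum.reindex_bij_betw[OF b, of "\<lambda>c. p c * c"] by simp
  show ?thesis
  proof (intro exI[of _ "card B"] exI[of _ b] conjI allI ballI impI)
    show "b s \<in> polys_in {..<n}" if "s < card B" for s
      using that b B by (auto simp: good_def bij_betw_def)
    show "\<exists>h p. h \<in> polys_in S \<and> h \<noteq> 0 \<and> (\<forall>s. p s \<in> polys_in S) \<and>
        h * f - (\<Sum>s<card B. p s * b s) \<in> I" if f: "f \<in> polys_in {..<n}" for f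
    proof -
      obtain h p where "h \<in> polys_in S" "h \<noteq> 0" "\<forall>b. p b \<in> polys_in S" "h * f - (\<Sum>b\<in>B. p b * b) \<in> I"
        using B f by (auto simp: good_def sp_def)
      then show ?thesis
        by (intro exI[of _ h] exI[of _ "\<lambda>s. p (b s)"]) (simp add: reindex)
    qed
    show "p s = 0" if p: "\<forall>s. p s \<in> polys_in S" "(\<Sum>s<card B. p s * b s) \<in> I" and s: "s < card B" for p s
    proof -
      have "(\<Sum>c\<in>B. p (?i c) * c) = (\<Sum>s<card B. p s * b s)"
        unfolding reindex by (intro sum.cong) (auto simp: i)
      then have "p (?i (b s)) = 0"
        using p s b by (intro indep[of "\<lambda>c. p (?i c)"]) (auto simp: bij_betw_def)
      with i s show ?thesis by simp
    qed
  qed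
qed

end

section \<open>Modules over the field of fractions\<close>

type_synonym 'k ratfun = "'k mpoly fract"

definition emb :: "'a::idom \<Rightarrow> 'a fract" where
  "emb p = Fract p 1"

lemma emb_simps [simp]:
  "emb 0 = 0" "emb 1 = 1" "emb (p + q) = emb p + emb q" "emb (p - q) = emb p - emb q"
  "emb (- p) = - emb p" "emb (p * q) = emb p * emb q"
  by (simp_all add: emb_def fract_collapse)

lemma emb_power [simp]: "emb (p ^ k) = emb p ^ k"
  by (induction k) auto

lemma emb_sum: "emb (sum f A) = (\<Sum>i\<in>A. emb (f i))"
  by (induction A rule: infinite_finite_induct) auto

lemma emb_eq_iff [simp]: "emb p = emb q \<longleftrightarrow> p = q"
  by (simp add: emb_def eq_fract)

lemma emb_eq_0_iff [simp]: "emb p = 0 \<longleftrightarrow> p = 0"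
  using emb_eq_iff[of p 0] by (simp del: emb_eq_iff)

lemma Fract_conv_emb: "Fract p h = emb p / emb h"
  by (simp add: emb_def)

text \<open>Linear maps are given by their columns \<open>M s\<close>.\<close>

definition app :: "nat \<Rightarrow> (nat \<Rightarrow> nat \<Rightarrow> 'a) \<Rightarrow> (nat \<Rightarrow> 'a) \<Rightarrow> nat \<Rightarrow> 'a::comm_ring_1" where
  "app m M u = (\<lambda>t. \<Sum>s<m. u s * M s t)"

text \<open>The action of the monomial with exponents \<open>e\<close>. The variables are applied in
  the order of their indices, which is immaterial once the \<open>X j\<close> are known to
  commute.\<close>

definition xact :: "nat \<Rightarrow> nat \<Rightarrow> (nat \<Rightarrow> nat \<Rightarrow> nat \<Rightarrow> 'a) \<Rightarrow> (nat \<Rightarrow> nat) \<Rightarrow> (nat \<Rightarrow> 'a) \<Rightarrow> nat \<Rightarrow> 'a::comm_ring_1" where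
  "xact n m X e v = foldl (\<lambda>u j. (app m (X j) ^^ e j) u) v [0..<n]"

text \<open>The vector \<open>f(X_1, ..., X_n) v\<close>.\<close>

definition ev :: "nat \<Rightarrow> nat \<Rightarrow> (nat \<Rightarrow> nat \<Rightarrow> nat \<Rightarrow> 'k ratfun) \<Rightarrow> (nat \<Rightarrow> 'k ratfun) \<Rightarrow> 'k::field mpoly \<Rightarrow> nat \<Rightarrow> 'k ratfun" where
  "ev n m X v f = (\<lambda>t. \<Sum>e\<in>Poly_Mapping.keys f.
    emb (pconst (Poly_Mapping.lookup f e)) * xact n m X (Poly_Mapping.lookup e) v t)"

text \<open>The matrix \<open>U\<close> turns the entrywise \<open>q\<close>-th power on coordinates into the \<open>q\<close>-th power map of
  the algebra generated by the commuting matrices \<open>X_j\<close>, with \<open>v\<close> in the role of \<open>1\<close>.\<close>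

definition frob_module :: "nat \<Rightarrow> nat \<Rightarrow> nat \<Rightarrow> (nat \<Rightarrow> nat \<Rightarrow> nat \<Rightarrow> 'a::comm_ring_1) \<Rightarrow>
    (nat \<Rightarrow> nat \<Rightarrow> 'a) \<Rightarrow> (nat \<Rightarrow> 'a) \<Rightarrow> bool" where
  "frob_module n q m X U v \<longleftrightarrow>
    (\<forall>i<n. \<forall>j<n. \<forall>s<m. app m (X i) (X j s) = app m (X j) (X i s)) \<and>
    app m U (\<lambda>s. v s ^ q) = v \<and>
    (\<forall>j<n. \<forall>s<m. app m U (\<lambda>t. X j s t ^ q) = (app m (X j) ^^ q) (U s))"

definition ratfuns_in :: "nat set \<Rightarrow> 'k::field ratfun set" where
  "ratfuns_in S = {Fract p h | p h. p \<in> polys_in S \<and> h \<in> polys_in S \<and> h \<noteq> 0}"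

lemma frobenius_sum:
  assumes "q > 0" "\<And>x y :: 'a::comm_ring_1. (x + y) ^ q = x ^ q + y ^ q"
  shows "(sum f A :: 'a) ^ q = (\<Sum>i\<in>A. f i ^ q)"
  using assms by (induction A rule: infinite_finite_induct) (auto simp: power_0_left)

context torsion_ideal
begin

text \<open>Coordinates with respect to \<open>torsion_basis\<close>: \<open>X j\<close> is
  multiplication by the variable \<open>j\<close>, the columns of \<open>U\<close> are the
  coordinates of the \<open>b s ^ q\<close>, and \<open>v\<close> is that of 1. The equations of
  \<open>frob_module\<close> then express commutativity, \<open>1 ^ q = 1\<close> and the rule that
  the q-th power of a product is the product of the q-th powers. The coordinates of \<open>f\<close>
  vanish exactly if \<open>f\<close> is torsion modulo \<open>I\<close> over K[x_S].\<close>

lemma coordinates: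
  fixes q :: nat
  assumes max: "\<And>j. j < n \<Longrightarrow> j \<notin> S \<Longrightarrow> \<exists>p\<in>I. p \<noteq> 0 \<and> p \<in> polys_in (insert j S)"
    and q: "q > 0" and frob: "\<And>x y :: 'k mpoly. (x + y) ^ q = x ^ q + y ^ q"
  shows "\<exists>m X U v. frob_module n q m X U v \<and>
    (\<forall>j<n. \<forall>s<m. \<forall>t. X j s t \<in> ratfuns_in S \<and> (t \<ge> m \<longrightarrow> X j s t = 0)) \<and>
    (\<forall>s<m. \<forall>t. U s t \<in> ratfuns_in S \<and> (t \<ge> m \<longrightarrow> U s t = 0)) \<and>
    (\<forall>t. v t \<in> ratfuns_in S \<and> (t \<ge> m \<longrightarrow> v t = 0)) \<and>
    (\<forall>f\<in>polys_in {..<n}. ev n m X v f = (\<lambda>_. 0) \<longleftrightarrow> (\<exists>h\<in>polys_in S. h \<noteq> 0 \<and> h * f \<in> I))"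
proof -
  let ?P = "polys_in {..<n} :: 'k mpoly set"
  have "\<exists>m b. (\<forall>s<m. b s \<in> ?P) \<and>
    (\<forall>f\<in>?P. \<exists>h p. h \<in> polys_in S \<and> h \<noteq> 0 \<and> (\<forall>s. p s \<in> polys_in S) \<and>
      h * f - (\<Sum>s<m. p s * b s) \<in> I) \<and>
    (\<forall>p s. (\<forall>s. p s \<in> polys_in S) \<longrightarrow> (\<Sum>s<m. p s * b s) \<in> I \<longrightarrow> s < (m::nat) \<longrightarrow> p s = 0)"
    by (rule torsion_basis, rule max)
  then obtain m :: nat and b where basis: "(\<forall>s<m. b s \<in> ?P) \<and>
    (\<forall>f\<in>?P. \<exists>h p. h \<in> polys_in S \<and> h \<noteq> 0 \<and> (\<forall>s. p s \<in> polys_in S) \<and>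
      h * f - (\<Sum>s<m. p s * b s) \<in> I) \<and>
    (\<forall>p s. (\<forall>s. p s \<in> polys_in S) \<longrightarrow> (\<Sum>s<m. p s * b s) \<in> I \<longrightarrow> s < m \<longrightarrow> p s = 0)"
    by (elim exE) (rule that)
  then have b: "b s \<in> ?P" if "s < m" for s
    using that by blast
  from basis have span: "\<exists>h p. h \<in> polys_in S \<and> h \<noteq> 0 \<and> (\<forall>s. p s \<in> polys_in S) \<and>
      h * f - (\<Sum>s<m. p s * b s) \<in> I" if "f \<in> ?P" for f
    using that by (elim conjE) (rule bspec)
  from basis have indep: "p s = 0" if "\<And>s. p s \<in> polys_in S" "(\<Sum>s<m. p s * b s) \<in> I" "s < m" for p s
    using that by (elim conjE allE[of _ p] allE[of _ s]) simp
  \<comment> \<open>Independence only concerns indices below \<open>m\<close>; extending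
    \<open>p\<close> by zero makes \<open>uniq\<close>, and with it the coordinates, meaningful at
    all indices.\<close>
  define rel where "rel f h p \<longleftrightarrow> h \<in> polys_in S \<and> h \<noteq> 0 \<and> (\<forall>s. p s \<in> polys_in S) \<and>
      (\<forall>s\<ge>m. p s = 0) \<and> h * f - (\<Sum>s<m. p s * b s) \<in> I" for f h p
  have rel_ex: "\<exists>h p. rel f h p" if f: "f \<in> ?P" for f
  proof -
    obtain h p where hp: "h \<in> polys_in S" "h \<noteq> 0" "\<forall>s. p s \<in> polys_in S" "h * f - (\<Sum>s<m. p s * b s) \<in> I"
      using span[OF f] by blast
    have "rel f h (\<lambda>s. if s < m then p s else 0)"
      using hp by (simp add: rel_def)
    then show ?thesis by blast
  qed
  have uniq: "h * p' s = h' * p s" if r: "rel f h p" "rel f h' p'" for f h h' p p' s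
  proof (cases "s < m")
    case True
    have "(\<Sum>s<m. (h * p' s - h' * p s) * b s) =
        h' * (h * f - (\<Sum>s<m. p s * b s)) - h * (h' * f - (\<Sum>s<m. p' s * b s))"
      by (simp add: algebra_simps sum_distrib_left sum_subtractf)
    also have "\<dots> \<in> I"
      by (rule is_ideal_diff[OF id]; rule is_idealD(4)[OF id]) (use r in \<open>auto simp: rel_def SD\<close>)
    finally have "h * p' s - h' * p s = 0"
      using r True by (intro indep[of "\<lambda>s. h * p' s - h' * p s"]) (auto simp: rel_def intro!: polys_in_diff polys_in_mult)
    then show ?thesis by simp
  qed (use r in \<open>simp add: rel_def\<close>)
  \<comment> \<open>By \<open>uniq\<close> the fraction does not depend on the relation that is
    picked.\<close>
  define co where "co f s = (case SOME hp. rel f (fst hp) (snd hp) of (h, p) \<Rightarrow> Fract (p s) h)" for f s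
  have co: "co f s = emb (p s) / emb h" if r: "rel f h p" for f h p s
  proof -
    obtain h' p' where hp: "(SOME hp. rel f (fst hp) (snd hp)) = (h', p')"
      by force
    have "rel f h' p'"
      using someI[of "\<lambda>hp. rel f (fst hp) (snd hp)" "(h, p)"] r hp by simp
    with uniq[OF r this, of s] r have "Fract (p' s) h' = Fract (p s) h"
      by (simp add: eq_fract rel_def mult.commute)
    then show ?thesis
      by (simp add: co_def hp flip: Fract_conv_emb)
  qed
  have co_in: "co f s \<in> ratfuns_in S" "s \<ge> m \<Longrightarrow> co f s = 0" if f: "f \<in> ?P" for f s
  proof -
    obtain h p where r: "rel f h p"
      using rel_ex[OF f] by blast
    then show "s \<ge> m \<Longrightarrow> co f s = 0"
      using co[OF r] by (simp add: rel_def)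
    have "co f s = Fract (p s) h"
      by (simp add: co[OF r] Fract_conv_emb)
    with r show "co f s \<in> ratfuns_in S"
      unfolding ratfuns_in_def by (auto simp: rel_def)
  qed
  have co_add: "co (f + g) s = co f s + co g s" if fg: "f \<in> ?P" "g \<in> ?P" for f g s
  proof -
    obtain h p where r: "rel f h p" using rel_ex[OF fg(1)] by blast
    obtain h' p' where r': "rel g h' p'" using rel_ex[OF fg(2)] by blast
    have "h * h' * (f + g) - (\<Sum>s<m. (h' * p s + h * p' s) * b s) =
        h' * (h * f - (\<Sum>s<m. p s * b s)) + h * (h' * g - (\<Sum>s<m. p' s * b s))"
      by (simp add: algebra_simps sum.distrib sum_distrib_left)
    also have "\<dots> \<in> I"
      using r r' by (intro is_idealD(3,4)[OF id] SD) (auto simp: rel_def)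
    finally have "rel (f + g) (h * h') (\<lambda>s. h' * p s + h * p' s)"
      using r r' by (auto simp: rel_def intro!: polys_in_add polys_in_mult)
    moreover have "h \<noteq> 0" "h' \<noteq> 0"
      using r r' by (auto simp: rel_def)
    ultimately show ?thesis
      by (simp add: co[OF r] co[OF r'] co[of "f + g"] field_simps)
  qed
  have co_scale: "co (a * f) s = emb a * co f s" if a: "a \<in> polys_in S" and f: "f \<in> ?P" for a f s
  proof -
    obtain h p where r: "rel f h p" using rel_ex[OF f] by blast
    have "h * (a * f) - (\<Sum>s<m. (a * p s) * b s) = a * (h * f - (\<Sum>s<m. p s * b s))"
      by (simp add: algebra_simps sum_distrib_left)
    also have "\<dots> \<in> I"
      using r a by (intro is_idealD(4)[OF id] SD) (auto simp: rel_def)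
    finally have "rel (a * f) h (\<lambda>s. a * p s)"
      using r a by (auto simp: rel_def intro!: polys_in_mult)
    from co[OF this] co[OF r] show ?thesis by simp
  qed
  have co_ideal: "co f s = 0" if f: "f \<in> I" for f s
  proof -
    have "rel f 1 (\<lambda>_. 0)" using f by (simp add: rel_def)
    from co[OF this] show ?thesis by simp
  qed
  have co_0: "co 0 s = 0" for s
    using co_ideal is_idealD(2)[OF id] by blast
  have co_sum: "co (sum f A) s = (\<Sum>i\<in>A. co (f i) s)" if fA: "\<And>i. i \<in> A \<Longrightarrow> f i \<in> ?P"
    for f :: "'x \<Rightarrow> 'k mpoly" and A s
    using fA by (induction A rule: infinite_finite_induct) (auto simp: co_0 co_add polys_in_sum)
  have co_zero: "(\<forall>s. co f s = 0) \<longleftrightarrow> (\<exists>h\<in>polys_in S. h \<noteq> 0 \<and> h * f \<in> I)" if f: "f \<in> ?P" for f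
  proof
    obtain h p where r: "rel f h p" using rel_ex[OF f] by blast
    assume "\<forall>s. co f s = 0"
    with co[OF r] r have "\<forall>s. p s = 0" by (simp add: rel_def)
    with r show "\<exists>h\<in>polys_in S. h \<noteq> 0 \<and> h * f \<in> I" by (auto simp: rel_def)
  next
    assume "\<exists>h\<in>polys_in S. h \<noteq> 0 \<and> h * f \<in> I"
    then obtain h where h: "h \<in> polys_in S" "h \<noteq> 0" "h * f \<in> I" by blast
    have "emb h * co f s = 0" for s
      using co_scale[OF h(1) f, of s] co_ideal[OF h(3), of s] by simp
    with h show "\<forall>s. co f s = 0" by simp
  qed
  have frob_diff: "(x - y) ^ q = x ^ q - y ^ q" for x y :: "'k mpoly"
    using frob[of "x - y" y] by simp
  have co_mult: "co (g * f) t = (\<Sum>s<m. co f s * co (g * b s) t)" if g: "g \<in> ?P" and f: "f \<in> ?P" for g f t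
  proof -
    obtain h p where r: "rel f h p" using rel_ex[OF f] by blast
    have hf: "h * (g * f) = g * (h * f - (\<Sum>s<m. p s * b s)) + (\<Sum>s<m. p s * (g * b s))"
      by (simp add: algebra_simps sum_distrib_left)
    have gI: "g * (h * f - (\<Sum>s<m. p s * b s)) \<in> I"
      using r g by (intro is_idealD(4)[OF id]) (auto simp: rel_def)
    have gb: "g * b s \<in> ?P" "p s * (g * b s) \<in> ?P" if "s < m" for s
      using r g b that SD[of "p s"] by (auto simp: rel_def intro!: polys_in_mult)
    have "emb h * co (g * f) t = co (h * (g * f)) t"
      using r f g by (intro co_scale[symmetric] polys_in_mult) (auto simp: rel_def)
    also have "\<dots> = co (\<Sum>s<m. p s * (g * b s)) t"
      unfolding hf using gb is_idealD(1)[OF id gI]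
      by (subst co_add) (auto intro!: polys_in_sum simp: co_ideal[OF gI])
    also have "\<dots> = (\<Sum>s<m. co (p s * (g * b s)) t)"
      by (rule co_sum) (use gb in auto)
    also have "\<dots> = (\<Sum>s<m. emb (p s) * co (g * b s) t)"
      using r gb by (intro sum.cong co_scale) (auto simp: rel_def)
    also have "\<dots> = emb h * (\<Sum>s<m. co f s * co (g * b s) t)"
      using r by (simp add: co[OF r] sum_distrib_left rel_def)
    finally show ?thesis using r by (simp add: rel_def)
  qed
  \<comment> \<open>The q-th power map is additive and preserves \<open>I\<close>, so a relation
    expressing \<open>h * f\<close> by the \<open>b s\<close> can be raised to the power
    \<open>q\<close> termwise.\<close>
  have co_frob: "co (f ^ q) t = (\<Sum>s<m. co f s ^ q * co (b s ^ q) t)" if f: "f \<in> ?P" for f t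
  proof -
    obtain h p where r: "rel f h p" using rel_ex[OF f] by blast
    have "(h * f) ^ q = (h * f - (\<Sum>s<m. p s * b s)) ^ q + (\<Sum>s<m. p s * b s) ^ q"
      using frob[of "h * f - (\<Sum>s<m. p s * b s)" "\<Sum>s<m. p s * b s"] by simp
    then have hf: "h ^ q * f ^ q = (h * f - (\<Sum>s<m. p s * b s)) ^ q + (\<Sum>s<m. p s ^ q * b s ^ q)"
      using frobenius_sum[OF q frob, of "\<lambda>s. p s * b s" "{..<m}"] by (simp add: power_mult_distrib)
    have fI: "h * f - (\<Sum>s<m. p s * b s) \<in> I"
      using r by (simp add: rel_def)
    have gI: "(h * f - (\<Sum>s<m. p s * b s)) ^ q \<in> I"
      using is_idealD(4)[OF id polys_in_power[OF is_idealD(1)[OF id fI]] fI, of "q - 1"] q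
      by (simp flip: power_Suc2)
    have gb: "b s ^ q \<in> ?P" "p s ^ q * b s ^ q \<in> ?P" "p s ^ q \<in> polys_in S" if "s < m" for s
      using r b that SD[of "p s"] by (auto simp: rel_def intro!: polys_in_mult polys_in_power)
    have "emb (h ^ q) * co (f ^ q) t = co (h ^ q * f ^ q) t"
      using r f by (intro co_scale[symmetric] polys_in_power) (auto simp: rel_def)
    also have "\<dots> = co (\<Sum>s<m. p s ^ q * b s ^ q) t"
      unfolding hf using gb is_idealD(1)[OF id gI]
      by (subst co_add) (auto intro!: polys_in_sum simp: co_ideal[OF gI])
    also have "\<dots> = (\<Sum>s<m. co (p s ^ q * b s ^ q) t)"
      by (rule co_sum) (use gb in auto)
    also have "\<dots> = (\<Sum>s<m. emb (p s ^ q) * co (b s ^ q) t)"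
      using r gb by (intro sum.cong co_scale) auto
    also have "\<dots> = emb (h ^ q) * (\<Sum>s<m. co f s ^ q * co (b s ^ q) t)"
      using r by (simp add: co[OF r] sum_distrib_left rel_def power_divide)
    finally show ?thesis using r by (simp add: rel_def)
  qed
  define X where "X j s = co (pvar j * b s)" for j s
  define U where "U s = co (b s ^ q)" for s
  define v where "v = co 1"
  have pv: "pvar j \<in> ?P" if "j < n" for j
    using that by (intro polys_in_pvar) auto
  have X: "app m (X j) (co f) = co (pvar j * f)" if "j < n" "f \<in> ?P" for j f
    using co_mult[OF pv[OF that(1)] that(2)] by (simp add: app_def X_def fun_eq_iff)
  have Xpow: "(app m (X j) ^^ i) (co f) = co (pvar j ^ i * f)" if "j < n" "f \<in> ?P" for j f i
  proof (induction i)
    case (Suc i)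
    have "pvar j ^ i * f \<in> ?P"
      using that pv by (intro polys_in_mult polys_in_power)
    with Suc X that(1) show ?case by (simp add: mult.assoc)
  qed simp
  have U: "app m U (\<lambda>s. co f s ^ q) = co (f ^ q)" if "f \<in> ?P" for f
    using co_frob[OF that] by (simp add: app_def U_def fun_eq_iff)
  have "frob_module n q m X U v"
    unfolding frob_module_def
  proof (intro conjI allI impI)
    show "app m (X i) (X j s) = app m (X j) (X i s)" if "i < n" "j < n" "s < m" for i j s
    proof -
      have "app m (X i) (X j s) = co (pvar i * (pvar j * b s))"
        using X[OF that(1) polys_in_mult[OF pv[OF that(2)] b[OF that(3)]]] by (simp only: X_def)
      moreover have "app m (X j) (X i s) = co (pvar j * (pvar i * b s))"
        using X[OF that(2) polys_in_mult[OF pv[OF that(1)] b[OF that(3)]]] by (simp only: X_def)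
      ultimately show ?thesis by (simp only: mult.left_commute)
    qed
    show "app m U (\<lambda>s. v s ^ q) = v"
      using U[of 1] by (simp add: v_def)
    show "app m U (\<lambda>t. X j s t ^ q) = (app m (X j) ^^ q) (U s)" if "j < n" "s < m" for j s
    proof -
      have "app m U (\<lambda>t. X j s t ^ q) = co ((pvar j * b s) ^ q)"
        using U[OF polys_in_mult[OF pv[OF that(1)] b[OF that(2)]]] by (simp only: X_def)
      also have "\<dots> = (app m (X j) ^^ q) (U s)"
        unfolding U_def Xpow[OF that(1) polys_in_power[OF b[OF that(2)]]] power_mult_distrib ..
      finally show ?thesis .
    qed
  qed
  moreover have "ev n m X v f = co f" if f: "f \<in> ?P" for f
  proof -
    have prod: "foldl (\<lambda>u j. (app m (X j) ^^ e j) u) v [0..<l] = co (\<Prod>j<l. pvar j ^ e j)" if "l \<le> n" for e l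
      using that
    proof (induction l)
      case (Suc l)
      have "(\<Prod>j<l. pvar j ^ e j) \<in> ?P"
        using Suc.prems pv by (intro polys_in_prod polys_in_power) auto
      with Suc show ?case by (simp add: Xpow mult.commute)
    qed (simp add: v_def)
    have mono: "xact n m X (Poly_Mapping.lookup e) v = co (Poly_Mapping.single e 1)"
      if e: "e \<in> Poly_Mapping.keys f" for e
    proof -
      have "Poly_Mapping.keys e \<subseteq> {..<n}"
        using f e by (simp add: polys_in_def)
      then show ?thesis
        unfolding xact_def prod[OF order_refl] by (simp only: monomial_conv_prod)
    qed
    have sP: "Poly_Mapping.single e c \<in> ?P" if "e \<in> Poly_Mapping.keys f" for e c
      using f that by (intro polys_in_single) (auto simp: polys_in_def)
    have "ev n m X v f t = co f t" for t
    proof -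
      have "ev n m X v f t =
          (\<Sum>e\<in>Poly_Mapping.keys f. co (pconst (Poly_Mapping.lookup f e) * Poly_Mapping.single e 1) t)"
        unfolding ev_def using sP by (intro sum.cong) (auto simp: mono co_scale)
      also have "\<dots> = co (\<Sum>e\<in>Poly_Mapping.keys f. Poly_Mapping.single e (Poly_Mapping.lookup f e)) t"
        using sP by (subst co_sum) (auto simp: mult_single)
      finally show ?thesis by (simp add: poly_mapping_sum_single)
    qed
    then show ?thesis by blast
  qed
  moreover have "X j s t \<in> ratfuns_in S \<and> (t \<ge> m \<longrightarrow> X j s t = 0)" if "j < n" "s < m" for j s t
    unfolding X_def using co_in[OF polys_in_mult[OF pv[OF that(1)] b[OF that(2)]]] by blast
  moreover have "U s t \<in> ratfuns_in S \<and> (t \<ge> m \<longrightarrow> U s t = 0)" if "s < m" for s t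
    unfolding U_def using co_in[OF polys_in_power[OF b[OF that]]] by blast
  moreover have "v t \<in> ratfuns_in S \<and> (t \<ge> m \<longrightarrow> v t = 0)" for t
    unfolding v_def using co_in[OF polys_in_1] by blast
  ultimately show ?thesis
    using co_zero by (intro exI[of _ m] exI[of _ X] exI[of _ U] exI[of _ v]) (auto simp: fun_eq_iff)
qed

end

text \<open>The empty set qualifies because a nonzero constant in \<open>I\<close> would be a unit.
  Among the finitely many sets of variables a maximal one exists, and its maximality is the last
  conclusion.\<close>

lemma maximal_independent_variables:
  assumes id: "is_ideal n I" and proper: "(1 :: 'k::field mpoly) \<notin> I"
  obtains S where "S \<subseteq> {..<n}" "I \<inter> polys_in S \<subseteq> {0}"
    "\<And>j. j < n \<Longrightarrow> j \<notin> S \<Longrightarrow> \<exists>p\<in>I. p \<noteq> 0 \<and> p \<in> polys_in (insert j S)"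
proof -
  define good where "good S \<longleftrightarrow> S \<subseteq> {..<n} \<and> I \<inter> polys_in S \<subseteq> {0}" for S
  have "good {}"
    unfolding good_def
  proof (intro conjI subsetI)
    fix f :: "'k mpoly"
    assume f: "f \<in> I \<inter> polys_in {}"
    then have "Poly_Mapping.keys f \<subseteq> {0}"
      by (auto simp: polys_in_def)
    then have f_eq: "f = pconst (Poly_Mapping.lookup f 0)"
      by (intro poly_mapping_eqI) (auto simp: lookup_single when_def in_keys_iff)
    show "f \<in> {0}"
    proof (rule ccontr)
      assume "f \<notin> {0}"
      with f_eq have "Poly_Mapping.lookup f 0 \<noteq> 0"
        by (metis single_zero singletonI)
      then have "pconst (inverse (Poly_Mapping.lookup f 0)) * f = 1"
        by (subst f_eq) (simp add: mult_single)
      with f proper show False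
        using is_idealD(4)[OF id polys_in_pconst, of f] by (metis IntD1)
    qed
  qed simp
  moreover have "finite {S. good S}"
    by (rule finite_subset[of _ "Pow {..<n}"]) (auto simp: good_def)
  ultimately obtain S where S: "good S" "\<And>T. good T \<Longrightarrow> S \<subseteq> T \<Longrightarrow> S = T"
    using finite_has_maximal[of "{S. good S}"] by auto
  show ?thesis
  proof (rule that[of S])
    fix j assume j: "j < n" "j \<notin> S"
    then have "\<not> good (insert j S)"
      using S(2)[of "insert j S"] by blast
    then show "\<exists>p\<in>I. p \<noteq> 0 \<and> p \<in> polys_in (insert j S)"
      using S(1) j by (auto simp: good_def)
  qed (use S in \<open>auto simp: good_def\<close>)
qed

text \<open>Vectors are functions on all of \<open>nat\<close>; vanishing from index
  \<open>m\<close> on lets equality of functions express equality of m-tuples. The independent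
  variables differ from block to block, so only the common field of fractions in the variables below
  \<open>n\<close> is recorded.\<close>

definition frob_block :: "nat \<Rightarrow> nat \<Rightarrow> nat \<times> (nat \<Rightarrow> nat \<Rightarrow> nat \<Rightarrow> 'k::field ratfun) \<times> (nat \<Rightarrow> nat \<Rightarrow> 'k ratfun) \<times>
    (nat \<Rightarrow> 'k ratfun) \<Rightarrow> bool" where
  "frob_block n q = (\<lambda>(m, X, U, v). frob_module n q m X U v \<and>
    (\<forall>j<n. \<forall>s<m. \<forall>t. X j s t \<in> ratfuns_in {..<n} \<and> (t \<ge> m \<longrightarrow> X j s t = 0)) \<and>
    (\<forall>s<m. \<forall>t. U s t \<in> ratfuns_in {..<n} \<and> (t \<ge> m \<longrightarrow> U s t = 0)) \<and>
    (\<forall>t. v t \<in> ratfuns_in {..<n} \<and> (t \<ge> m \<longrightarrow> v t = 0)))"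

text \<open>
  Noetherian induction: with \<open>S\<close> a maximal set of variables that are independent modulo \<open>I\<close> and \<open>h\<close> a
  polynomial in these variables that annihilates the torsion of \<open>K[x] / I\<close> over \<open>K[x_S]\<close>,
  \<open>I = (I : h) \<inter> (I + (h))\<close>, where \<open>(I : h)\<close> is the kernel of a single block.
\<close>

lemma ideal_frob_blocks:
  fixes I :: "'k::field mpoly set"
  assumes "is_ideal n I" and q: "q > 0" and frob: "\<And>x y :: 'k mpoly. (x + y) ^ q = x ^ q + y ^ q"
  shows "\<exists>bs. (\<forall>b\<in>set bs. frob_block n q b) \<and>
    (\<forall>f\<in>polys_in {..<n}. f \<in> I \<longleftrightarrow> (\<forall>(m, X, U, v)\<in>set bs. ev n m X v f = (\<lambda>_. 0)))"
  using assms(1)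
proof (induction I rule: wf_induct_rule[OF wf_ideals[of n]])
  case (1 I)
  let ?P = "polys_in {..<n} :: 'k mpoly set"
  show ?case
  proof (cases "1 \<in> I")
    case True
    then have "f \<in> I" if "f \<in> ?P" for f
      using is_idealD(4)[OF 1(2) that True] by simp
    then show ?thesis by (intro exI[of _ "[]"]) simp
  next
    case False
    obtain S where SS: "S \<subseteq> {..<n}" "I \<inter> polys_in S \<subseteq> {0}"
      "\<And>j. j < n \<Longrightarrow> j \<notin> S \<Longrightarrow> \<exists>p\<in>I. p \<noteq> 0 \<and> p \<in> polys_in (insert j S)"
      using maximal_independent_variables[OF 1(2) False] by blast
    interpret torsion_ideal n I S
      by unfold_locales (use 1(2) SS in auto)
    obtain m X U v where b: "frob_module n q m X U v"
      "\<forall>j<n. \<forall>s<m. \<forall>t. X j s t \<in> ratfuns_in S \<and> (t \<ge> m \<longrightarrow> X j s t = 0)"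
      "\<forall>s<m. \<forall>t. U s t \<in> ratfuns_in S \<and> (t \<ge> m \<longrightarrow> U s t = 0)"
      "\<forall>t. v t \<in> ratfuns_in S \<and> (t \<ge> m \<longrightarrow> v t = 0)" and
      ker: "\<forall>f\<in>?P. ev n m X v f = (\<lambda>_. 0) \<longleftrightarrow> (\<exists>h\<in>polys_in S. h \<noteq> 0 \<and> h * f \<in> I)"
      using coordinates[OF SS(3) q frob] by blast
    have "ratfuns_in S \<subseteq> (ratfuns_in {..<n} :: 'k ratfun set)"
      using polys_in_mono[OF SS(1)] unfolding ratfuns_in_def by blast
    with b have block: "frob_block n q (m, X, U, v)"
      unfolding frob_block_def by blast
    \<comment> \<open>By the ascending chain condition, some \<open>Q h\<close> with
      \<open>h\<close> nonzero in K[x_S] is maximal among these ideal quotients. For any other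
      \<open>h'\<close>, both \<open>Q h\<close> and \<open>Q h'\<close> lie in
      \<open>Q (h' * h)\<close>, which by maximality equals \<open>Q h\<close>. So this
      \<open>h\<close> annihilates all torsion.\<close>
    define Q where "Q h = {f \<in> ?P. h * f \<in> I}" for h
    have Qid: "is_ideal n (Q h)" for h
      unfolding is_ideal_def Q_def
      using is_idealD[OF id] by (auto simp: distrib_left mult.left_commute intro: polys_in_add polys_in_mult)
    have "Q 1 \<in> Q ` (polys_in S - {0})"
      by (intro imageI) auto
    then obtain M where "M \<in> Q ` (polys_in S - {0})" and
      M: "\<And>N. (N, M) \<in> {(J, I). is_ideal n I \<and> is_ideal n J \<and> I \<subset> J} \<Longrightarrow> N \<notin> Q ` (polys_in S - {0})"
      by (rule wfE_min[OF wf_ideals[of n]]) (use that in blast)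
    then obtain h where h: "h \<in> polys_in S" "h \<noteq> 0" and Mh: "M = Q h"
      by auto
    have hmax: "\<not> Q h \<subset> Q h'" if "h' \<in> polys_in S" "h' \<noteq> 0" for h'
      using M[of "Q h'"] that Qid by (auto simp: Mh)
    have Qh: "f \<in> Q h" if "f \<in> ?P" "h' \<in> polys_in S" "h' \<noteq> 0" "h' * f \<in> I" for f h'
    proof -
      have "Q h \<subseteq> Q (h' * h)"
        using is_idealD(4)[OF id SD[OF that(2)]] by (auto simp: Q_def mult.assoc)
      then have "Q (h' * h) = Q h"
        using hmax[of "h' * h"] that h by (auto intro: polys_in_mult)
      moreover have "f \<in> Q (h' * h)"
        using that is_idealD(4)[OF id SD[OF h(1)] that(4)] by (simp add: Q_def mult_ac)
      ultimately show ?thesis by simp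
    qed
    define J where "J = {i + g * h | i g. i \<in> I \<and> g \<in> ?P}"
    have hP: "h \<in> ?P" using h SD by blast
    have JI: "i + g * h \<in> J" if "i \<in> I" "g \<in> ?P" for i g
      using that by (auto simp: J_def)
    have Jid: "is_ideal n J"
      unfolding is_ideal_def
    proof (intro conjI ballI subsetI)
      show "f \<in> ?P" if "f \<in> J" for f
        using that is_idealD(1)[OF id] hP by (auto simp: J_def intro: polys_in_add polys_in_mult)
      show "0 \<in> J"
        using JI[OF is_idealD(2)[OF id] polys_in_0] by simp
      show "f + g \<in> J" if fg: "f \<in> J" "g \<in> J" for f g
      proof -
        obtain i r j s where "f = i + r * h" "g = j + s * h" "i \<in> I" "j \<in> I" "r \<in> ?P" "s \<in> ?P"
          using fg by (auto simp: J_def)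
        then show ?thesis
          using JI[of "i + j" "r + s"] is_idealD(3)[OF id, of i j] polys_in_add[of r _ s]
          by (simp add: algebra_simps)
      qed
      show "f * g \<in> J" if f: "f \<in> ?P" and g: "g \<in> J" for f g
      proof -
        obtain j s where "g = j + s * h" "j \<in> I" "s \<in> ?P"
          using g by (auto simp: J_def)
        then show ?thesis
          using JI[of "f * j" "f * s"] is_idealD(4)[OF id f] polys_in_mult[OF f] by (simp add: algebra_simps)
      qed
    qed
    have IJ: "I \<subseteq> J" using JI[OF _ polys_in_0] by auto
    have "h \<in> J" using JI[OF is_idealD(2)[OF id] polys_in_1] by simp
    moreover have "h \<notin> I" using SS(2) h by blast
    ultimately have "I \<subset> J" using IJ by blast
    with Jid id obtain bs where bs: "\<forall>b\<in>set bs. frob_block n q b"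
      "\<forall>f\<in>?P. f \<in> J \<longleftrightarrow> (\<forall>(m, X, U, v)\<in>set bs. ev n m X v f = (\<lambda>_. 0))"
      using 1(1)[of J] by blast
    have "f \<in> I \<longleftrightarrow> ev n m X v f = (\<lambda>_. 0) \<and> f \<in> J" if f: "f \<in> ?P" for f
    proof
      assume "f \<in> I"
      then have "1 * f \<in> I" by simp
      then show "ev n m X v f = (\<lambda>_. 0) \<and> f \<in> J"
        using ker f IJ polys_in_1 \<open>f \<in> I\<close> by (metis subsetD zero_neq_one)
    next
      assume *: "ev n m X v f = (\<lambda>_. 0) \<and> f \<in> J"
      then have "f \<in> Q h"
        using ker f Qh by blast
      then have hf: "h * f \<in> I" by (simp add: Q_def)
      obtain i g where ig: "f = i + g * h" "i \<in> I" "g \<in> ?P"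
        using * by (auto simp: J_def)
      \<comment> \<open>From \<open>f = i + g * h\<close> and \<open>h * f \<in> I\<close> it
        follows that \<open>h * h * g \<in> I\<close>. Thus \<open>g\<close> is torsion, the choice
        of \<open>h\<close> gives \<open>h * g \<in> I\<close>, and so
        \<open>f \<in> I\<close>.\<close>
      have "h * f - h * i \<in> I"
        using hf is_idealD(4)[OF id hP ig(2)] by (rule is_ideal_diff[OF id])
      moreover have "h * f - h * i = h * h * g"
        by (simp add: ig algebra_simps)
      ultimately have "g \<in> Q h"
        using h ig by (intro Qh[of g "h * h"]) (auto intro: polys_in_mult)
      then show "f \<in> I"
        using ig is_idealD(3)[OF id] by (simp add: Q_def mult.commute)
    qed
    with bs block show ?thesis
      by (intro exI[of _ "(m, X, U, v) # bs"]) auto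
  qed
qed

section \<open>Frobenius modules\<close>

lemma app_sum_left: "app m M (\<lambda>t. \<Sum>i\<in>A. c i * u i t) = (\<lambda>t. \<Sum>i\<in>A. c i * app m M (u i) t)"
proof
  fix t
  have "app m M (\<lambda>t. \<Sum>i\<in>A. c i * u i t) t = (\<Sum>s<m. \<Sum>i\<in>A. c i * (u i s * M s t))"
    by (simp add: app_def sum_distrib_right mult.assoc)
  also have "\<dots> = (\<Sum>i\<in>A. \<Sum>s<m. c i * (u i s * M s t))"
    by (rule sum.swap)
  finally show "app m M (\<lambda>t. \<Sum>i\<in>A. c i * u i t) t = (\<Sum>i\<in>A. c i * app m M (u i) t)"
    by (simp add: app_def sum_distrib_left)
qed

lemma funpow_app_sum:
  "(app m M ^^ k) (\<lambda>t. \<Sum>i\<in>A. c i * u i t) = (\<lambda>t. \<Sum>i\<in>A. c i * (app m M ^^ k) (u i) t)"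
  by (induction k) (simp_all add: app_sum_left)

lemma funpow_app_app: "(app m M ^^ k) (app m B u) = (\<lambda>t. \<Sum>s<m. u s * (app m M ^^ k) (B s) t)"
  using funpow_app_sum[where m = m and M = M and k = k and c = u and u = B and A = "{..<m}"]
  by (simp add: app_def[of m B])

lemma app_app: "app m M (app m B u) = (\<lambda>t. \<Sum>s<m. u s * app m M (B s) t)"
  using funpow_app_app[where k = 1] by simp

lemma xact_Suc: "xact (Suc n) m X e u = (app m (X n) ^^ e n) (xact n m X e u)"
  by (simp add: xact_def)

lemma xact_0: "xact 0 m X e u = u"
  by (simp add: xact_def)

lemma xact_cong: "(\<And>j. j < n \<Longrightarrow> a j = b j) \<Longrightarrow> xact n m X a u = xact n m X b u"
  by (induction n) (auto simp: xact_0 xact_Suc)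

lemma xact_sum:
  "xact n m X e (\<lambda>t. \<Sum>i\<in>A. c i * u i t) = (\<lambda>t. \<Sum>i\<in>A. c i * xact n m X e (u i) t)"
  by (induction n) (simp_all add: xact_0 xact_Suc funpow_app_sum)

lemma funpow_commute_map:
  assumes "\<And>u. f (g u) = g (f u)"
  shows "(f ^^ a) ((g ^^ b) u) = (g ^^ b) ((f ^^ a) u)"
proof -
  have 1: "f ((g ^^ b) u) = (g ^^ b) (f u)" for b u
    by (induction b) (auto simp: assms)
  show ?thesis by (induction a) (auto simp: 1)
qed

context
  fixes n q m :: nat and X :: "nat \<Rightarrow> nat \<Rightarrow> nat \<Rightarrow> 'a::comm_ring_1" and U v
  assumes fm: "frob_module n q m X U v" and q: "q > 1"
    and frob: "\<And>x y :: 'a. (x + y) ^ q = x ^ q + y ^ q"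
begin

lemma app_commute:
  assumes "i < n" "j < n"
  shows "app m (X i) (app m (X j) u) = app m (X j) (app m (X i) u)"
  using fm assms by (simp add: app_app frob_module_def)

lemma xact_commute:
  assumes "l \<le> n" "j < n"
  shows "(app m (X j) ^^ k) (xact l m X a u) = xact l m X a ((app m (X j) ^^ k) u)"
  using assms(1)
proof (induction l arbitrary: u)
  case (Suc l)
  have "(app m (X j) ^^ k) ((app m (X l) ^^ a l) w) = (app m (X l) ^^ a l) ((app m (X j) ^^ k) w)" for w
    using Suc.prems assms(2) by (intro funpow_commute_map app_commute) auto
  with Suc show ?case by (simp add: xact_Suc)
qed (simp add: xact_0)

lemma xact_add:
  assumes "l \<le> n"
  shows "xact l m X (\<lambda>j. a j + b j) u = xact l m X a (xact l m X b u)"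
  using assms
proof (induction l)
  case (Suc l)
  then show ?case
    using xact_commute[of l l "b l" a] by (simp add: xact_Suc funpow_add)
qed (simp add: xact_0)

text \<open>Sending \<open>u\<close> to \<open>app m U (\<lambda>s. u s ^ q)\<close> is additive and
  turns a scalar factor into its q-th power. The identity required for the columns of
  \<open>X j\<close> therefore extends to all vectors.\<close>

lemma app_U_app_X:
  assumes "j < n"
  shows "app m U (\<lambda>t. app m (X j) u t ^ q) = (app m (X j) ^^ q) (app m U (\<lambda>s. u s ^ q))"
proof -
  have "(\<lambda>t. app m (X j) u t ^ q) = (\<lambda>t. \<Sum>s<m. u s ^ q * X j s t ^ q)"
    unfolding app_def using q by (subst frobenius_sum[OF _ frob]) (auto simp: power_mult_distrib)
  then have "app m U (\<lambda>t. app m (X j) u t ^ q) = (\<lambda>t. \<Sum>s<m. u s ^ q * app m U (\<lambda>t. X j s t ^ q) t)"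
    using app_sum_left[of m U "\<lambda>s. u s ^ q" "\<lambda>s t. X j s t ^ q" "{..<m}"] by simp
  also have "\<dots> = (\<lambda>t. \<Sum>s<m. u s ^ q * (app m (X j) ^^ q) (U s) t)"
    using fm assms by (simp add: frob_module_def)
  also have "\<dots> = (app m (X j) ^^ q) (app m U (\<lambda>s. u s ^ q))"
    by (simp add: funpow_app_app)
  finally show ?thesis .
qed

lemma app_U_funpow:
  assumes "j < n"
  shows "app m U (\<lambda>t. (app m (X j) ^^ k) u t ^ q) = (app m (X j) ^^ (q * k)) (app m U (\<lambda>s. u s ^ q))"
proof (induction k)
  case (Suc k)
  have "app m U (\<lambda>t. (app m (X j) ^^ Suc k) u t ^ q) =
      (app m (X j) ^^ q) (app m U (\<lambda>t. (app m (X j) ^^ k) u t ^ q))"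
    using app_U_app_X[OF assms, of "(app m (X j) ^^ k) u"] by simp
  with Suc show ?case by (simp add: funpow_add)
qed simp

lemma app_U_xact:
  assumes "l \<le> n"
  shows "app m U (\<lambda>t. xact l m X a v t ^ q) = xact l m X (\<lambda>j. q * a j) v"
  using assms
proof (induction l)
  case 0
  then show ?case using fm by (simp add: xact_0 frob_module_def)
next
  case (Suc l)
  then show ?case
    using app_U_funpow[of l "a l" "xact l m X a v"] by (simp add: xact_Suc)
qed

text \<open>The transition of the automaton: to append a digit \<open>w\<close> in base
  \<open>q\<close> to the exponents \<open>a\<close>, raise the coordinates to the power
  \<open>q\<close>, apply \<open>U\<close>, then apply the monomial \<open>w\<close>.\<close>

lemma xact_digit:
  "xact n m X (\<lambda>j. q * a j + w j) v = (\<lambda>t. \<Sum>s<m. xact n m X a v s ^ q * xact n m X w (U s) t)"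
proof -
  have "xact n m X (\<lambda>j. q * a j + w j) v = xact n m X w (xact n m X (\<lambda>j. q * a j) v)"
    using xact_add[of n w "\<lambda>j. q * a j" v] by (simp add: add.commute)
  also have "xact n m X (\<lambda>j. q * a j) v = (\<lambda>t. \<Sum>s<m. xact n m X a v s ^ q * U s t)"
    by (subst app_U_xact[symmetric]) (simp_all add: app_def)
  finally show ?thesis by (simp add: xact_sum)
qed

lemma xact_zero_beyond:
  assumes "\<And>j s t. j < n \<Longrightarrow> s < m \<Longrightarrow> t \<ge> m \<Longrightarrow> X j s t = 0" "\<And>t. t \<ge> m \<Longrightarrow> v t = 0" "t \<ge> m"
  shows "xact n m X a v t = 0"
proof -
  have "xact l m X a v t = 0" if "l \<le> n" "t \<ge> m" for l t
    using that
  proof (induction l arbitrary: t)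
    case (Suc l)
    have "(app m (X l) ^^ k) u t = 0" if "\<And>t. t \<ge> m \<Longrightarrow> u t = 0" for k u
      using that Suc.prems assms(1) by (cases k) (auto simp: app_def)
    with Suc show ?case by (simp add: xact_Suc)
  qed (simp add: xact_0 assms(2))
  with assms(3) show ?thesis by blast
qed

end

lemma frobenius_fract:
  fixes x y :: "'a::idom fract"
  assumes frob: "\<And>x y :: 'a. (x + y) ^ q = x ^ q + y ^ q"
  shows "(x + y) ^ q = x ^ q + y ^ q"
proof -
  obtain a b where x: "x = emb a / emb b" "b \<noteq> 0"
    by (cases x rule: Fract_cases_nonzero) (auto simp: Fract_conv_emb fract_collapse intro: that[of 0 1])
  obtain c d where y: "y = emb c / emb d" "d \<noteq> 0"
    by (cases y rule: Fract_cases_nonzero) (auto simp: Fract_conv_emb fract_collapse intro: that[of 0 1])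
  have "x + y = emb (a * d + c * b) / emb (b * d)"
    using x y by (simp add: field_simps)
  then have "(x + y) ^ q = emb ((a * d) ^ q + (c * b) ^ q) / emb ((b * d) ^ q)"
    by (simp only: power_divide frob flip: emb_power)
  also have "\<dots> = x ^ q + y ^ q"
    using x(2) y(2) by (simp add: x(1) y(1) power_divide power_mult_distrib field_simps)
  finally show ?thesis .
qed

lemma ev_eq_sum:
  assumes "finite A" "Poly_Mapping.keys f \<subseteq> A"
  shows "ev n m X v f t = (\<Sum>e\<in>A. emb (pconst (Poly_Mapping.lookup f e)) * xact n m X (Poly_Mapping.lookup e) v t)"
  unfolding ev_def using assms by (intro sum.mono_neutral_left) (auto simp: in_keys_iff)

lemma ev_0: "ev n m X v 0 t = 0"
  by (simp add: ev_def)

lemma ev_add: "ev n m X v (f + g) t = ev n m X v f t + ev n m X v g t"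
proof -
  let ?A = "Poly_Mapping.keys f \<union> Poly_Mapping.keys g"
  have "Poly_Mapping.keys (f + g) \<subseteq> ?A" by (rule keys_add)
  then show ?thesis
    by (simp add: ev_eq_sum[of ?A] lookup_add single_add distrib_right sum.distrib)
qed

lemma ev_sum: "ev n m X v (sum f A) t = (\<Sum>i\<in>A. ev n m X v (f i) t)"
  by (induction A rule: infinite_finite_induct) (auto simp: ev_0 ev_add)

lemma ev_single: "ev n m X v (Poly_Mapping.single e c) t = emb (pconst c) * xact n m X (Poly_Mapping.lookup e) v t"
  by (subst ev_eq_sum[of "{e}"]) auto

text \<open>Makes the kernel of a block an ideal. Soundness of a certificate must not presuppose
  where the matrices come from; it suffices that they commute, since then \<open>xact\<close> turns
  sums of exponents into compositions.\<close>

lemma ev_mult_eq_0: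
  fixes f g :: "'k::field mpoly"
  assumes fm: "frob_module n q m X U v" and q: "q > 1"
    and frob: "\<And>x y :: 'k mpoly. (x + y) ^ q = x ^ q + y ^ q"
    and g: "ev n m X v g = (\<lambda>_. 0)"
  shows "ev n m X v (f * g) = (\<lambda>_. 0)"
proof
  fix t
  have single: "ev n m X v (Poly_Mapping.single s c * g) t = 0" for s c
  proof -
    have "ev n m X v (Poly_Mapping.single s c * g) t =
        (\<Sum>e\<in>Poly_Mapping.keys g. emb (pconst c) * (emb (pconst (Poly_Mapping.lookup g e)) *
          xact n m X (Poly_Mapping.lookup s) (xact n m X (Poly_Mapping.lookup e) v) t))"
      unfolding single_mult_conv_sum ev_sum ev_single
    proof (intro sum.cong refl)
      fix e
      have "xact n m X (Poly_Mapping.lookup (s + e)) v =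
          xact n m X (\<lambda>j. Poly_Mapping.lookup s j + Poly_Mapping.lookup e j) v"
        by (intro xact_cong) (simp add: lookup_add)
      also have "\<dots> = xact n m X (Poly_Mapping.lookup s) (xact n m X (Poly_Mapping.lookup e) v)"
        by (rule xact_add[OF fm q frobenius_fract[OF frob] order_refl])
      finally show "emb (pconst (c * Poly_Mapping.lookup g e)) * xact n m X (Poly_Mapping.lookup (s + e)) v t =
          emb (pconst c) * (emb (pconst (Poly_Mapping.lookup g e)) *
          xact n m X (Poly_Mapping.lookup s) (xact n m X (Poly_Mapping.lookup e) v) t)"
        by (simp add: mult_single[of 0 c 0, simplified, symmetric] mult.assoc)
    qed
    also have "\<dots> = emb (pconst c) * xact n m X (Poly_Mapping.lookup s) (ev n m X v g) t"
      unfolding ev_def xact_sum by (simp add: sum_distrib_left)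
    also have "xact n m X (Poly_Mapping.lookup s) (ev n m X v g) t = 0"
      using xact_sum[of n m X "Poly_Mapping.lookup s" "\<lambda>_. 0" "\<lambda>_ _. 0" "{}"] by (simp add: g)
    finally show ?thesis by simp
  qed
  have "f * g = (\<Sum>s\<in>Poly_Mapping.keys f. Poly_Mapping.single s (Poly_Mapping.lookup f s) * g)"
    by (subst poly_mapping_sum_single[of f, symmetric]) (simp add: sum_distrib_right)
  then show "ev n m X v (f * g) t = 0"
    by (simp add: ev_sum single)
qed

section \<open>Pumping\<close>

text \<open>
  \<open>st\<close> is the state of an automaton that reads \<open>k \<times> n\<close> numbers in base \<open>q\<close>, highest digits first.
  A tuple with more than \<open>N\<close> digits visits a state twice, and the digits in between can be cut out.
\<close>

lemma pump:
  fixes st :: "(nat \<Rightarrow> nat \<Rightarrow> nat) \<Rightarrow> 's"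
  assumes q: "q > 1" and S: "finite S" "card S \<le> N" "\<And>a. st a \<in> S"
    and step: "\<And>a b w. st a = st b \<Longrightarrow> (\<And>i j. w i j < q) \<Longrightarrow>
      st (\<lambda>i j. q * a i j + w i j) = st (\<lambda>i j. q * b i j + w i j)"
  shows "\<exists>b. st b = st a \<and> (\<forall>i<k. \<forall>j<n. b i j < q ^ N)"
proof (induction "\<Sum>i<k. \<Sum>j<n. a i j" arbitrary: a rule: less_induct)
  case less
  \<comment> \<open>\<open>step\<close> for a whole block of \<open>e\<close> digits: the last digit
    of \<open>w\<close> is split off, the leading ones are handled by induction.\<close>
  have steps: "st (\<lambda>i j. q ^ e * a i j + w i j) = st (\<lambda>i j. q ^ e * b i j + w i j)"
    if "st a = st b" "\<And>i j. w i j < q ^ e" for a b w e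
    using that(2)
  proof (induction e arbitrary: w)
    case 0
    with that(1) show ?case by simp
  next
    case (Suc e)
    have "w i j div q < q ^ e" for i j
      using Suc.prems[of i j] by (simp add: less_mult_imp_div_less mult.commute)
    from Suc.IH[OF this]
    have "st (\<lambda>i j. q * (q ^ e * a i j + w i j div q) + w i j mod q) =
        st (\<lambda>i j. q * (q ^ e * b i j + w i j div q) + w i j mod q)"
      using q by (intro step) auto
    then show ?case by (simp add: algebra_simps)
  qed
  show ?case
  proof (cases "\<forall>i<k. \<forall>j<n. a i j div q ^ N = 0")
    case True
    then have "\<forall>i<k. \<forall>j<n. a i j < q ^ N"
      using q by (auto simp: div_eq_0_iff)
    then show ?thesis by blast
  next
    case False
    then obtain i0 j0 where ij: "i0 < k" "j0 < n" "a i0 j0 div q ^ N \<noteq> 0"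
      by blast
    \<comment> \<open>The quotients by \<open>q ^ e\<close> are what has been read when
      \<open>e\<close> digits remain. There are \<open>N + 1\<close> choices of \<open>e\<close> but
      at most \<open>N\<close> states.\<close>
    have "\<not> inj_on (\<lambda>e. st (\<lambda>i j. a i j div q ^ e)) {..N}"
    proof
      assume "inj_on (\<lambda>e. st (\<lambda>i j. a i j div q ^ e)) {..N}"
      then have "card {..N} \<le> card S"
        using S by (intro card_inj_on_le) auto
      with S show False by simp
    qed
    then obtain e e' where e: "e < e'" "e' \<le> N" "st (\<lambda>i j. a i j div q ^ e) = st (\<lambda>i j. a i j div q ^ e')"
      unfolding inj_on_def by (metis atMost_iff linorder_neq_iff)
    \<comment> \<open>The digits at the places from \<open>e\<close> to \<open>e' - 1\<close> are
      cut out.\<close>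
    define b where "b i j = q ^ e * (a i j div q ^ e') + a i j mod q ^ e" for i j
    have a_eq: "q ^ e * (a i j div q ^ e) + a i j mod q ^ e = a i j" for i j
      by simp
    have "st b = st (\<lambda>i j. q ^ e * (a i j div q ^ e) + a i j mod q ^ e)"
      unfolding b_def using q by (intro steps e(3)[symmetric]) auto
    then have st: "st b = st a"
      by simp
    have e'_eq: "a i j div q ^ e' = a i j div q ^ e div q ^ (e' - e)" for i j
      using e(1) by (simp flip: div_mult2_eq power_add)
    have le: "b i j \<le> a i j" for i j
    proof -
      have "q ^ e * (a i j div q ^ e') \<le> q ^ e * (a i j div q ^ e)"
        unfolding e'_eq by (intro mult_le_mono2 div_le_dividend)
      with a_eq[of i j] show ?thesis unfolding b_def by linarith
    qed
    \<comment> \<open>Some digit at a place beyond \<open>e\<close> is nonzero in the entry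
      \<open>a i0 j0\<close>, because its quotient by \<open>q ^ N\<close> is nonzero and
      \<open>e \<le> N\<close>. Cutting out at least one place then makes this entry strictly
      smaller, as the induction on the sum of all entries requires.\<close>
    have less_ij: "b i0 j0 < a i0 j0"
    proof -
      have "q ^ N = q ^ e * q ^ (N - e)"
        using e by (simp flip: power_add)
      then have "a i0 j0 div q ^ e \<noteq> 0"
        using ij(3) by (metis div_0 div_mult2_eq)
      moreover have "1 < q ^ (e' - e)"
        using e q one_less_power[of q "e' - e"] by simp
      ultimately have "a i0 j0 div q ^ e' < a i0 j0 div q ^ e"
        unfolding e'_eq by (intro div_less_dividend) auto
      then have "q ^ e * (a i0 j0 div q ^ e') < q ^ e * (a i0 j0 div q ^ e)"
        using q by simp
      with a_eq[of i0 j0] show ?thesis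
        unfolding b_def by linarith
    qed
    have "(\<Sum>i<k. \<Sum>j<n. b i j) < (\<Sum>i<k. \<Sum>j<n. a i j)"
    proof (rule sum_strict_mono_ex1)
      have "(\<Sum>j<n. b i0 j) < (\<Sum>j<n. a i0 j)"
        by (rule sum_strict_mono_ex1) (use ij le less_ij in auto)
      with ij show "\<exists>i\<in>{..<k}. (\<Sum>j<n. b i j) < (\<Sum>j<n. a i j)"
        by blast
    qed (auto intro: sum_mono le)
    from less[OF this] st show ?thesis by metis
  qed
qed

text \<open>The degree is bounded in each variable separately: bounds add up under multiplication,
  and division of exponents by \<open>q\<close> acts on every variable alone.\<close>

definition polys_deg :: "nat \<Rightarrow> nat \<Rightarrow> 'k::comm_ring_1 mpoly set" where
  "polys_deg n d = {f \<in> polys_in {..<n}. \<forall>e\<in>Poly_Mapping.keys f. \<forall>j. Poly_Mapping.lookup e j \<le> d}"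

lemma polys_deg_0 [simp]: "0 \<in> polys_deg n d"
  by (simp add: polys_deg_def)

lemma polys_deg_pconst [simp]: "pconst c \<in> polys_deg n d"
  by (simp add: polys_deg_def)

lemma polys_deg_add: "f \<in> polys_deg n d \<Longrightarrow> g \<in> polys_deg n d \<Longrightarrow> f + g \<in> polys_deg n d"
  using keys_add[of f g] by (auto simp: polys_deg_def intro!: polys_in_add)

lemma polys_deg_sum: "(\<And>i. i \<in> A \<Longrightarrow> f i \<in> polys_deg n d) \<Longrightarrow> sum f A \<in> polys_deg n d"
  by (induction A rule: infinite_finite_induct) (auto intro: polys_deg_add)

lemma polys_deg_mult:
  assumes "f \<in> polys_deg n d" "g \<in> polys_deg n d'"
  shows "f * g \<in> polys_deg n (d + d')"
  unfolding polys_deg_def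
proof (intro CollectI conjI ballI allI)
  show "f * g \<in> polys_in {..<n}"
    using assms by (auto simp: polys_deg_def intro: polys_in_mult)
  fix e j
  assume "e \<in> Poly_Mapping.keys (f * g)"
  then obtain a b where "e = a + b" "a \<in> Poly_Mapping.keys f" "b \<in> Poly_Mapping.keys g"
    using keys_mult[of f g] by blast
  with assms show "Poly_Mapping.lookup e j \<le> d + d'"
    by (auto simp: polys_deg_def lookup_add intro: add_mono)
qed

lemma polys_deg_power: "f \<in> polys_deg n d \<Longrightarrow> f ^ k \<in> polys_deg n (k * d)"
proof (induction k)
  case 0
  then show ?case using polys_deg_pconst[of 1] by (simp del: polys_deg_pconst)
qed (use polys_deg_mult in auto)

definition box :: "nat \<Rightarrow> nat \<Rightarrow> (nat \<Rightarrow>\<^sub>0 nat) set" where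
  "box n d = {e. Poly_Mapping.keys e \<subseteq> {..<n} \<and> (\<forall>j. Poly_Mapping.lookup e j \<le> d)}"

lemma finite_card_box: "finite (box n d) \<and> card (box n d) \<le> (d + 1) ^ n"
proof -
  have inj: "inj_on (\<lambda>e. restrict (Poly_Mapping.lookup e) {..<n}) (box n d)"
  proof (rule inj_onI, rule poly_mapping_eqI)
    fix e e' i
    assume "e \<in> box n d" "e' \<in> box n d"
      and eq: "restrict (Poly_Mapping.lookup e) {..<n} = restrict (Poly_Mapping.lookup e') {..<n}"
    then have "i \<ge> n \<Longrightarrow> Poly_Mapping.lookup e i = 0 \<and> Poly_Mapping.lookup e' i = 0"
      unfolding box_def by (auto simp: subset_iff in_keys_iff)
    with fun_cong[OF eq, of i] show "Poly_Mapping.lookup e i = Poly_Mapping.lookup e' i"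
      by (cases "i < n") auto
  qed
  have sub: "(\<lambda>e. restrict (Poly_Mapping.lookup e) {..<n}) ` box n d \<subseteq> (\<Pi>\<^sub>E j\<in>{..<n}. {..d})"
    by (auto simp: box_def PiE_def extensional_def)
  have fin: "finite (\<Pi>\<^sub>E j\<in>{..<n}. {..d})"
    by (intro finite_PiE) auto
  have "card (\<Pi>\<^sub>E j\<in>{..<n}. {..d}) = (d + 1) ^ n"
    by (subst card_PiE) auto
  with inj_on_finite[OF inj sub fin] card_inj_on_le[OF inj sub fin] show ?thesis
    by simp
qed

lemma finite_card_polys_deg:
  "finite (polys_deg n d :: 'k::{finite,field} mpoly set) \<and>
    card (polys_deg n d :: 'k mpoly set) \<le> card (UNIV :: 'k set) ^ ((d + 1) ^ n)"
proof -
  let ?V = "polys_deg n d :: 'k mpoly set"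
  have keys: "Poly_Mapping.keys f \<subseteq> box n d" if "f \<in> ?V" for f
    using that by (auto simp: polys_deg_def polys_in_def box_def)
  have inj: "inj_on (\<lambda>f. restrict (Poly_Mapping.lookup f) (box n d)) ?V"
  proof (rule inj_onI, rule poly_mapping_eqI)
    fix f g e
    assume fg: "f \<in> ?V" "g \<in> ?V"
      and eq: "restrict (Poly_Mapping.lookup f) (box n d) = restrict (Poly_Mapping.lookup g) (box n d)"
    have "e \<notin> box n d \<Longrightarrow> Poly_Mapping.lookup f e = 0 \<and> Poly_Mapping.lookup g e = 0"
      using keys[OF fg(1)] keys[OF fg(2)] by (auto simp: subset_iff in_keys_iff)
    with fun_cong[OF eq, of e] show "Poly_Mapping.lookup f e = Poly_Mapping.lookup g e"
      by (cases "e \<in> box n d") auto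
  qed
  have sub: "(\<lambda>f. restrict (Poly_Mapping.lookup f) (box n d)) ` ?V \<subseteq> (\<Pi>\<^sub>E e\<in>box n d. UNIV)"
    by auto
  have fin: "finite (\<Pi>\<^sub>E e\<in>box n d. UNIV :: 'k set)"
    using finite_card_box by (intro finite_PiE) auto
  have "card (\<Pi>\<^sub>E e\<in>box n d. UNIV :: 'k set) = card (UNIV :: 'k set) ^ card (box n d)"
    using finite_card_box by (subst card_PiE) auto
  also have "\<dots> \<le> card (UNIV :: 'k set) ^ ((d + 1) ^ n)"
    using finite_card_box by (intro power_increasing) (auto simp: Suc_le_eq card_gt_0_iff)
  finally show ?thesis
    using inj_on_finite[OF inj sub fin] card_inj_on_le[OF inj sub fin] by simp
qed

definition scale_exp :: "nat \<Rightarrow> (nat \<Rightarrow>\<^sub>0 nat) \<Rightarrow> (nat \<Rightarrow>\<^sub>0 nat)" where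
  "scale_exp q e = Poly_Mapping.map ((*) q) e"

lemma lookup_scale_exp [simp]: "Poly_Mapping.lookup (scale_exp q e) j = q * Poly_Mapping.lookup e j"
  by (simp add: scale_exp_def Poly_Mapping.map.rep_eq when_def)

lemma single_power:
  "Poly_Mapping.single e c ^ k = Poly_Mapping.single (scale_exp k e) (c ^ k :: 'k::comm_ring_1)"
proof (induction k)
  case 0
  have "scale_exp 0 e = 0" by (intro poly_mapping_eqI) simp
  then show ?case by simp
next
  case (Suc k)
  have "e + scale_exp k e = scale_exp (Suc k) e"
    by (intro poly_mapping_eqI) (simp add: lookup_add)
  with Suc show ?case by (simp add: mult_single)
qed

locale frobenius_field =
  fixes q :: nat and K :: "'k::{finite,field} itself"
  assumes q: "q > 1" and frob: "\<And>x y :: 'k mpoly. (x + y) ^ q = x ^ q + y ^ q"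
    and fix_q: "\<And>c :: 'k. c ^ q = c"
begin

lemma frobE: "(x + y) ^ q = x ^ q + y ^ q" for x y :: "'k ratfun"
  by (rule frobenius_fract[OF frob])

lemma power_q_conv_sum:
  "(f :: 'k mpoly) ^ q = (\<Sum>e\<in>Poly_Mapping.keys f. Poly_Mapping.single (scale_exp q e) (Poly_Mapping.lookup f e))"
proof -
  have "f ^ q = (\<Sum>e\<in>Poly_Mapping.keys f. Poly_Mapping.single e (Poly_Mapping.lookup f e)) ^ q"
    by (simp only: poly_mapping_sum_single)
  also have "\<dots> = (\<Sum>e\<in>Poly_Mapping.keys f. Poly_Mapping.single e (Poly_Mapping.lookup f e) ^ q)"
    using q by (intro frobenius_sum frob) auto
  finally show ?thesis by (simp add: single_power fix_q)
qed

section \<open>Base-q digits of exponents and q-th roots of polynomials\<close>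

abbreviation digits :: "nat \<Rightarrow> (nat \<Rightarrow>\<^sub>0 nat) set" where
  "digits n \<equiv> box n (q - 1)"

lemma digits_less: "d \<in> digits n \<Longrightarrow> Poly_Mapping.lookup d j < q"
  using q by (auto simp: box_def intro: le_less_trans[of _ "q - 1"])

text \<open>K[x] is free over its subring of q-th powers, with the monomials of exponents below
  \<open>q\<close> as a basis. An exponent splits into remainder and quotient modulo
  \<open>q\<close>, and a coefficient is its own q-th root by \<open>fix_q\<close>. The roots
  \<open>r w\<close> have only a q-th of the degree, which will keep the forms of the automaton
  bounded.\<close>

lemma digit_decomposition:
  fixes p :: "'k mpoly"
  assumes "p \<in> polys_deg n (q * d)"
  shows "\<exists>r. (\<forall>w\<in>digits n. r w \<in> polys_deg n d) \<and> p = (\<Sum>w\<in>digits n. Poly_Mapping.single w 1 * r w ^ q)"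
proof -
  have fin: "finite (digits n)" using finite_card_box by blast
  have main: "\<exists>r. (\<forall>w\<in>digits n. r w \<in> polys_deg n d) \<and>
      (\<Sum>e\<in>A. Poly_Mapping.single e (c e)) = (\<Sum>w\<in>digits n. Poly_Mapping.single w 1 * (r w :: 'k mpoly) ^ q)"
    if "finite A" "A \<subseteq> box n (q * d)" for A c
    using that
  proof induction
    case empty
    show ?case using q by (intro exI[of _ "\<lambda>_. 0"]) (simp add: power_0_left)
  next
    case (insert e A)
    then obtain r where r: "\<forall>w\<in>digits n. r w \<in> polys_deg n d"
      "(\<Sum>e\<in>A. Poly_Mapping.single e (c e)) = (\<Sum>w\<in>digits n. Poly_Mapping.single w 1 * r w ^ q)"
      by blast
    have e: "e \<in> box n (q * d)" using insert by simp
    define e' where "e' = Poly_Mapping.map (\<lambda>x. x div q) e"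
    define w where "w = Poly_Mapping.map (\<lambda>x. x mod q) e"
    have e': "Poly_Mapping.lookup e' j = Poly_Mapping.lookup e j div q" for j
      by (simp add: e'_def Poly_Mapping.map.rep_eq when_def)
    have w: "Poly_Mapping.lookup w j = Poly_Mapping.lookup e j mod q" for j
      by (simp add: w_def Poly_Mapping.map.rep_eq when_def)
    have "Poly_Mapping.keys e' \<subseteq> Poly_Mapping.keys e" "Poly_Mapping.keys w \<subseteq> Poly_Mapping.keys e"
      using gr0I by (fastforce simp: in_keys_iff e' w)+
    then have keys: "Poly_Mapping.keys e' \<subseteq> {..<n}" "Poly_Mapping.keys w \<subseteq> {..<n}"
      using e by (auto simp: box_def)
    have "Poly_Mapping.lookup e j mod q \<le> q - 1" for j
      using q mod_less_divisor[of q "Poly_Mapping.lookup e j"] by linarith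
    then have wD: "w \<in> digits n"
      using keys by (simp add: box_def w)
    have "Poly_Mapping.lookup e j div q \<le> d" for j
    proof -
      have "Poly_Mapping.lookup e j div q \<le> q * d div q"
        using e by (intro div_le_mono) (simp add: box_def)
      then show ?thesis using q by simp
    qed
    then have e'D: "Poly_Mapping.single e' (c e) \<in> polys_deg n d"
      using keys by (auto simp: polys_deg_def e' intro!: polys_in_single)
    have "w + scale_exp q e' = e"
      by (intro poly_mapping_eqI) (simp add: lookup_add e' w)
    then have single: "Poly_Mapping.single e (c e) = Poly_Mapping.single w 1 * Poly_Mapping.single e' (c e) ^ q"
      by (simp add: single_power mult_single fix_q)
    let ?r = "\<lambda>u. r u + (if u = w then Poly_Mapping.single e' (c e) else 0)"
    have "(\<Sum>u\<in>digits n. Poly_Mapping.single u 1 * ?r u ^ q) =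
        (\<Sum>u\<in>digits n. Poly_Mapping.single u 1 * r u ^ q) +
        (\<Sum>u\<in>digits n. if u = w then Poly_Mapping.single w 1 * Poly_Mapping.single e' (c e) ^ q else 0)"
      using q by (subst sum.distrib[symmetric], intro sum.cong refl) (auto simp: frob distrib_left power_0_left)
    also have "\<dots> = (\<Sum>u\<in>digits n. Poly_Mapping.single u 1 * r u ^ q) + Poly_Mapping.single e (c e)"
      using wD fin single by simp
    also have "\<dots> = (\<Sum>e\<in>insert e A. Poly_Mapping.single e (c e))"
      using insert r by (simp add: add.commute)
    finally show ?case
      using r e'D by (intro exI[of _ ?r]) (auto intro!: polys_deg_add)
  qed
  have "Poly_Mapping.keys p \<subseteq> box n (q * d)"
    using assms by (auto simp: polys_deg_def polys_in_def box_def)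
  from main[OF finite_keys this, of "Poly_Mapping.lookup p"] show ?thesis
    by (simp only: poly_mapping_sum_single)
qed

text \<open>Different pairs of digits \<open>w\<close> and exponent \<open>e\<close> give different
  exponents \<open>w + scale_exp q e\<close>, so each coefficient of the sum comes from one
  coefficient of one \<open>r w\<close>.\<close>

lemma digits_independent_poly:
  fixes r :: "_ \<Rightarrow> 'k mpoly"
  assumes "(\<Sum>w\<in>digits n. Poly_Mapping.single w 1 * r w ^ q) = 0" "w \<in> digits n"
  shows "r w = 0"
proof (rule poly_mapping_eqI)
  fix e
  have fin: "finite (digits n)" using finite_card_box by blast
  have inj: "u + scale_exp q e' = w + scale_exp q e \<longleftrightarrow> u = w \<and> e' = e" if u: "u \<in> digits n" for u e'
  proof
    assume eq: "u + scale_exp q e' = w + scale_exp q e"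
    have *: "Poly_Mapping.lookup u j = Poly_Mapping.lookup w j \<and> Poly_Mapping.lookup e' j = Poly_Mapping.lookup e j" for j
    proof -
      have "Poly_Mapping.lookup u j + q * Poly_Mapping.lookup e' j =
          Poly_Mapping.lookup w j + q * Poly_Mapping.lookup e j"
        using arg_cong[OF eq, of "\<lambda>x. Poly_Mapping.lookup x j"] by (simp add: lookup_add)
      with digits_less[OF u] digits_less[OF assms(2)] show ?thesis
        by (metis add.right_neutral div_less div_mult_self2 less_nat_zero_code mod_less mod_mult_self2 add_0)
    qed
    then show "u = w \<and> e' = e" by (auto intro: poly_mapping_eqI)
  qed simp
  have "Poly_Mapping.lookup (Poly_Mapping.single u 1 * r u ^ q) (w + scale_exp q e) =
      (if u = w then Poly_Mapping.lookup (r w) e else 0)" if u: "u \<in> digits n" for u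
  proof -
    have "Poly_Mapping.lookup (Poly_Mapping.single u 1 * r u ^ q) (w + scale_exp q e) =
        (\<Sum>e'\<in>Poly_Mapping.keys (r u). Poly_Mapping.lookup (r u) e' when u + scale_exp q e' = w + scale_exp q e)"
      by (simp add: power_q_conv_sum sum_distrib_left mult_single lookup_sum lookup_single)
    also have "\<dots> = (\<Sum>e'\<in>Poly_Mapping.keys (r u). if e' = e then (if u = w then Poly_Mapping.lookup (r u) e else 0) else 0)"
      by (intro sum.cong refl) (auto simp: when_def inj[OF u])
    also have "\<dots> = (if u = w then Poly_Mapping.lookup (r w) e else 0)"
      by (auto simp: in_keys_iff)
    finally show ?thesis .
  qed
  then have "Poly_Mapping.lookup (\<Sum>u\<in>digits n. Poly_Mapping.single u 1 * r u ^ q) (w + scale_exp q e) =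
      Poly_Mapping.lookup (r w) e"
    using assms(2) fin by (simp add: lookup_sum)
  with assms(1) show "Poly_Mapping.lookup (r w) e = Poly_Mapping.lookup 0 e"
    by simp
qed

lemma common_denominator:
  fixes z :: "'i \<Rightarrow> 'a::idom fract"
  assumes "finite A"
  shows "\<exists>h p. h \<noteq> 0 \<and> (\<forall>i\<in>A. z i = emb (p i) / emb h)"
  using assms
proof induction
  case (insert i A)
  then obtain h p where hp: "h \<noteq> 0" "\<forall>i\<in>A. z i = emb (p i) / emb h" by blast
  obtain a b where ab: "z i = emb a / emb b" "b \<noteq> 0"
    by (cases "z i" rule: Fract_cases_nonzero) (auto simp: Fract_conv_emb fract_collapse intro: that[of 0 1])
  show ?case
    using hp ab insert(2)
    by (intro exI[of _ "h * b"] exI[of _ "\<lambda>j. if j = i then a * h else p j * b"]) auto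
qed (auto intro: exI[of _ 1])

text \<open>Clearing a common denominator \<open>h\<close> multiplies the sum by
  \<open>h ^ q\<close>, which reduces the claim to polynomials. It lets the vanishing of one form be
  replaced by the vanishing of several forms of smaller degree.\<close>

lemma digits_independent:
  fixes z :: "_ \<Rightarrow> 'k ratfun"
  assumes "(\<Sum>w\<in>digits n. emb (Poly_Mapping.single w 1) * z w ^ q) = 0" "w \<in> digits n"
  shows "z w = 0"
proof -
  have fin: "finite (digits n)" using finite_card_box by blast
  obtain h p where hp: "h \<noteq> 0" "\<forall>w\<in>digits n. z w = emb (p w) / emb h"
    using common_denominator[OF fin] by blast
  have "emb (\<Sum>w\<in>digits n. Poly_Mapping.single w 1 * p w ^ q) / emb h ^ q =
      (\<Sum>w\<in>digits n. emb (Poly_Mapping.single w 1) * z w ^ q)"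
    using hp by (simp add: emb_sum sum_divide_distrib power_divide)
  with assms(1) hp(1) have "(\<Sum>w\<in>digits n. Poly_Mapping.single w 1 * p w ^ q) = 0"
    by simp
  from digits_independent_poly[OF this assms(2)] hp assms(2) show ?thesis by simp
qed

text \<open>At most \<open>n * (q - 1)\<close> matrices and the vector \<open>u\<close> contribute
  one factor \<open>h\<close> each to the denominator, and
  \<open>n * (q - 1) + 1 \<le> (q - 1) * (n + 1)\<close> because \<open>q > 1\<close>. The larger
  exponent is the one that fits the scaling by \<open>h ^ (n + 1)\<close> in the automaton.\<close>

lemma xact_denominator:
  assumes h: "h \<in> polys_deg n D" "h \<noteq> 0"
    and X: "\<And>j s t. j < n \<Longrightarrow> s < m \<Longrightarrow> Xh j s t \<in> polys_deg n D \<and> X j s t = emb (Xh j s t) / emb h"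
    and u: "\<And>t. r t \<in> polys_deg n D \<and> u t = emb (r t) / emb h"
    and w: "\<And>j. j < n \<Longrightarrow> w j < q"
  shows "\<exists>P. \<forall>t. P t \<in> polys_deg n (D * ((q - 1) * (n + 1))) \<and>
    emb h ^ ((q - 1) * (n + 1)) * xact n m X w u t = emb (P t :: 'k mpoly)"
proof -
  define frac where "frac c u \<longleftrightarrow> (\<exists>r. \<forall>t. r t \<in> polys_deg n (D * c) \<and> u t = emb (r t :: 'k mpoly) / emb h ^ c)"
    for c and u :: "nat \<Rightarrow> 'k ratfun"
  have step: "frac (c + 1) (app m (X j) u)" if u: "frac c u" and j: "j < n" for c u j
  proof -
    obtain r where r: "\<forall>t. r t \<in> polys_deg n (D * c) \<and> u t = emb (r t) / emb h ^ c"
      using u unfolding frac_def by blast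
    have "(\<Sum>s<m. r s * Xh j s t) \<in> polys_deg n (D * (c + 1))" for t
    proof (intro polys_deg_sum)
      fix s assume "s \<in> {..<m}"
      then show "r s * Xh j s t \<in> polys_deg n (D * (c + 1))"
        using polys_deg_mult[of "r s" n "D * c" "Xh j s t" D] r X[OF j, of s t] by (simp add: add.commute)
    qed
    moreover have "app m (X j) u t = emb (\<Sum>s<m. r s * Xh j s t) / emb h ^ (c + 1)" for t
      using r X[OF j] by (simp add: app_def emb_sum sum_divide_distrib mult.commute)
    ultimately show ?thesis
      unfolding frac_def by (intro exI[of _ "\<lambda>t. \<Sum>s<m. r s * Xh j s t"]) simp
  qed
  have steps: "frac (c + i) ((app m (X j) ^^ i) u)" if "frac c u" "j < n" for c u j i
    using that(1) by (induction i) (use step[OF _ that(2)] in auto)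
  have "frac (1 + (\<Sum>j<l. w j)) (xact l m X w u)" if "l \<le> n" for l
    using that
  proof (induction l)
    case 0
    show ?case using u unfolding frac_def xact_0 by (intro exI[of _ r]) simp
  next
    case (Suc l)
    then show ?case
      using steps[of "1 + (\<Sum>j<l. w j)" "xact l m X w u" l "w l"] by (simp add: xact_Suc)
  qed
  from this[OF order_refl] obtain r where
    r: "\<forall>t. r t \<in> polys_deg n (D * (1 + (\<Sum>j<n. w j))) \<and>
      xact n m X w u t = emb (r t) / emb h ^ (1 + (\<Sum>j<n. w j))"
    by (auto simp: frac_def)
  define c where "c = 1 + (\<Sum>j<n. w j)"
  define E where "E = (q - 1) * (n + 1)"
  have "(\<Sum>j<n. w j) \<le> (\<Sum>j<n. q - 1)"
    using w by (intro sum_mono) fastforce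
  then have "(\<Sum>j<n. w j) \<le> n * (q - 1)"
    by simp
  moreover have "E = n * (q - 1) + (q - 1)"
    by (simp add: E_def)
  ultimately have "c \<le> E"
    using q unfolding c_def by linarith
  then obtain b where b: "E = c + b"
    using le_Suc_ex by blast
  have "h ^ b * r t \<in> polys_deg n (D * E)" for t
    using polys_deg_mult[OF polys_deg_power[OF h(1), of b], of "r t" "D * c"] r
    by (simp add: b c_def algebra_simps)
  moreover have "emb h ^ E * xact n m X w u t = emb (h ^ b * r t)" for t
  proof -
    have "xact n m X w u t = emb (r t) / emb h ^ c"
      using r unfolding c_def[symmetric] by blast
    then show ?thesis
      using h(2) by (simp add: b power_add)
  qed
  ultimately show ?thesis
    unfolding E_def by (intro exI[of _ "\<lambda>t. h ^ b * r t"]) simp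
qed

text \<open>
  The state \<open>T a\<close> of a tuple \<open>a\<close> is the set of all linear forms of bounded degree that vanish at the
  vectors \<open>X^(a i) v\<close>. Dividing these vectors by \<open>h ^ (n + 1)\<close> makes the transition matrices polynomial
  (this uses \<open>q \<ge> 2\<close>), and extracting \<open>q\<close>-th roots keeps the degrees bounded.
\<close>

lemma block_states:
  fixes X U v k n m D h
  defines "value c a \<equiv> (\<lambda>t. \<Sum>i<k. emb (pconst (c i)) * xact n m X (a i) v t)"
  assumes fm: "frob_module n q m X U v"
    and h: "h \<in> polys_deg n D" "h \<noteq> (0 :: 'k mpoly)"
    and X: "\<And>j s t. j < n \<Longrightarrow> s < m \<Longrightarrow> Xh j s t \<in> polys_deg n D \<and> X j s t = emb (Xh j s t) / emb h"
    and U: "\<And>s t. s < m \<Longrightarrow> Uh s t \<in> polys_deg n D \<and> U s t = emb (Uh s t) / emb h"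
    and beyond: "\<And>j s t. j < n \<Longrightarrow> s < m \<Longrightarrow> t \<ge> m \<Longrightarrow> X j s t = 0" "\<And>t. t \<ge> m \<Longrightarrow> v t = 0"
    and mM: "m \<le> M"
  shows "\<exists>V :: (nat \<Rightarrow> nat \<Rightarrow> 'k mpoly) set. \<exists>T.
    finite V \<and> card V \<le> (card (UNIV :: 'k set) ^ ((D * (n + 1) + 1) ^ n)) ^ (k * M) \<and>
    (\<forall>a. T a \<subseteq> V) \<and>
    (\<forall>a b w. T a = T b \<longrightarrow> (\<forall>i j. w i j < q) \<longrightarrow>
      T (\<lambda>i j. q * a i j + w i j) = T (\<lambda>i j. q * b i j + w i j)) \<and>
    (\<forall>a b c. T a = T b \<longrightarrow> value c a = (\<lambda>_. 0) \<longrightarrow> value c b = (\<lambda>_. 0))"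
proof -
  define D' where "D' = D * (n + 1)"
  define \<eta> where "\<eta> a s = xact n m X a v s / emb h ^ (n + 1)" for a s
  define F where "F L a = (\<Sum>i<k. \<Sum>s<m. emb (L i s) * \<eta> (a i) s)" for L :: "nat \<Rightarrow> nat \<Rightarrow> 'k mpoly" and a
  \<comment> \<open>Forms with all coefficients outside the \<open>k\<close> by \<open>m\<close>
    range equal to zero, so that functions on \<open>nat\<close> make up a finite set.\<close>
  define V :: "(nat \<Rightarrow> nat \<Rightarrow> 'k mpoly) set" where
    "V = {L. \<forall>i s. L i s \<in> (if i < k \<and> s < m then polys_deg n D' else {0})}"
  define T where "T a = {L \<in> V. F L a = 0}" for a
  have V: "finite V \<and> card V \<le> (card (UNIV :: 'k set) ^ ((D' + 1) ^ n)) ^ (k * M)"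
  proof -
    let ?I = "{..<k} \<times> {..<m}"
    let ?W = "\<Pi>\<^sub>E i\<in>?I. (polys_deg n D' :: 'k mpoly set)"
    let ?f = "\<lambda>L :: nat \<Rightarrow> nat \<Rightarrow> 'k mpoly. restrict (\<lambda>(i, s). L i s) ?I"
    have fin: "finite ?W"
      using finite_card_polys_deg by (intro finite_PiE) auto
    have inj: "inj_on ?f V"
    proof (intro inj_onI ext)
      fix L L' i s
      assume "L \<in> V" "L' \<in> V" and eq: "?f L = ?f L'"
      then have "\<not> (i < k \<and> s < m) \<Longrightarrow> L i s = 0 \<and> L' i s = 0"
        unfolding V_def by (metis (mono_tags, lifting) mem_Collect_eq singletonD)
      with fun_cong[OF eq, of "(i, s)"] show "L i s = L' i s"
        by (cases "i < k \<and> s < m") auto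
    qed
    have sub: "?f ` V \<subseteq> ?W"
      by (auto simp: V_def PiE_def extensional_def)
    have "card ?W = card (polys_deg n D' :: 'k mpoly set) ^ (k * m)"
      by (subst card_PiE) (auto simp: card_cartesian_product)
    also have "\<dots> \<le> (card (UNIV :: 'k set) ^ ((D' + 1) ^ n)) ^ (k * m)"
      using finite_card_polys_deg by (intro power_mono) auto
    also have "\<dots> \<le> (card (UNIV :: 'k set) ^ ((D' + 1) ^ n)) ^ (k * M)"
      using mM by (intro power_increasing mult_le_mono2) (auto simp: Suc_le_eq card_gt_0_iff)
    finally show ?thesis
      using inj_on_finite[OF inj sub fin] card_inj_on_le[OF inj sub fin] by simp
  qed
  \<comment> \<open>Reading the digits \<open>w\<close> pulls a form \<open>L\<close> back to the
    forms \<open>dec d\<close>. These depend on \<open>L\<close> and \<open>w\<close> but not on the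
    tuple \<open>a\<close>.\<close>
  have decomp: "\<exists>dec. (\<forall>d\<in>digits n. dec d \<in> V) \<and>
      (\<forall>a. F L (\<lambda>i j. q * a i j + w i j) = (\<Sum>d\<in>digits n. emb (Poly_Mapping.single d 1) * F (dec d) a ^ q))"
    if L: "L \<in> V" and w: "\<And>i j. w i j < q" for L w
  proof -
    let ?E = "(q - 1) * (n + 1)"
    define good where "good i s P \<longleftrightarrow> (\<forall>t. P t \<in> polys_deg n (D * ?E) \<and>
      emb h ^ ?E * xact n m X (w i) (U s) t = emb (P t))" for i s P
    have ex: "\<exists>P. good i s P" if "s < m" for i s
      unfolding good_def
      by (rule xact_denominator[where Xh = Xh and r = "Uh s"]) (use h X U[OF that] w in auto)
    define P where "P i s = (SOME P. good i s P)" for i s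
    have "good i s (P i s)" if "s < m" for i s
      unfolding P_def by (rule someI_ex[OF ex[OF that]])
    then have P: "\<And>i s t. s < m \<Longrightarrow> P i s t \<in> polys_deg n (D * ?E)"
      "\<And>i s t. s < m \<Longrightarrow> emb h ^ ?E * xact n m X (w i) (U s) t = emb (P i s t)"
      by (simp_all add: good_def)
    define R where "R i s' = (\<Sum>s<m. L i s * P i s' s)" for i s'
    \<comment> \<open>The equation that dictates \<open>D' = D * (n + 1)\<close>: a form of degree
      \<open>D'\<close> times a transition entry of degree \<open>D * ?E\<close> has digit
      components whose q-th roots are again of degree at most \<open>D'\<close>.\<close>
    have "q * D' = D' + D * ?E"
    proof -
      obtain q' where "q = Suc q'" using q by (cases q) auto
      then show ?thesis by (simp add: D'_def algebra_simps)
    qed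
    then have R: "R i s' \<in> polys_deg n (q * D')" if "i < k" "s' < m" for i s'
      using L that P(1)[OF that(2)] unfolding R_def V_def
      by (auto intro!: polys_deg_sum polys_deg_mult split: if_splits)
    define good' where "good' i s' r \<longleftrightarrow> (\<forall>d\<in>digits n. r d \<in> polys_deg n D') \<and>
      R i s' = (\<Sum>d\<in>digits n. Poly_Mapping.single d 1 * r d ^ q)" for i s' r
    have ex': "\<exists>r. good' i s' r" if "i < k" "s' < m" for i s'
      unfolding good'_def by (rule digit_decomposition[OF R[OF that]])
    define r where "r i s' = (SOME r. good' i s' r)" for i s'
    have "good' i s' (r i s')" if "i < k" "s' < m" for i s'
      unfolding r_def by (rule someI_ex[OF ex'[OF that]])
    then have r: "\<And>i s' d. i < k \<Longrightarrow> s' < m \<Longrightarrow> d \<in> digits n \<Longrightarrow> r i s' d \<in> polys_deg n D'"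
      "\<And>i s'. i < k \<Longrightarrow> s' < m \<Longrightarrow> R i s' = (\<Sum>d\<in>digits n. Poly_Mapping.single d 1 * r i s' d ^ q)"
      by (simp_all add: good'_def)
    define dec where "dec d i s = (if i < k \<and> s < m then r i s d else 0)" for d i s
    have "dec d \<in> V" if "d \<in> digits n" for d
      using r(1) that by (auto simp: V_def dec_def)
    moreover have "F L (\<lambda>i j. q * a i j + w i j) =
        (\<Sum>d\<in>digits n. emb (Poly_Mapping.single d 1) * F (dec d) a ^ q)" for a
    proof -
      have \<eta>: "\<eta> (\<lambda>j. q * a i j + w i j) s = (\<Sum>s'<m. \<eta> (a i) s' ^ q * emb (P i s' s))" for i s
      proof -
        have "\<eta> (\<lambda>j. q * a i j + w i j) s =
            (\<Sum>s'<m. xact n m X (a i) v s' ^ q * xact n m X (w i) (U s') s / emb h ^ (n + 1))"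
          unfolding \<eta>_def by (subst xact_digit[OF fm q frobE]) (simp add: sum_divide_distrib)
        also have "\<dots> = (\<Sum>s'<m. \<eta> (a i) s' ^ q * emb (P i s' s))"
        proof (intro sum.cong refl)
          fix s' assume "s' \<in> {..<m}"
          then have "emb (P i s' s) = emb h ^ ?E * xact n m X (w i) (U s') s"
            using P(2) by simp
          moreover define H where "H = emb h ^ (n + 1)"
          moreover define G where "G = emb h ^ ?E"
          \<comment> \<open>The q-th power of the old scaled vector has denominator
            \<open>H ^ q\<close>, the new scaled vector has denominator \<open>H\<close>. The
            difference is the factor \<open>G\<close>, which is just what turns the entries for
            \<open>w\<close> into polynomials.\<close>
          have HG: "H ^ q = G * H"
          proof -
            obtain q' where "q = Suc q'" using q by (cases q) auto
            then show ?thesis by (simp add: H_def G_def algebra_simps flip: power_add power_mult power_Suc)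
          qed
          have "H \<noteq> 0" "G \<noteq> 0"
            using h(2) by (simp_all add: H_def G_def)
          then have "x ^ q * y / H = (x / H) ^ q * (G * y)" for x y
            by (simp add: power_divide HG)
          ultimately show "xact n m X (a i) v s' ^ q * xact n m X (w i) (U s') s / emb h ^ (n + 1) =
              \<eta> (a i) s' ^ q * emb (P i s' s)"
            by (simp add: \<eta>_def G_def)
        qed
        finally show ?thesis .
      qed
      have "F L (\<lambda>i j. q * a i j + w i j) =
          (\<Sum>i<k. \<Sum>s<m. \<Sum>s'<m. \<eta> (a i) s' ^ q * emb (L i s * P i s' s))"
        by (simp add: F_def \<eta> sum_distrib_left mult_ac)
      also have "\<dots> = (\<Sum>i<k. \<Sum>s'<m. \<Sum>s<m. \<eta> (a i) s' ^ q * emb (L i s * P i s' s))"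
        by (intro sum.cong refl sum.swap)
      also have "\<dots> = (\<Sum>i<k. \<Sum>s'<m. \<eta> (a i) s' ^ q * emb (R i s'))"
        by (simp add: R_def emb_sum sum_distrib_left)
      also have "\<dots> = (\<Sum>i<k. \<Sum>s'<m. \<Sum>d\<in>digits n. emb (Poly_Mapping.single d 1) * (emb (dec d i s') * \<eta> (a i) s') ^ q)"
        by (intro sum.cong refl) (simp add: r(2) dec_def emb_sum sum_distrib_left power_mult_distrib mult_ac)
      also have "\<dots> = (\<Sum>i<k. \<Sum>d\<in>digits n. \<Sum>s'<m. emb (Poly_Mapping.single d 1) * (emb (dec d i s') * \<eta> (a i) s') ^ q)"
        by (intro sum.cong refl sum.swap)
      also have "\<dots> = (\<Sum>d\<in>digits n. \<Sum>i<k. \<Sum>s'<m. emb (Poly_Mapping.single d 1) * (emb (dec d i s') * \<eta> (a i) s') ^ q)"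
        by (rule sum.swap)
      also have "\<dots> = (\<Sum>d\<in>digits n. emb (Poly_Mapping.single d 1) * F (dec d) a ^ q)"
        using q by (simp add: F_def frobenius_sum[OF _ frobE] sum_distrib_left)
      finally show ?thesis .
    qed
    ultimately show ?thesis by blast
  qed
  have step: "T (\<lambda>i j. q * a i j + w i j) = T (\<lambda>i j. q * b i j + w i j)"
    if ab: "T a = T b" and w: "\<And>i j. w i j < q" for a b w
  proof -
    have fin: "finite (digits n)" using finite_card_box by blast
    have "F L (\<lambda>i j. q * a i j + w i j) = 0 \<longleftrightarrow> F L (\<lambda>i j. q * b i j + w i j) = 0" if L: "L \<in> V" for L
    proof -
      obtain dec where dec: "\<forall>d\<in>digits n. dec d \<in> V"
        "\<forall>a. F L (\<lambda>i j. q * a i j + w i j) = (\<Sum>d\<in>digits n. emb (Poly_Mapping.single d 1) * F (dec d) a ^ q)"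
        using decomp[of L w, OF L w] by blast
      \<comment> \<open>Independence of the digit monomials over q-th powers makes \<open>L\<close>
        vanish at the new tuple exactly if every \<open>dec d\<close> vanishes at the old one. So
        the old state and the digits determine the new state.\<close>
      have "F L (\<lambda>i j. q * a i j + w i j) = 0 \<longleftrightarrow> (\<forall>d\<in>digits n. dec d \<in> T a)" for a
        using dec digits_independent[where n = n and z = "\<lambda>d. F (dec d) a"] q by (auto simp: T_def power_0_left)
      then show ?thesis by (simp add: ab)
    qed
    then show ?thesis by (auto simp: T_def)
  qed
  have dec: "value c b = (\<lambda>_. 0)" if ab: "T a = T b" and a: "value c a = (\<lambda>_. 0)" for a b c
  proof
    fix t
    show "value c b t = 0"
    proof (cases "t < m")
      case False
      then have "xact n m X e v t = 0" for e
        using beyond by (intro xact_zero_beyond[OF fm q frobE]) auto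
      then show ?thesis by (simp add: value_def)
    next
      case True
      \<comment> \<open>A relation with coefficients in K, read at coordinate \<open>t\<close>, is
        itself a form of degree 0; the state therefore decides it.\<close>
      define L where "L i s = (if i < k \<and> s = t then pconst (c i) else 0)" for i s
      have L: "L \<in> V" using True by (auto simp: V_def L_def)
      have F: "F L e = value c e t / emb h ^ (n + 1)" for e
      proof -
        have "F L e = (\<Sum>i<k. \<Sum>s<m. if s = t then emb (pconst (c i)) * \<eta> (e i) t else 0)"
          unfolding F_def by (intro sum.cong refl) (auto simp: L_def)
        then show ?thesis
          using True by (simp add: value_def \<eta>_def sum_divide_distrib)
      qed
      have "L \<in> T a" using L F a by (simp add: T_def)
      then have "L \<in> T b" using ab by simp
      then have "F L b = 0" by (simp add: T_def)
      with F h(2) show ?thesis by simp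
    qed
  qed
  show ?thesis
  proof (intro exI[of _ V] exI[of _ T] conjI allI impI)
    show "finite V" "card V \<le> (card (UNIV :: 'k set) ^ ((D * (n + 1) + 1) ^ n)) ^ (k * M)"
      using V unfolding D'_def by blast+
    show "T a \<subseteq> V" for a
      unfolding T_def by blast
    show "T (\<lambda>i j. q * a i j + w i j) = T (\<lambda>i j. q * b i j + w i j)"
      if "T a = T b" "\<forall>i j. w i j < q" for a b w
      using that by (intro step) blast+
    show "value c b = (\<lambda>_. 0)" if "T a = T b" "value c a = (\<lambda>_. 0)" for a b c
      using that by (rule dec)
  qed
qed

end

section \<open>Computing with lists of terms\<close>

lemma funpow_app_frac:
  fixes h g :: "'a::idom"
  shows "(app m (\<lambda>s t. emb (M s t) / emb h) ^^ k) (\<lambda>t. emb (r t) / emb g) =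
    (\<lambda>t. emb ((app m M ^^ k) r t) / (emb g * emb h ^ k))"
proof (induction k)
  case (Suc k)
  then show ?case
    by (simp add: app_def emb_sum sum_divide_distrib mult_ac)
qed simp

lemma xact_frac:
  fixes h g :: "'a::idom"
  shows "xact n m (\<lambda>j s t. emb (X j s t) / emb h) e (\<lambda>t. emb (r t) / emb g) =
    (\<lambda>t. emb (xact n m X e r t) / (emb g * emb h ^ (\<Sum>j<n. e j)))"
proof (induction n)
  case (Suc n)
  then show ?case
    using funpow_app_frac[where M = "X n" and r = "xact n m X e r" and g = "g * h ^ (\<Sum>j<n. e j)"]
    by (simp add: xact_Suc power_add mult_ac)
qed (simp add: xact_0)

lemma app_frac:
  fixes h g :: "'a::idom"
  shows "app m (\<lambda>s t. emb (M s t) / emb h) (\<lambda>t. emb (r t) / emb g) = (\<lambda>t. emb (app m M r t) / (emb g * emb h))"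
  using funpow_app_frac[where k = 1] by simp

text \<open>Clearing denominators: in the first and third identity both sides have the same one. In
  the second, the left side has \<open>h ^ q * h\<close> and the right side only \<open>h\<close>,
  which leaves the factor \<open>h ^ q\<close>.\<close>

lemma frob_module_frac:
  fixes h :: "'a::idom"
  assumes h: "h \<noteq> 0"
  shows "frob_module n q m (\<lambda>j s t. emb (X j s t) / emb h) (\<lambda>s t. emb (U s t) / emb h) (\<lambda>t. emb (v t) / emb h) \<longleftrightarrow>
    (\<forall>i<n. \<forall>j<n. \<forall>s<m. app m (X i) (X j s) = app m (X j) (X i s)) \<and>
    app m U (\<lambda>s. v s ^ q) = (\<lambda>t. h ^ q * v t) \<and>
    (\<forall>j<n. \<forall>s<m. app m U (\<lambda>t. X j s t ^ q) = (app m (X j) ^^ q) (U s))"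
proof -
  have 1: "app m (\<lambda>s t. emb (U s t) / emb h) (\<lambda>s. (emb (w s) / emb h) ^ q) =
      (\<lambda>t. emb (app m U (\<lambda>s. w s ^ q) t) / (emb h ^ q * emb h))" for w
    using app_frac[of m U h "\<lambda>s. w s ^ q" "h ^ q"] by (simp add: power_divide)
  have 2: "(\<lambda>t. emb (x t) / (emb h ^ q * emb h)) = (\<lambda>t. emb (y t) / emb h) \<longleftrightarrow> x = (\<lambda>t. h ^ q * y t)" for x y
  proof -
    have "emb (x t) / (emb h ^ q * emb h) = emb (y t) / emb h \<longleftrightarrow> emb (x t) = emb (h ^ q * y t)" for t
      using h by (simp add: field_simps)
    then show ?thesis by (simp add: fun_eq_iff del: emb_simps emb_power)
  qed
  have 3: "(\<lambda>t. emb (x t) / (emb h * emb h)) = (\<lambda>t. emb (y t) / (emb h * emb h)) \<longleftrightarrow> x = y" for x y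
    using h by (simp add: fun_eq_iff)
  have 4: "(\<lambda>t. emb (x t) / (emb h ^ q * emb h)) = (\<lambda>t. emb (y t) / (emb h * emb h ^ q)) \<longleftrightarrow> x = y" for x y
    using h by (simp add: fun_eq_iff mult.commute)
  show ?thesis
    unfolding frob_module_def app_frac funpow_app_frac 1 2 3 4 ..
qed

lemma emb_sum_list: "emb (\<Sum>x\<leftarrow>xs. f x) = (\<Sum>x\<leftarrow>xs. emb (f x))"
  by (induction xs) auto

text \<open>\<open>Poly_Mapping.nth\<close> forgets trailing zeros, so exponent lists can be
  compared as lists only at equal length. This is what \<open>plen\<close> and \<open>vlen\<close>
  provide.\<close>

lemma inj_nth_length: "length e = length e' \<Longrightarrow> Poly_Mapping.nth e = Poly_Mapping.nth e' \<longleftrightarrow> e = (e' :: nat list)"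
proof
  assume len: "length e = length e'" and eq: "Poly_Mapping.nth e = Poly_Mapping.nth e'"
  show "e = e'"
  proof (rule nth_equalityI[OF len])
    fix i assume "i < length e"
    with len show "e ! i = e' ! i"
      using arg_cong[OF eq, of "\<lambda>x. Poly_Mapping.lookup x i"] by (simp add: nth_default_def)
  qed
qed simp

definition eadd :: "nat \<Rightarrow> nat list \<Rightarrow> nat list \<Rightarrow> nat list" where
  "eadd n e e' = map (\<lambda>i. nth_default 0 e i + nth_default 0 e' i) [0..<n]"

lemma length_eadd [simp]: "length (eadd n e e') = n"
  by (simp add: eadd_def)

lemma nth_eadd:
  "length e = n \<Longrightarrow> length e' = n \<Longrightarrow> Poly_Mapping.nth (eadd n e e') = Poly_Mapping.nth e + Poly_Mapping.nth e'"
  by (intro poly_mapping_eqI) (simp add: lookup_add eadd_def nth_default_def)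

text \<open>Coefficients are stored as codes. In a vector, an entry \<open>((s, e), c)\<close> adds
  the term with exponents \<open>e\<close> and coefficient \<open>c\<close> to component
  \<open>s\<close>. Repeated keys are allowed, so that addition is \<open>@\<close>; only the zero
  test collects coefficients.\<close>

type_synonym lpoly = "(nat list \<times> nat) list"
type_synonym lvec = "((nat \<times> nat list) \<times> nat) list"

definition plen :: "nat \<Rightarrow> lpoly \<Rightarrow> bool" where
  "plen n p \<longleftrightarrow> (\<forall>u\<in>set p. length (fst u) = n)"

definition vlen :: "nat \<Rightarrow> nat \<Rightarrow> lvec \<Rightarrow> bool" where
  "vlen n m v \<longleftrightarrow> (\<forall>u\<in>set v. fst (fst u) < m \<and> length (snd (fst u)) = n)"

definition pv :: "lpoly \<Rightarrow> lvec" where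
  "pv p = map (\<lambda>u. ((0, fst u), snd u)) p"

text \<open>The componentwise q-th power: no mixed terms arise by \<open>frob\<close>, and
  coefficients stay unchanged by \<open>fix_q\<close>.\<close>

definition frobv :: "nat \<Rightarrow> lvec \<Rightarrow> lvec" where
  "frobv q v = map (\<lambda>u. ((fst (fst u), map (\<lambda>x. q * x) (snd (fst u))), snd u)) v"

locale coded_field = frobenius_field q K for q and K :: "'k::{finite,field} itself" +
  fixes enc :: "'k \<Rightarrow> nat"
  assumes inj_enc: "inj enc"
begin

definition dec :: "nat \<Rightarrow> 'k" where
  "dec = inv_into UNIV enc"

lemma dec_enc [simp]: "dec (enc c) = c"
  using inj_enc by (simp add: dec_def)

text \<open>A number outside the range of \<open>enc\<close> is also read as some field element.
  Since K is finite, these operations are finite case distinctions and hence computable.\<close>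

definition kadd :: "nat \<Rightarrow> nat \<Rightarrow> nat" where "kadd x y = enc (dec x + dec y)"
definition kmul :: "nat \<Rightarrow> nat \<Rightarrow> nat" where "kmul x y = enc (dec x * dec y)"
definition kneg :: "nat \<Rightarrow> nat" where "kneg x = enc (- dec x)"

definition csum :: "'b \<Rightarrow> ('b \<times> nat) list \<Rightarrow> nat" where
  "csum k xs = foldl (\<lambda>acc u. if fst u = k then kadd acc (snd u) else acc) (enc 0) xs"

definition pzero :: "('b \<times> nat) list \<Rightarrow> bool" where
  "pzero xs \<longleftrightarrow> (\<forall>u\<in>set xs. csum (fst u) xs = enc 0)"

definition vneg :: "lvec \<Rightarrow> lvec" where
  "vneg v = map (\<lambda>u. (fst u, kneg (snd u))) v"

definition veq :: "lvec \<Rightarrow> lvec \<Rightarrow> bool" where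
  "veq u v \<longleftrightarrow> pzero (u @ vneg v)"

definition vmul :: "nat \<Rightarrow> lpoly \<Rightarrow> lvec \<Rightarrow> lvec" where
  "vmul n p v = concat (map (\<lambda>t. map (\<lambda>u. ((fst (fst u), eadd n (fst t) (snd (fst u))), kmul (snd t) (snd u))) v) p)"

definition lapp :: "nat \<Rightarrow> lvec list \<Rightarrow> lvec \<Rightarrow> lvec" where
  "lapp n M v = concat (map (\<lambda>u. vmul n [(snd (fst u), snd u)] (nth_default [] M (fst (fst u)))) v)"

definition lxact :: "nat \<Rightarrow> lvec list list \<Rightarrow> nat list \<Rightarrow> lvec \<Rightarrow> lvec" where
  "lxact n Xs e v = foldl (\<lambda>u j. ((\<lambda>w. lapp n (nth_default [] Xs j) w) ^^ nth_default 0 e j) u) v [0..<n]"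

text \<open>The vector \<open>ev\<close> of \<open>f\<close> with denominators cleared. If the
  matrices and \<open>v\<close> have denominator \<open>h\<close>, a term of total degree d has
  denominator \<open>h ^ (d + 1)\<close>; the sum of all total degrees in \<open>f\<close> bounds
  every d and supplies a common power. The list \<open>replicate n 0\<close> is the exponent vector
  of a constant.\<close>

definition hev :: "nat \<Rightarrow> lpoly \<Rightarrow> lvec list list \<Rightarrow> lvec \<Rightarrow> lpoly \<Rightarrow> lvec" where
  "hev n h Xs v f = concat (map (\<lambda>u. vmul n [(replicate n 0, snd u)]
    (((\<lambda>w. vmul n h w) ^^ (sum_list (map (\<lambda>t. sum_list (fst t)) f) - sum_list (fst u))) (lxact n Xs (fst u) v))) f)"

section \<open>Meaning of the operations on term lists\<close>

definition coef :: "('b \<times> nat) list \<Rightarrow> 'b \<Rightarrow> 'k" where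
  "coef xs k = (\<Sum>u\<leftarrow>xs. if fst u = k then dec (snd u) else 0)"

lemma dec_csum: "dec (csum k xs) = coef xs k" and csum_range: "enc (dec (csum k xs)) = csum k xs"
proof -
  have "dec (foldl (\<lambda>acc u. if fst u = k then kadd acc (snd u) else acc) a xs) = dec a + coef xs k" for a
    by (induction xs arbitrary: a) (auto simp: coef_def kadd_def)
  from this[of "enc 0"] show "dec (csum k xs) = coef xs k"
    by (simp add: csum_def)
  have "enc (dec (foldl (\<lambda>acc u. if fst u = k then kadd acc (snd u) else acc) (enc c) xs)) =
      foldl (\<lambda>acc u. if fst u = k then kadd acc (snd u) else acc) (enc c) xs" for c
    by (induction xs arbitrary: c) (auto simp: kadd_def)
  then show "enc (dec (csum k xs)) = csum k xs"
    by (simp add: csum_def)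
qed

lemma coef_eq_0: "k \<notin> fst ` set xs \<Longrightarrow> coef xs k = 0"
  by (induction xs) (auto simp: coef_def)

lemma pzero_iff: "pzero xs \<longleftrightarrow> (\<forall>k. coef xs k = 0)"
proof -
  have "csum k xs = enc 0 \<longleftrightarrow> coef xs k = 0" for k
    using dec_csum[of k xs] csum_range[of k xs] by (metis dec_enc)
  then show ?thesis
    unfolding pzero_def using coef_eq_0[of _ xs] by force
qed

definition pol :: "lpoly \<Rightarrow> 'k mpoly" where
  "pol p = (\<Sum>u\<leftarrow>p. Poly_Mapping.single (Poly_Mapping.nth (fst u)) (dec (snd u)))"

definition vec :: "lvec \<Rightarrow> nat \<Rightarrow> 'k mpoly" where
  "vec v s = (\<Sum>u\<leftarrow>v. if fst (fst u) = s then Poly_Mapping.single (Poly_Mapping.nth (snd (fst u))) (dec (snd u)) else 0)"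

lemma pol_simps [simp]:
  "pol [] = 0" "pol (u # p) = Poly_Mapping.single (Poly_Mapping.nth (fst u)) (dec (snd u)) + pol p"
  "pol (p @ p') = pol p + pol p'"
  by (simp_all add: pol_def)

lemma vec_simps [simp]:
  "vec [] s = 0"
  "vec (u # v) s = (if fst (fst u) = s then Poly_Mapping.single (Poly_Mapping.nth (snd (fst u))) (dec (snd u)) else 0) + vec v s"
  "vec (v @ v') s = vec v s + vec v' s"
  by (simp_all add: vec_def)

lemma vec_pv: "vec (pv p) s = (if s = 0 then pol p else 0)"
  by (induction p) (auto simp: pv_def)

lemma lookup_pol: "plen n p \<Longrightarrow> length e = n \<Longrightarrow> Poly_Mapping.lookup (pol p) (Poly_Mapping.nth e) = coef p e"
  by (induction p) (auto simp: coef_def plen_def lookup_add lookup_single when_def inj_nth_length)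

lemma keys_pol: "Poly_Mapping.keys (pol p) \<subseteq> Poly_Mapping.nth ` fst ` set p"
proof (induction p)
  case (Cons u p)
  show ?case
    using keys_add[of "Poly_Mapping.single (Poly_Mapping.nth (fst u)) (dec (snd u))" "pol p"] Cons
    by (auto split: if_splits)
qed simp

lemma pol_eq_0_iff:
  assumes "plen n p"
  shows "pol p = 0 \<longleftrightarrow> (\<forall>e. coef p e = 0)"
proof
  assume 0: "pol p = 0"
  show "\<forall>e. coef p e = 0"
  proof
    fix e
    show "coef p e = 0"
    proof (cases "length e = n")
      case True
      with lookup_pol[OF assms True] 0 show ?thesis by simp
    next
      case False
      then show ?thesis using assms by (intro coef_eq_0) (auto simp: plen_def)
    qed
  qed
next
  assume 0: "\<forall>e. coef p e = 0"
  have False if key: "x \<in> Poly_Mapping.keys (pol p)" for x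
  proof -
    obtain u where u: "u \<in> set p" "x = Poly_Mapping.nth (fst u)"
      using keys_pol key by blast
    then have "Poly_Mapping.lookup (pol p) x = 0"
      using lookup_pol[OF assms, of "fst u"] assms 0 by (simp add: plen_def)
    with key show False by (simp add: in_keys_iff)
  qed
  then show "pol p = 0"
    by (metis equals0I keys_eq_empty)
qed

lemma pzero_pol: "plen n p \<Longrightarrow> pzero p \<longleftrightarrow> pol p = 0"
  by (simp add: pzero_iff pol_eq_0_iff)

lemma vec_conv_pol:
  "vec v s = pol (map (\<lambda>u. (snd (fst u), snd u)) (filter (\<lambda>u. fst (fst u) = s) v))"
  by (induction v) auto

lemma pzero_vec:
  assumes "vlen n m v"
  shows "pzero v \<longleftrightarrow> vec v = (\<lambda>_. 0)"
proof -
  have coef: "coef v (s, e) = coef (map (\<lambda>u. (snd (fst u), snd u)) (filter (\<lambda>u. fst (fst u) = s) v)) e" for s e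
    by (induction v) (auto simp: coef_def)
  have plen: "plen n (map (\<lambda>u. (snd (fst u), snd u)) (filter (\<lambda>u. fst (fst u) = s) v))" for s
    using assms by (auto simp: plen_def vlen_def)
  have "vec v s = 0 \<longleftrightarrow> (\<forall>e. coef v (s, e) = 0)" for s
    unfolding vec_conv_pol pol_eq_0_iff[OF plen] coef ..
  then show ?thesis
    by (auto simp: pzero_iff fun_eq_iff)
qed

lemma vlen_append: "vlen n m (u @ v) \<longleftrightarrow> vlen n m u \<and> vlen n m v"
  by (auto simp: vlen_def)

lemma vec_vneg: "vec (vneg v) s = - vec v s"
  by (induction v) (auto simp: vneg_def kneg_def single_uminus)

lemma vlen_vneg: "vlen n m (vneg v) \<longleftrightarrow> vlen n m v"
  by (auto simp: vlen_def vneg_def)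

lemma veq_iff: "vlen n m u \<Longrightarrow> vlen n m v \<Longrightarrow> veq u v \<longleftrightarrow> vec u = vec v"
  unfolding veq_def by (subst pzero_vec[of n m]) (auto simp: vlen_append vlen_vneg vec_vneg fun_eq_iff)

lemma vec_vmul:
  assumes "plen n p" "vlen n m v"
  shows "vec (vmul n p v) s = pol p * vec v s"
proof -
  have one: "vec (map (\<lambda>u. ((fst (fst u), eadd n e (snd (fst u))), kmul c (snd u))) v) s =
      Poly_Mapping.single (Poly_Mapping.nth e) (dec c) * vec v s" if "length e = n" for e c
    using assms(2) that
    by (induction v) (auto simp: vlen_def mult_single nth_eadd kmul_def distrib_left)
  show ?thesis
    using assms(1) by (induction p) (auto simp: vmul_def plen_def one distrib_right)
qed

lemma vlen_vmul: "vlen n m v \<Longrightarrow> vlen n m (vmul n p v)"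
  by (auto simp: vlen_def vmul_def)

lemma vec_funpow_vmul:
  "plen n p \<Longrightarrow> vlen n m v \<Longrightarrow> vec (((\<lambda>w. vmul n p w) ^^ k) v) s = pol p ^ k * vec v s \<and>
    vlen n m (((\<lambda>w. vmul n p w) ^^ k) v)"
  by (induction k) (auto simp: vec_vmul[of n _ m] vlen_vmul mult.assoc)

definition mat :: "lvec list \<Rightarrow> nat \<Rightarrow> nat \<Rightarrow> 'k mpoly" where
  "mat M s = vec (nth_default [] M s)"

definition mlen :: "nat \<Rightarrow> nat \<Rightarrow> lvec list \<Rightarrow> bool" where
  "mlen n m M \<longleftrightarrow> (\<forall>v\<in>set M. vlen n m v)"

lemma mlenD: "mlen n m M \<Longrightarrow> vlen n m (nth_default [] M s)"
  by (cases "s < length M") (simp_all add: mlen_def nth_default_nth nth_default_beyond, simp add: vlen_def)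

lemma vec_lapp:
  assumes "vlen n m v" "mlen n m M"
  shows "vec (lapp n M v) = app m (mat M) (vec v)"
proof
  fix t
  show "vec (lapp n M v) t = app m (mat M) (vec v) t"
    using assms(1)
  proof (induction v)
    case Nil
    then show ?case by (simp add: lapp_def app_def)
  next
    case (Cons u v)
    obtain s e c where u: "u = ((s, e), c)" by (metis prod.collapse)
    have "s < m" "length e = n" and v: "vlen n m v"
      using Cons.prems by (auto simp: vlen_def u)
    then have "vec (vmul n [(e, c)] (nth_default [] M s)) t = Poly_Mapping.single (Poly_Mapping.nth e) (dec c) * mat M s t"
      using vec_vmul[OF _ mlenD[OF assms(2)], of "[(e, c)]"] by (simp add: plen_def mat_def)
    moreover have "(\<Sum>s'<m. vec (u # v) s' * mat M s' t) =
        Poly_Mapping.single (Poly_Mapping.nth e) (dec c) * mat M s t + (\<Sum>s'<m. vec v s' * mat M s' t)"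
    proof -
      have "(\<Sum>s'<m. vec (u # v) s' * mat M s' t) =
          (\<Sum>s'<m. (if s' = s then Poly_Mapping.single (Poly_Mapping.nth e) (dec c) * mat M s t else 0) + vec v s' * mat M s' t)"
        by (intro sum.cong) (auto simp: u distrib_right)
      with \<open>s < m\<close> show ?thesis by (simp add: sum.distrib)
    qed
    ultimately show ?case
      using Cons.IH[OF v] by (simp add: lapp_def app_def u)
  qed
qed

lemma vlen_lapp: "mlen n m M \<Longrightarrow> vlen n m (lapp n M v)"
  using vlen_vmul[OF mlenD, of n m M] unfolding lapp_def vlen_def by fastforce

lemma vec_funpow_lapp:
  "mlen n m M \<Longrightarrow> vlen n m v \<Longrightarrow> vec (((\<lambda>w. lapp n M w) ^^ k) v) = (app m (mat M) ^^ k) (vec v) \<and>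
    vlen n m (((\<lambda>w. lapp n M w) ^^ k) v)"
  by (induction k) (auto simp: vec_lapp vlen_lapp)

lemma vec_frobv: "vec (frobv q v) s = vec v s ^ q"
proof (induction v)
  case Nil
  then show ?case using q by (simp add: frobv_def)
next
  case (Cons u v)
  have nth: "Poly_Mapping.nth (map (\<lambda>x. q * x) e) = scale_exp q (Poly_Mapping.nth e)" for e :: "nat list"
    by (intro poly_mapping_eqI) (simp add: nth_default_def)
  show ?case
    using Cons q by (auto simp: frobv_def frob single_power fix_q nth power_0_left)
qed

lemma vlen_frobv: "vlen n m v \<Longrightarrow> vlen n m (frobv q v)"
  by (auto simp: vlen_def frobv_def)

lemma vec_lxact:
  assumes "\<And>j. mlen n m (nth_default [] Xs j)" "vlen n m v"
  shows "vec (lxact n Xs e v) = xact n m (\<lambda>j. mat (nth_default [] Xs j)) (nth_default 0 e) (vec v) \<and>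
    vlen n m (lxact n Xs e v)"
proof -
  have "vec (foldl (\<lambda>u j. ((\<lambda>w. lapp n (nth_default [] Xs j) w) ^^ nth_default 0 e j) u) v [0..<l]) =
      xact l m (\<lambda>j. mat (nth_default [] Xs j)) (nth_default 0 e) (vec v) \<and>
      vlen n m (foldl (\<lambda>u j. ((\<lambda>w. lapp n (nth_default [] Xs j) w) ^^ nth_default 0 e j) u) v [0..<l])" for l
    by (induction l) (simp_all add: xact_0 xact_Suc assms vec_funpow_lapp[where m = m])
  then show ?thesis
    by (simp add: lxact_def)
qed

lemma ev_pol:
  "ev n m X v (pol f) t = (\<Sum>u\<leftarrow>f. emb (pconst (dec (snd u))) * xact n m X (nth_default 0 (fst u)) v t)"
  by (induction f) (auto simp: ev_0 ev_add ev_single)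

lemma hev_zero_iff:
  assumes X: "\<And>j. mlen n m (nth_default [] Xs j)" and v: "vlen n m v" and h: "plen n h" "pol h \<noteq> 0"
    and f: "plen n f"
  shows "pzero (hev n h Xs v f) \<longleftrightarrow>
    ev n m (\<lambda>j s t. emb (mat (nth_default [] Xs j) s t) / emb (pol h)) (\<lambda>t. emb (vec v t) / emb (pol h)) (pol f) = (\<lambda>_. 0)"
proof -
  define N where "N = sum_list (map (\<lambda>t. sum_list (fst t)) f)"
  define \<zeta> where "\<zeta> e = xact n m (\<lambda>j. mat (nth_default [] Xs j)) (nth_default 0 e) (vec v)" for e
  have nth0: "Poly_Mapping.nth (replicate n 0) = (0 :: nat \<Rightarrow>\<^sub>0 nat)"
    by (intro poly_mapping_eqI) (simp add: nth_default_def)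
  have pl: "plen n [(replicate n 0, c)]" for c
    by (simp add: plen_def)
  have part: "vec (concat (map (\<lambda>u. vmul n [(replicate n 0, snd u)]
        (((\<lambda>w. vmul n h w) ^^ (N - sum_list (fst u))) (lxact n Xs (fst u) v))) g)) t =
      (\<Sum>u\<leftarrow>g. pconst (dec (snd u)) * (pol h ^ (N - sum_list (fst u)) * \<zeta> (fst u) t)) \<and>
      vlen n m (concat (map (\<lambda>u. vmul n [(replicate n 0, snd u)]
        (((\<lambda>w. vmul n h w) ^^ (N - sum_list (fst u))) (lxact n Xs (fst u) v))) g))" for g t
  proof (induction g)
    case Nil
    then show ?case by (simp add: vlen_def)
  next
    case (Cons u g)
    have 1: "vec (lxact n Xs (fst u) v) = \<zeta> (fst u)" "vlen n m (lxact n Xs (fst u) v)"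
      using vec_lxact[OF X v] by (auto simp: \<zeta>_def)
    note 2 = vec_funpow_vmul[OF h(1) 1(2), of "N - sum_list (fst u)"]
    show ?case
      using Cons 2 vec_vmul[OF pl, of m] by (simp add: vlen_append vlen_vmul 1 nth0)
  qed
  have scaled: "emb (vec (hev n h Xs v f) t) = emb (pol h) ^ (N + 1) *
      ev n m (\<lambda>j s t. emb (mat (nth_default [] Xs j) s t) / emb (pol h)) (\<lambda>t. emb (vec v t) / emb (pol h)) (pol f) t" for t
  proof -
    have tm: "emb (pol h) ^ (N + 1) * (emb (pconst (dec (snd u))) * xact n m
        (\<lambda>j s t. emb (mat (nth_default [] Xs j) s t) / emb (pol h)) (nth_default 0 (fst u)) (\<lambda>t. emb (vec v t) / emb (pol h)) t) =
        emb (pconst (dec (snd u)) * (pol h ^ (N - sum_list (fst u)) * \<zeta> (fst u) t))" if u: "u \<in> set f" for u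
    proof -
      have "length (fst u) = n" using f u by (simp add: plen_def)
      then have sum: "(\<Sum>j<n. nth_default 0 (fst u) j) = sum_list (fst u)"
        by (simp add: sum_list_sum_nth atLeast0LessThan nth_default_def)
      have "sum_list (fst u) \<le> N"
        unfolding N_def using u by (intro member_le_sum_list) auto
      then have "emb (pol h) ^ (N + 1) = emb (pol h) ^ (N - sum_list (fst u)) * (emb (pol h) * emb (pol h) ^ sum_list (fst u))"
        by (simp flip: power_add power_Suc)
      then show ?thesis
        using h(2) by (simp add: xact_frac sum \<zeta>_def)
    qed
    have "emb (vec (hev n h Xs v f) t) =
        (\<Sum>u\<leftarrow>f. emb (pconst (dec (snd u)) * (pol h ^ (N - sum_list (fst u)) * \<zeta> (fst u) t)))"
      unfolding hev_def N_def[symmetric] part[THEN conjunct1] emb_sum_list ..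
    also have "\<dots> = (\<Sum>u\<leftarrow>f. emb (pol h) ^ (N + 1) * (emb (pconst (dec (snd u))) * xact n m
        (\<lambda>j s t. emb (mat (nth_default [] Xs j) s t) / emb (pol h)) (nth_default 0 (fst u))
        (\<lambda>t. emb (vec v t) / emb (pol h)) t))"
      using tm by (intro arg_cong[of _ _ sum_list] map_cong refl) (rule sym)
    finally show ?thesis
      unfolding ev_pol sum_list_const_mult .
  qed
  have "vec (hev n h Xs v f) t = 0 \<longleftrightarrow>
      ev n m (\<lambda>j s t. emb (mat (nth_default [] Xs j) s t) / emb (pol h)) (\<lambda>t. emb (vec v t) / emb (pol h)) (pol f) t = 0" for t
    unfolding emb_eq_0_iff[symmetric, of "vec (hev n h Xs v f) t"] scaled using h(2) by simp
  moreover have "vlen n m (hev n h Xs v f)"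
    using part[of f] by (simp add: hev_def N_def)
  ultimately show ?thesis
    by (simp add: pzero_vec fun_eq_iff)
qed

end

section \<open>Certificates for the absence of short polynomials\<close>

text \<open>Matrices decoded from lists will agree with given ones only for variables below
  \<open>n\<close> and columns below \<open>m\<close>; the congruences confine the comparison to
  these.\<close>

lemma app_mat_cong: "(\<And>s. s < m \<Longrightarrow> M s = M' s) \<Longrightarrow> app m M = app m M'"
  by (auto simp: app_def fun_eq_iff)

lemma xact_mat_cong:
  "(\<And>j s. j < n \<Longrightarrow> s < m \<Longrightarrow> X j s = X' j s) \<Longrightarrow> xact n m X e v = xact n m X' e v"
  by (induction n) (auto simp: xact_0 xact_Suc app_mat_cong[of m "X _" "X' _"])

lemma ev_mat_cong:
  "(\<And>j s. j < n \<Longrightarrow> s < m \<Longrightarrow> X j s = X' j s) \<Longrightarrow> ev n m X v f = ev n m X' v f"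
  unfolding ev_def using xact_mat_cong[of n m X X'] by simp

lemma frob_module_cong:
  assumes "\<And>j s. j < n \<Longrightarrow> s < m \<Longrightarrow> X j s = X' j s" "\<And>s. s < m \<Longrightarrow> U s = U' s"
  shows "frob_module n q m X U v \<longleftrightarrow> frob_module n q m X' U' v"
proof -
  have "app m (X j) = app m (X' j)" if "j < n" for j
    using assms(1) that by (intro app_mat_cong) auto
  moreover have "app m U = app m U'"
    using assms(2) by (intro app_mat_cong)
  ultimately show ?thesis
    unfolding frob_module_def using assms by (auto cong: conj_cong)
qed

definition pbound :: "nat \<Rightarrow> nat \<Rightarrow> lpoly \<Rightarrow> bool" where
  "pbound n D p \<longleftrightarrow> (\<forall>u\<in>set p. length (fst u) = n \<and> (\<forall>x\<in>set (fst u). x \<le> D))"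

definition vbound :: "nat \<Rightarrow> nat \<Rightarrow> nat \<Rightarrow> lvec \<Rightarrow> bool" where
  "vbound n m D v \<longleftrightarrow> (\<forall>u\<in>set v. fst (fst u) < m \<and> length (snd (fst u)) = n \<and> (\<forall>x\<in>set (snd (fst u)). x \<le> D))"

lemma pbound_plen: "pbound n D p \<Longrightarrow> plen n p"
  by (auto simp: pbound_def plen_def)

lemma vbound_vlen: "vbound n m D v \<Longrightarrow> vlen n m v"
  by (auto simp: vbound_def vlen_def)

text \<open>Stating the existence of a bound as eventual truth in \<open>D\<close> lets finitely
  many bounds be merged by filter rules.\<close>

lemma eventually_pbound: "plen n p \<Longrightarrow> \<forall>\<^sub>F D in sequentially. pbound n D p"
  unfolding pbound_def plen_def
  by (intro eventually_ball_finite ballI eventually_conj) auto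

lemma eventually_vbound: "vlen n m v \<Longrightarrow> \<forall>\<^sub>F D in sequentially. vbound n m D v"
  unfolding vbound_def vlen_def
  by (intro eventually_ball_finite ballI eventually_conj) auto

text \<open>The components are the common denominator, the vector \<open>v\<close>, the columns of
  \<open>U\<close> and, for each variable, the columns of its matrix. The dimension is the length of
  the third component.\<close>

type_synonym lblock = "lpoly \<times> lvec \<times> lvec list \<times> lvec list list"

context coded_field
begin

lemma pol_polys_deg: "pbound n D p \<Longrightarrow> pol p \<in> polys_deg n D"
proof (induction p)
  case (Cons u p)
  then have u: "length (fst u) = n" "\<forall>x\<in>set (fst u). x \<le> D" and p: "pbound n D p"
    by (auto simp: pbound_def)
  have "Poly_Mapping.keys (Poly_Mapping.nth (fst u)) \<subseteq> {..<n}"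
    using u(1) by (auto simp: in_keys_iff nth_default_def split: if_splits simp del: keys_nth)
  moreover have "nth_default 0 (fst u) j \<le> D" for j
    using u(2) by (auto simp: nth_default_def)
  ultimately have "Poly_Mapping.single (Poly_Mapping.nth (fst u)) (dec (snd u)) \<in> polys_deg n D"
    by (auto simp: polys_deg_def intro: polys_in_single simp del: keys_nth)
  with Cons.IH[OF p] show ?case
    by (auto intro: polys_deg_add)
qed simp

lemma pol_polys_in: "plen n p \<Longrightarrow> pol p \<in> polys_in {..<n}"
proof -
  assume "plen n p"
  then obtain D where "pbound n D p"
    using eventually_happens[OF eventually_pbound] by auto
  from pol_polys_deg[OF this] show ?thesis by (simp add: polys_deg_def)
qed

lemma vec_polys_deg: "vbound n m D v \<Longrightarrow> vec v s \<in> polys_deg n D"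
  unfolding vec_conv_pol by (rule pol_polys_deg) (auto simp: vbound_def pbound_def)

lemma vec_beyond: "vlen n m v \<Longrightarrow> s \<ge> m \<Longrightarrow> vec v s = 0"
  by (induction v) (auto simp: vlen_def)

lemma terms_of_poly:
  assumes "f \<in> polys_in {..<n}"
  shows "\<exists>p. plen n p \<and> pol p = f \<and> length p = card (Poly_Mapping.keys f)"
proof -
  obtain es where es: "set es = Poly_Mapping.keys f" "distinct es"
    using finite_distinct_list[OF finite_keys[of f]] by auto
  define p where "p = map (\<lambda>e. (map (Poly_Mapping.lookup e) [0..<n], enc (Poly_Mapping.lookup f e))) es"
  have nth: "Poly_Mapping.nth (map (Poly_Mapping.lookup e) [0..<n]) = e" if "e \<in> Poly_Mapping.keys f" for e
  proof (rule poly_mapping_eqI)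
    fix i
    have "Poly_Mapping.keys e \<subseteq> {..<n}"
      using assms that by (simp add: polys_in_def)
    then have "i \<ge> n \<Longrightarrow> i \<notin> Poly_Mapping.keys e"
      by auto
    then have "i \<ge> n \<Longrightarrow> Poly_Mapping.lookup e i = 0"
      by (simp add: in_keys_iff)
    then show "Poly_Mapping.lookup (Poly_Mapping.nth (map (Poly_Mapping.lookup e) [0..<n])) i = Poly_Mapping.lookup e i"
      by (simp add: nth_default_def)
  qed
  have "pol p = (\<Sum>e\<leftarrow>es. Poly_Mapping.single (Poly_Mapping.nth (map (Poly_Mapping.lookup e) [0..<n])) (Poly_Mapping.lookup f e))"
    by (simp add: pol_def p_def o_def)
  also have "\<dots> = (\<Sum>e\<in>set es. Poly_Mapping.single (Poly_Mapping.nth (map (Poly_Mapping.lookup e) [0..<n])) (Poly_Mapping.lookup f e))"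
    using es(2) by (rule sum_list_distinct_conv_sum_set)
  also have "\<dots> = (\<Sum>e\<in>Poly_Mapping.keys f. Poly_Mapping.single e (Poly_Mapping.lookup f e))"
    unfolding es(1) using nth by (intro sum.cong) auto
  finally have "pol p = f"
    by (simp add: poly_mapping_sum_single)
  moreover have "length p = card (Poly_Mapping.keys f)"
    using distinct_card[OF es(2)] es(1) by (simp add: p_def)
  moreover have "plen n p" by (auto simp: plen_def p_def)
  ultimately show ?thesis by blast
qed

lemma terms_of_vec:
  assumes "\<And>t. t < m \<Longrightarrow> r t \<in> polys_in {..<n}" "\<And>t. t \<ge> m \<Longrightarrow> r t = 0"
  shows "\<exists>v. vlen n m v \<and> vec v = r"
  using assms
proof (induction m arbitrary: r)
  case 0
  then show ?case by (intro exI[of _ "[]"]) (auto simp: vlen_def)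
next
  case (Suc m)
  obtain v where v: "vlen n m v" "vec v = (\<lambda>t. if t < m then r t else 0)"
    using Suc.IH[of "\<lambda>t. if t < m then r t else 0"] Suc.prems(1) by auto
  obtain p where p: "plen n p" "pol p = r m"
    using terms_of_poly Suc.prems(1)[of m] by blast
  have "vec (map (\<lambda>u. ((m, fst u), snd u)) p) s = (if s = m then pol p else 0)" for s
    by (induction p) auto
  then have "vec (v @ map (\<lambda>u. ((m, fst u), snd u)) p) = r"
    using v p Suc.prems(2) by (auto simp: fun_eq_iff not_less_less_Suc_eq less_Suc_eq_le)
  moreover have "vlen n (Suc m) (v @ map (\<lambda>u. ((m, fst u), snd u)) p)"
    using v(1) p(1) by (auto simp: vlen_def plen_def)
  ultimately show ?case by blast
qed

definition block_bounds :: "nat \<Rightarrow> nat \<Rightarrow> nat \<Rightarrow> lblock \<Rightarrow> bool" where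
  "block_bounds n D M b \<longleftrightarrow> (case b of (h, v, U, Xs) \<Rightarrow>
    length U \<le> M \<and> pbound n D h \<and> vbound n (length U) D v \<and> (\<forall>u\<in>set U. vbound n (length U) D u) \<and>
    (\<forall>Y\<in>set Xs. \<forall>u\<in>set Y. vbound n (length U) D u))"

definition block_ids :: "nat \<Rightarrow> lblock \<Rightarrow> bool" where
  "block_ids n b \<longleftrightarrow> (case b of (h, v, U, Xs) \<Rightarrow>
    \<not> pzero h \<and>
    (\<forall>i\<in>set [0..<n]. \<forall>j\<in>set [0..<n]. \<forall>s\<in>set [0..<length U].
      veq (lapp n (nth_default [] Xs i) (nth_default [] (nth_default [] Xs j) s))
        (lapp n (nth_default [] Xs j) (nth_default [] (nth_default [] Xs i) s))) \<and>
    veq (lapp n U (frobv q v)) (((\<lambda>w. vmul n h w) ^^ q) v) \<and>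
    (\<forall>j\<in>set [0..<n]. \<forall>s\<in>set [0..<length U].
      veq (lapp n U (frobv q (nth_default [] (nth_default [] Xs j) s)))
        (((\<lambda>w. lapp n (nth_default [] Xs j) w) ^^ q) (nth_default [] U s))))"

definition bzero :: "nat \<Rightarrow> lblock \<Rightarrow> lpoly \<Rightarrow> bool" where
  "bzero n b f \<longleftrightarrow> (case b of (h, v, U, Xs) \<Rightarrow> pzero (hev n h Xs v f))"

definition bX :: "lblock \<Rightarrow> nat \<Rightarrow> nat \<Rightarrow> nat \<Rightarrow> 'k ratfun" where
  "bX b = (case b of (h, v, U, Xs) \<Rightarrow> \<lambda>j s t. emb (mat (nth_default [] Xs j) s t) / emb (pol h))"

definition bU :: "lblock \<Rightarrow> nat \<Rightarrow> nat \<Rightarrow> 'k ratfun" where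
  "bU b = (case b of (h, v, U, Xs) \<Rightarrow> \<lambda>s t. emb (mat U s t) / emb (pol h))"

definition bv :: "lblock \<Rightarrow> nat \<Rightarrow> 'k ratfun" where
  "bv b = (case b of (h, v, U, Xs) \<Rightarrow> \<lambda>t. emb (vec v t) / emb (pol h))"

definition bm :: "lblock \<Rightarrow> nat" where
  "bm b = (case b of (h, v, U, Xs) \<Rightarrow> length U)"

lemma mlen_nth_default: "\<forall>Y\<in>set Xs. mlen n m Y \<Longrightarrow> mlen n m (nth_default [] Xs j)"
  by (cases "j < length Xs") (simp_all add: nth_default_nth nth_default_beyond, simp add: mlen_def)

lemma block_ids_iff:
  assumes "plen n h" "vlen n (length U) v" "mlen n (length U) U" "\<forall>Y\<in>set Xs. mlen n (length U) Y"
  shows "block_ids n (h, v, U, Xs) \<longleftrightarrow> pol h \<noteq> 0 \<and>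
    frob_module n q (length U) (bX (h, v, U, Xs)) (bU (h, v, U, Xs)) (bv (h, v, U, Xs))"
proof (cases "pol h = 0")
  case True
  then show ?thesis using pzero_pol[OF assms(1)] by (simp add: block_ids_def)
next
  case False
  let ?m = "length U"
  note X = mlen_nth_default[OF assms(4)]
  have col: "vec (nth_default [] M s) = mat M s" for M s
    by (simp add: mat_def)
  have frobv: "vec (frobv q w) = (\<lambda>t. vec w t ^ q)" for w
    by (simp add: vec_frobv fun_eq_iff)
  have 1: "veq (lapp n (nth_default [] Xs i) (nth_default [] (nth_default [] Xs j) s))
        (lapp n (nth_default [] Xs j) (nth_default [] (nth_default [] Xs i) s)) \<longleftrightarrow>
      app ?m (mat (nth_default [] Xs i)) (mat (nth_default [] Xs j) s) =
      app ?m (mat (nth_default [] Xs j)) (mat (nth_default [] Xs i) s)" for i j s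
    by (subst veq_iff[of n ?m]) (simp_all add: vlen_lapp X vec_lapp[where m = ?m] mlenD[OF X] col)
  have 2: "veq (lapp n U (frobv q v)) (((\<lambda>w. vmul n h w) ^^ q) v) \<longleftrightarrow>
      app ?m (mat U) (\<lambda>s. vec v s ^ q) = (\<lambda>t. pol h ^ q * vec v t)"
    using vec_funpow_vmul[OF assms(1,2)] vlen_frobv[OF assms(2)]
    by (subst veq_iff[of n ?m])
      (simp_all add: vlen_lapp assms vec_lapp[where m = ?m] frobv fun_eq_iff)
  have 3: "veq (lapp n U (frobv q (nth_default [] (nth_default [] Xs j) s)))
        (((\<lambda>w. lapp n (nth_default [] Xs j) w) ^^ q) (nth_default [] U s)) \<longleftrightarrow>
      app ?m (mat U) (\<lambda>t. mat (nth_default [] Xs j) s t ^ q) =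
      (app ?m (mat (nth_default [] Xs j)) ^^ q) (mat U s)" for j s
    using vec_funpow_lapp[where k = q, OF X[of j] mlenD[OF assms(3), of s]] vlen_frobv[OF mlenD[OF X]]
    by (subst veq_iff[of n ?m])
      (simp_all add: vlen_lapp assms vec_lapp[where m = ?m] frobv col)
  show ?thesis
    unfolding block_ids_def bX_def bU_def bv_def prod.case frob_module_frac[OF False] 1 2 3
    using False pzero_pol[OF assms(1)] by auto
qed

text \<open>What a block that passed the checks provides, whatever its origin. The bound on the
  forms depends on \<open>D\<close> and \<open>M\<close> but not on the individual block, so it can
  be computed from the certificate.\<close>

lemma block_facts:
  assumes "block_bounds n D M b" "block_ids n b"
  shows "frob_module n q (bm b) (bX b) (bU b) (bv b)"
    and "plen n f \<Longrightarrow> bzero n b f \<longleftrightarrow> ev n (bm b) (bX b) (bv b) (pol f) = (\<lambda>_. 0)"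
    and "\<exists>V :: (nat \<Rightarrow> nat \<Rightarrow> 'k mpoly) set. \<exists>T.
      finite V \<and> card V \<le> (card (UNIV :: 'k set) ^ ((D * (n + 1) + 1) ^ n)) ^ (k * M) \<and>
      (\<forall>a. T a \<subseteq> V) \<and>
      (\<forall>a b w. T a = T b \<longrightarrow> (\<forall>i j. w i j < q) \<longrightarrow>
        T (\<lambda>i j. q * a i j + w i j) = T (\<lambda>i j. q * b i j + w i j)) \<and>
      (\<forall>a a' c. T a = T a' \<longrightarrow>
        (\<lambda>t. \<Sum>i<k. emb (pconst (c i)) * xact n (bm b) (bX b) (a i) (bv b) t) = (\<lambda>_. 0) \<longrightarrow>
        (\<lambda>t. \<Sum>i<k. emb (pconst (c i)) * xact n (bm b) (bX b) (a' i) (bv b) t) = (\<lambda>_. 0))"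
proof -
  obtain h v U Xs where b: "b = (h, v, U, Xs)"
    by (metis prod.collapse)
  let ?m = "length U"
  have bounds: "?m \<le> M" "pbound n D h" "vbound n ?m D v" "\<forall>u\<in>set U. vbound n ?m D u"
    "\<forall>Y\<in>set Xs. \<forall>u\<in>set Y. vbound n ?m D u"
    using assms(1) by (simp_all add: block_bounds_def b)
  have lens: "plen n h" "vlen n ?m v" "mlen n ?m U" "\<forall>Y\<in>set Xs. mlen n ?m Y"
    using bounds pbound_plen vbound_vlen unfolding mlen_def by blast+
  have col: "vbound n ?m D (nth_default [] Y s)" if "\<forall>u\<in>set Y. vbound n ?m D u" for Y s
    using that by (cases "s < length Y") (simp_all add: nth_default_nth nth_default_beyond, simp add: vbound_def)
  have colX: "vbound n ?m D (nth_default [] (nth_default [] Xs j) s)" for j s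
  proof (rule col)
    show "\<forall>u\<in>set (nth_default [] Xs j). vbound n ?m D u"
      using bounds(5) nth_mem by (cases "j < length Xs") (fastforce simp: nth_default_nth nth_default_beyond)+
  qed
  have fm: "pol h \<noteq> 0" "frob_module n q (bm b) (bX b) (bU b) (bv b)"
    using assms(2) unfolding b bm_def prod.case block_ids_iff[OF lens] by blast+
  show "frob_module n q (bm b) (bX b) (bU b) (bv b)" by (rule fm(2))
  show "bzero n b f \<longleftrightarrow> ev n (bm b) (bX b) (bv b) (pol f) = (\<lambda>_. 0)" if "plen n f"
    unfolding bzero_def bm_def bX_def bv_def b prod.case
    by (rule hev_zero_iff[OF mlen_nth_default[OF lens(4)] lens(2,1) fm(1) that])
  show "\<exists>V :: (nat \<Rightarrow> nat \<Rightarrow> 'k mpoly) set. \<exists>T.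
      finite V \<and> card V \<le> (card (UNIV :: 'k set) ^ ((D * (n + 1) + 1) ^ n)) ^ (k * M) \<and>
      (\<forall>a. T a \<subseteq> V) \<and>
      (\<forall>a b w. T a = T b \<longrightarrow> (\<forall>i j. w i j < q) \<longrightarrow>
        T (\<lambda>i j. q * a i j + w i j) = T (\<lambda>i j. q * b i j + w i j)) \<and>
      (\<forall>a a' c. T a = T a' \<longrightarrow>
        (\<lambda>t. \<Sum>i<k. emb (pconst (c i)) * xact n (bm b) (bX b) (a i) (bv b) t) = (\<lambda>_. 0) \<longrightarrow>
        (\<lambda>t. \<Sum>i<k. emb (pconst (c i)) * xact n (bm b) (bX b) (a' i) (bv b) t) = (\<lambda>_. 0))"
  proof (rule block_states[OF fm(2)])
    show "pol h \<in> polys_deg n D" "pol h \<noteq> 0"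
      using pol_polys_deg[OF bounds(2)] fm(1) by auto
    show "mat (nth_default [] Xs j) s t \<in> polys_deg n D \<and>
        bX b j s t = emb (mat (nth_default [] Xs j) s t) / emb (pol h)" for j s t
      using vec_polys_deg[OF colX[of j s], of t] by (simp add: mat_def bX_def b)
    show "mat U s t \<in> polys_deg n D \<and> bU b s t = emb (mat U s t) / emb (pol h)" for s t
      using vec_polys_deg[OF col[OF bounds(4)], of s t] by (simp add: mat_def bU_def b)
    show "bX b j s t = 0" if "bm b \<le> t" for j s t
      using vec_beyond[OF vbound_vlen[OF colX[of j s]]] that by (simp add: bX_def b mat_def bm_def)
    show "bv b t = 0" if "bm b \<le> t" for t
      using vec_beyond[OF lens(2)] that by (simp add: bv_def b bm_def)
    show "bm b \<le> M"
      using bounds(1) by (simp add: bm_def b)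
  qed
qed

text \<open>From the inside: polynomials of degree at most \<open>D * (n + 1)\<close>, forms in
  \<open>k\<close> vectors of dimension at most \<open>M\<close>, sets of such forms, one set for
  each of \<open>l\<close> blocks, and a relation on \<open>k\<close> indices recording which
  exponents coincide.\<close>

definition state_bound :: "nat \<Rightarrow> nat \<Rightarrow> nat \<Rightarrow> nat \<Rightarrow> nat \<Rightarrow> nat" where
  "state_bound n k D M l =
    (2 ^ ((card (UNIV :: 'k set) ^ ((D * (n + 1) + 1) ^ n)) ^ (k * M))) ^ l * 2 ^ (k * k)"

definition kcodes :: "nat list" where
  "kcodes = sorted_list_of_set (range enc)"

definition candidates :: "nat \<Rightarrow> nat \<Rightarrow> lpoly" where
  "candidates n B = concat (map (\<lambda>e. map (\<lambda>c. (e, c)) kcodes) (tuples n [0..<B]))"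

text \<open>Lists of exactly \<open>k\<close> terms cover all shorter sums, since zero coefficients
  and repeated exponents are permitted.\<close>

definition no_check :: "nat \<Rightarrow> nat \<Rightarrow> lpoly list \<Rightarrow> nat \<Rightarrow> nat \<Rightarrow> lblock list \<Rightarrow> bool" where
  "no_check n k gs D M bs \<longleftrightarrow>
    (\<forall>b\<in>set bs. block_bounds n D M b \<and> block_ids n b \<and> (\<forall>g\<in>set gs. bzero n b g)) \<and>
    (\<forall>f\<in>set (tuples k (candidates n (q ^ state_bound n k D M (length bs)))).
      pzero f \<or> \<not> (\<forall>b\<in>set bs. bzero n b f))"

lemma set_candidates: "set (candidates n B) = {(e, c). length e = n \<and> set e \<subseteq> {..<B} \<and> c \<in> range enc}"
  by (auto simp: candidates_def kcodes_def set_tuples atLeast0LessThan)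

text \<open>The coefficients of a sum of terms depend only on which exponents coincide. Tuples with
  the same pattern of coincidences thus give polynomials that vanish together.\<close>

lemma lookup_poly_of_tuples:
  fixes k :: nat
  assumes "\<And>i. i < k \<Longrightarrow> (r i = r i0) = (i \<in> A)"
  shows "Poly_Mapping.lookup (\<Sum>i<k. Poly_Mapping.single (r i) (c i)) (r i0) = (\<Sum>i\<in>{..<k} \<inter> A. c i)"
proof -
  have "Poly_Mapping.lookup (\<Sum>i<k. Poly_Mapping.single (r i) (c i)) (r i0) =
      (\<Sum>i<k. if i \<in> A then c i else 0)"
    using assms by (simp add: lookup_sum lookup_single when_def)
  also have "\<dots> = (\<Sum>i\<in>{..<k} \<inter> A. c i)"
    by (rule sum.inter_restrict[symmetric]) simp
  finally show ?thesis .
qed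

text \<open>The automata of all blocks run in parallel with the relation \<open>R\<close>, which
  records the coincidences among the \<open>k\<close> exponent vectors. Pumping with the
  coefficients kept fixed preserves vanishing under every block, and \<open>R\<close> prevents the
  terms from cancelling.\<close>

lemma small_counterexample:
  assumes blocks: "\<forall>b\<in>set bs. block_bounds n D M b \<and> block_ids n b"
    and f: "f \<in> polys_in {..<n}" "f \<noteq> 0" "card (Poly_Mapping.keys f) \<le> k"
    and ev: "\<forall>b\<in>set bs. ev n (bm b) (bX b) (bv b) f = (\<lambda>_. 0)"
  shows "\<exists>g\<in>set (tuples k (candidates n (q ^ state_bound n k D M (length bs)))).
    pol g \<noteq> 0 \<and> (\<forall>b\<in>set bs. ev n (bm b) (bX b) (bv b) (pol g) = (\<lambda>_. 0))"
proof -
  define C where "C = (card (UNIV :: 'k set) ^ ((D * (n + 1) + 1) ^ n)) ^ (k * M)"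
  define N where "N = state_bound n k D M (length bs)"
  define val where "val b c a = (\<lambda>t. \<Sum>i<k. emb (pconst (c i)) * xact n (bm b) (bX b) (a i) (bv b) t)"
    for b and c :: "nat \<Rightarrow> 'k" and a
  define goodT where "goodT b V T \<longleftrightarrow> finite V \<and> card V \<le> C \<and> (\<forall>a. T a \<subseteq> V) \<and>
      (\<forall>a b w. T a = T b \<longrightarrow> (\<forall>i j. w i j < q) \<longrightarrow>
        T (\<lambda>i j. q * a i j + w i j) = T (\<lambda>i j. q * b i j + w i j)) \<and>
      (\<forall>a a' c. T a = T a' \<longrightarrow> val b c a = (\<lambda>_. 0) \<longrightarrow> val b c a' = (\<lambda>_. 0))"
    for b and V :: "(nat \<Rightarrow> nat \<Rightarrow> 'k mpoly) set" and T
  have "\<exists>V T. goodT b V T" if "b \<in> set bs" for b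
    unfolding goodT_def val_def C_def using blocks that by (intro block_facts(3)) auto
  then obtain V T where VT: "\<And>b. b \<in> set bs \<Longrightarrow> goodT b (V b) (T b)"
    by metis
  define R where "R a = {(i, j). i < k \<and> j < k \<and> (\<forall>l<n. a i l = a j l)}" for a :: "nat \<Rightarrow> nat \<Rightarrow> nat"
  define st where "st a = (restrict (\<lambda>b. T b a) (set bs), R a)" for a
  define S where "S = (\<Pi>\<^sub>E b\<in>set bs. Pow (V b)) \<times> Pow ({..<k} \<times> {..<k})"
  have fin: "finite (\<Pi>\<^sub>E b\<in>set bs. Pow (V b))"
    using VT by (intro finite_PiE) (auto simp: goodT_def)
  have "card (\<Pi>\<^sub>E b\<in>set bs. Pow (V b)) = (\<Prod>b\<in>set bs. 2 ^ card (V b))"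
    using VT by (subst card_PiE) (auto simp: goodT_def card_Pow intro!: prod.cong)
  also have "\<dots> \<le> (\<Prod>b\<in>set bs. 2 ^ C)"
    using VT by (intro prod_mono) (auto simp: goodT_def intro: power_increasing)
  also have "\<dots> \<le> (2 ^ C) ^ length bs"
    using card_length[of bs] by (simp del: power_Suc add: power_increasing)
  finally have "card S \<le> N"
    by (simp add: S_def N_def state_bound_def C_def card_cartesian_product card_Pow)
  moreover have "finite S"
    using fin by (simp add: S_def)
  moreover have "st a \<in> S" for a
    using VT by (auto simp: st_def S_def goodT_def R_def)
  moreover have "st (\<lambda>i j. q * a i j + w i j) = st (\<lambda>i j. q * b i j + w i j)"
    if ab: "st a = st b" and w: "\<And>i j. w i j < q" for a b w
  proof -
    have T: "T x a = T x b" if "x \<in> set bs" for x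
      using fun_cong[OF arg_cong[OF ab, of fst], of x] that by (simp add: st_def)
    have "T x (\<lambda>i j. q * a i j + w i j) = T x (\<lambda>i j. q * b i j + w i j)" if "x \<in> set bs" for x
      using VT[OF that] T[OF that] w unfolding goodT_def by blast
    moreover have digit: "q * x + y = q * x' + y' \<longleftrightarrow> x = x' \<and> y = y'" if "y < q" "y' < q" for x x' y y'
      using that by (metis add.commute div_mult_self3 mod_mult_self2 mod_less div_less add_0 mult.commute
        div_mult_self1 less_nat_zero_code)
    have "R (\<lambda>i j. q * a i j + w i j) = {(i, j) \<in> R a. \<forall>l<n. w i l = w j l}" for a
      unfolding R_def using digit[OF w w] by auto
    moreover have "R a = R b" using ab by (simp add: st_def)
    ultimately show ?thesis
      by (simp add: st_def) (intro restrict_ext, simp)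
  qed
  ultimately have pump: "\<exists>b. st b = st a \<and> (\<forall>i<k. \<forall>j<n. b i j < q ^ N)" for a
    using pump[where q = q and S = S and N = N and st = st and k = k and n = n and a = a] q by blast
  obtain p where p: "plen n p" "pol p = f" "length p = card (Poly_Mapping.keys f)"
    using terms_of_poly[OF f(1)] by blast
  define r where "r a i = Poly_Mapping.nth (map (a i) [0..<n])" for a :: "nat \<Rightarrow> nat \<Rightarrow> nat" and i
  have r_eq: "r a i = r a j \<longleftrightarrow> (i, j) \<in> R a" if "i < k" "j < k" for a i j
    using that by (auto simp: r_def R_def inj_nth_length)
  have ev_val: "ev n (bm b) (bX b) (bv b) (\<Sum>i<k. Poly_Mapping.single (r a i) (c i)) = val b c a" for b c a
  proof
    fix t
    have "xact n (bm b) (bX b) (Poly_Mapping.lookup (r a i)) (bv b) = xact n (bm b) (bX b) (a i) (bv b)" for i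
      by (rule xact_cong) (simp add: r_def nth_default_def)
    then show "ev n (bm b) (bX b) (bv b) (\<Sum>i<k. Poly_Mapping.single (r a i) (c i)) t = val b c a t"
      by (simp add: val_def ev_sum ev_single)
  qed
  \<comment> \<open>The terms of \<open>f\<close> are padded to \<open>k\<close> terms, with
    exponents and coefficients zero.\<close>
  define a where "a i j = (if i < length p then nth_default 0 (fst (p ! i)) j else 0)" for i j
  define c where "c i = (if i < length p then dec (snd (p ! i)) else 0)" for i
  have f_eq: "(\<Sum>i<k. Poly_Mapping.single (r a i) (c i)) = f"
  proof -
    have "(\<Sum>i<k. Poly_Mapping.single (r a i) (c i)) = (\<Sum>i<length p. Poly_Mapping.single (r a i) (c i))"
      using f(3) p(3) by (intro sum.mono_neutral_right) (auto simp: c_def)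
    also have "\<dots> = (\<Sum>i<length p. Poly_Mapping.single (Poly_Mapping.nth (fst (p ! i))) (dec (snd (p ! i))))"
    proof (intro sum.cong refl)
      fix i assume i: "i \<in> {..<length p}"
      then have "length (fst (p ! i)) = n" using p(1) by (simp add: plen_def)
      then have "map (a i) [0..<n] = fst (p ! i)"
        using i by (intro nth_equalityI) (auto simp: a_def nth_default_def)
      with i show "Poly_Mapping.single (r a i) (c i) = Poly_Mapping.single (Poly_Mapping.nth (fst (p ! i))) (dec (snd (p ! i)))"
        by (simp add: r_def c_def)
    qed
    also have "\<dots> = pol p"
      by (simp add: pol_def sum_list_sum_nth atLeast0LessThan)
    finally show ?thesis using p(2) by simp
  qed
  obtain b where b: "st b = st a" "\<forall>i<k. \<forall>j<n. b i j < q ^ N"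
    using pump by blast
  define g where "g = map (\<lambda>i. (map (b i) [0..<n], enc (c i))) [0..<k]"
  have "g \<in> set (tuples k (candidates n (q ^ N)))"
    using b(2) by (auto simp: g_def set_tuples set_candidates)
  moreover have g_eq: "pol g = (\<Sum>i<k. Poly_Mapping.single (r b i) (c i))"
    by (simp add: pol_def g_def r_def o_def interv_sum_list_conv_sum_set_nat atLeast0LessThan)
  have RR: "R a = R b" using b(1) by (simp add: st_def)
  have "pol g \<noteq> 0"
  proof
    assume 0: "pol g = 0"
    \<comment> \<open>By \<open>R a = R b\<close> the coefficient of \<open>f\<close> at the i-th
      old exponent equals that of \<open>pol g\<close> at the i-th new one. No other exponents occur
      in \<open>f\<close>.\<close>
    have "Poly_Mapping.lookup f e = 0" if e: "e \<in> r a ` {..<k}" for e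
    proof -
      obtain i where i: "i < k" "e = r a i" using e by auto
      have "Poly_Mapping.lookup f (r a i) = (\<Sum>j\<in>{..<k} \<inter> {j. (j, i) \<in> R a}. c j)"
        unfolding f_eq[symmetric] using r_eq i(1) by (intro lookup_poly_of_tuples) auto
      also have "\<dots> = Poly_Mapping.lookup (pol g) (r b i)"
        unfolding g_eq RR using r_eq i(1) by (intro lookup_poly_of_tuples[symmetric]) auto
      finally show ?thesis by (simp add: 0 i)
    qed
    moreover have "Poly_Mapping.lookup f e = 0" if "e \<notin> r a ` {..<k}" for e
      unfolding f_eq[symmetric] using that by (auto simp: lookup_sum lookup_single when_def intro!: sum.neutral)
    ultimately have "Poly_Mapping.lookup f e = 0" for e
      by blast
    then have "f = 0"
      by (intro poly_mapping_eqI) simp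
    with f(2) show False by simp
  qed
  moreover have "ev n (bm x) (bX x) (bv x) (pol g) = (\<lambda>_. 0)" if x: "x \<in> set bs" for x
  proof -
    have "T x a = T x b"
      using fun_cong[OF arg_cong[OF b(1), of fst], of x] x by (simp add: st_def)
    moreover have "val x c a = (\<lambda>_. 0)"
      using ev x by (simp add: f_eq flip: ev_val)
    ultimately have "val x c b = (\<lambda>_. 0)"
      using VT[OF x] unfolding goodT_def by blast
    then show ?thesis by (simp add: g_eq ev_val)
  qed
  ultimately show ?thesis
    unfolding N_def by blast
qed

end

section \<open>Generated ideals and the shortest length\<close>

lemma mpoly_ring_simps:
  "f \<otimes>\<^bsub>mpoly_ring n\<^esub> g = f * g" "f \<oplus>\<^bsub>mpoly_ring n\<^esub> g = f + g" "\<zero>\<^bsub>mpoly_ring n\<^esub> = 0"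
  by (simp_all add: mpoly_ring_def)

lemma is_ideal_iff: "is_ideal n (I :: 'k::comm_ring_1 mpoly set) \<longleftrightarrow> ideal I (mpoly_ring n)"
proof
  interpret R: cring "mpoly_ring n :: 'k mpoly ring" by (rule cring_mpoly_ring)
  assume I: "is_ideal n I"
  show "ideal I (mpoly_ring n)"
  proof (rule idealI)
    show "ring (mpoly_ring n :: 'k mpoly ring)" by (rule R.ring_axioms)
    show "subgroup I (add_monoid (mpoly_ring n))"
    proof (rule group.subgroupI[OF R.a_group])
      show "I \<subseteq> carrier (add_monoid (mpoly_ring n))"
        using is_idealD(1)[OF I] by (auto simp: carrier_mpoly_ring)
      show "I \<noteq> {}" using is_idealD(2)[OF I] by auto
      fix a b assume a: "a \<in> I" and b: "b \<in> I"
      have "- a \<in> carrier (mpoly_ring n)"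
        using is_idealD(1)[OF I is_ideal_uminus[OF I a]] by (simp add: carrier_mpoly_ring)
      then have "\<ominus>\<^bsub>mpoly_ring n\<^esub> a = - a"
        using is_idealD(1)[OF I a] by (intro R.minus_equality) (auto simp: carrier_mpoly_ring mpoly_ring_simps)
      then show "inv\<^bsub>add_monoid (mpoly_ring n)\<^esub> a \<in> I"
        using is_ideal_uminus[OF I a] by (simp add: a_inv_def)
      show "a \<otimes>\<^bsub>add_monoid (mpoly_ring n)\<^esub> b \<in> I"
        using is_idealD(3)[OF I a b] by (simp add: mpoly_ring_simps)
    qed
    fix a x :: "'k mpoly"
    assume "a \<in> I" "x \<in> carrier (mpoly_ring n)"
    then show "x \<otimes>\<^bsub>mpoly_ring n\<^esub> a \<in> I" "a \<otimes>\<^bsub>mpoly_ring n\<^esub> x \<in> I"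
      using is_idealD(4)[OF I, of x a] by (simp_all add: carrier_mpoly_ring mpoly_ring_simps mult.commute)
  qed
next
  assume I: "ideal I (mpoly_ring n)"
  note sub = ideal.axioms(1)[OF I]
  show "is_ideal n I"
    unfolding is_ideal_def
    using additive_subgroup.a_subset[OF sub] additive_subgroup.zero_closed[OF sub]
      additive_subgroup.a_closed[OF sub] ideal.I_l_closed[OF I]
    by (simp add: carrier_mpoly_ring mpoly_ring_simps)
qed

lemma genideal_facts:
  fixes G :: "'k::comm_ring_1 mpoly set"
  assumes "G \<subseteq> polys_in {..<n}"
  shows "is_ideal n (genideal (mpoly_ring n) G)" "G \<subseteq> genideal (mpoly_ring n) G"
    "is_ideal n J \<Longrightarrow> G \<subseteq> J \<Longrightarrow> genideal (mpoly_ring n) G \<subseteq> J"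
proof -
  interpret R: cring "mpoly_ring n :: 'k mpoly ring" by (rule cring_mpoly_ring)
  have G: "G \<subseteq> carrier (mpoly_ring n)"
    using assms by (simp add: carrier_mpoly_ring)
  show "is_ideal n (genideal (mpoly_ring n) G)" "G \<subseteq> genideal (mpoly_ring n) G"
    "is_ideal n J \<Longrightarrow> G \<subseteq> J \<Longrightarrow> genideal (mpoly_ring n) G \<subseteq> J"
    unfolding is_ideal_iff
    by (rule R.genideal_ideal[OF G] R.genideal_self[OF G] R.genideal_minimal; assumption)+
qed

lemma shortest_length_le_iff:
  "shortest_length I \<le> enat k \<longleftrightarrow> (\<exists>f\<in>I. f \<noteq> 0 \<and> card (Poly_Mapping.keys f) \<le> k)"
proof
  assume le: "shortest_length I \<le> enat k"
  have "I - {0} \<noteq> {}"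
  proof
    assume "I - {0} = {}"
    with le show False by (simp add: shortest_length_def top_enat_def)
  qed
  then obtain f where "f \<in> I" "f \<noteq> 0" by blast
  from shortest_length_attained[OF this] le show "\<exists>f\<in>I. f \<noteq> 0 \<and> card (Poly_Mapping.keys f) \<le> k"
    by auto
next
  assume "\<exists>f\<in>I. f \<noteq> 0 \<and> card (Poly_Mapping.keys f) \<le> k"
  then obtain f where f: "f \<in> I - {0}" "card (Poly_Mapping.keys f) \<le> k" by blast
  have "shortest_length I \<le> enat (card (Poly_Mapping.keys f))"
    unfolding shortest_length_def using f(1) by (rule INF_lower)
  with f(2) show "shortest_length I \<le> enat k"
    by (meson enat_ord_simps(1) order_trans)
qed

lemma common_denominator_in:
  assumes "finite A" "\<And>i. i \<in> A \<Longrightarrow> z i \<in> ratfuns_in S"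
  shows "\<exists>h p. h \<in> polys_in S \<and> h \<noteq> 0 \<and> (\<forall>i\<in>A. p i \<in> polys_in S \<and> z i = emb (p i) / emb h)"
  using assms
proof induction
  case (insert i A)
  then obtain h p where hp: "h \<in> polys_in S" "h \<noteq> 0" "\<forall>i\<in>A. p i \<in> polys_in S \<and> z i = emb (p i) / emb h"
    by blast
  obtain a b where ab: "z i = emb a / emb b" "a \<in> polys_in S" "b \<in> polys_in S" "b \<noteq> 0"
    using insert.prems[of i] by (auto simp: ratfuns_in_def Fract_conv_emb)
  show ?case
    using hp ab insert(2)
    by (intro exI[of _ "h * b"] exI[of _ "\<lambda>j. if j = i then a * h else p j * b"])
      (auto intro: polys_in_mult)
qed (auto intro: exI[of _ 1])

context coded_field
begin

text \<open>The cofactors \<open>hs\<close> carry the sign, so that membership in the ideal becomes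
  one zero test of a sum. The number of listed terms bounds the support of the polynomial from
  above.\<close>

definition yes_check :: "nat \<Rightarrow> nat \<Rightarrow> lpoly list \<Rightarrow> lpoly list \<Rightarrow> lpoly \<Rightarrow> bool" where
  "yes_check n k gs hs f \<longleftrightarrow> length f \<le> k \<and> plen n f \<and> (\<forall>h\<in>set hs. plen n h) \<and> \<not> pzero f \<and>
    pzero (pv f @ concat (map (\<lambda>i. vmul n (nth_default [] hs i) (pv (nth_default [] gs i))) [0..<length gs]))"

lemma plen_nth_default: "\<forall>h\<in>set hs. plen n h \<Longrightarrow> plen n (nth_default [] hs i)"
  by (cases "i < length hs") (simp_all add: nth_default_nth nth_default_beyond, simp add: plen_def)

lemma pzero_combination:
  assumes "plen n f" "\<forall>h\<in>set hs. plen n h" "\<forall>g\<in>set gs. plen n g"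
  shows "pzero (pv f @ concat (map (\<lambda>i. vmul n (nth_default [] hs i) (pv (nth_default [] gs i))) [0..<length gs])) \<longleftrightarrow>
    pol f + (\<Sum>i<length gs. pol (nth_default [] hs i) * pol (nth_default [] gs i)) = 0"
proof -
  have pv: "vlen n 1 (pv p)" if "plen n p" for p
    using that by (auto simp: vlen_def pv_def plen_def)
  have conc: "vec (concat (map F [0..<l])) s = (\<Sum>i<l. vec (F i) s)" for F l s
    by (induction l) auto
  let ?c = "concat (map (\<lambda>i. vmul n (nth_default [] hs i) (pv (nth_default [] gs i))) [0..<length gs])"
  have "vlen n 1 (vmul n (nth_default [] hs i) (pv (nth_default [] gs i)))" for i
    by (intro vlen_vmul pv plen_nth_default assms)
  then have "vlen n 1 (pv f @ ?c)"
    using pv[OF assms(1)] by (auto simp: vlen_def)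
  moreover have "vec (pv f @ ?c) s = (if s = 0 then pol f + (\<Sum>i<length gs. pol (nth_default [] hs i) * pol (nth_default [] gs i)) else 0)" for s
  proof -
    have "vec (vmul n (nth_default [] hs i) (pv (nth_default [] gs i))) s =
        pol (nth_default [] hs i) * (if s = 0 then pol (nth_default [] gs i) else 0)" for i
      by (subst vec_vmul[OF plen_nth_default[OF assms(2)] pv[OF plen_nth_default[OF assms(3)]]]) (simp add: vec_pv)
    then show ?thesis by (simp add: conc vec_pv)
  qed
  ultimately show ?thesis
    by (subst pzero_vec) (auto simp: fun_eq_iff)
qed

context
  fixes n :: nat and gs :: "lpoly list"
  assumes gs: "\<forall>g\<in>set gs. plen n g"
begin

abbreviation gen :: "'k mpoly set" where
  "gen \<equiv> genideal (mpoly_ring n) (pol ` set gs)"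

lemma gens_in: "pol ` set gs \<subseteq> polys_in {..<n}"
  using gs pol_polys_in by blast

lemmas gen_ideal = genideal_facts(1)[OF gens_in]
lemmas gen_self = genideal_facts(2)[OF gens_in]
lemmas gen_minimal = genideal_facts(3)[OF gens_in]

lemma pol_gs: "i < length gs \<Longrightarrow> pol (nth_default [] gs i) \<in> gen"
  using gen_self by (simp add: nth_default_nth image_subset_iff)

lemma yes_check_sound:
  assumes "yes_check n k gs hs f"
  shows "\<exists>f\<in>gen. f \<noteq> 0 \<and> card (Poly_Mapping.keys f) \<le> k"
proof -
  have f: "length f \<le> k" "plen n f" "\<forall>h\<in>set hs. plen n h" "pol f \<noteq> 0"
    and eq: "pol f + (\<Sum>i<length gs. pol (nth_default [] hs i) * pol (nth_default [] gs i)) = 0"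
    using assms pzero_combination[OF _ _ gs] pzero_pol by (auto simp: yes_check_def)
  have sum: "(\<Sum>i<length gs. pol (nth_default [] hs i) * pol (nth_default [] gs i)) \<in> gen"
    using pol_gs by (intro is_ideal_sum[OF gen_ideal] is_idealD(4)[OF gen_ideal] pol_polys_in plen_nth_default f) auto
  have "pol f = - (\<Sum>i<length gs. pol (nth_default [] hs i) * pol (nth_default [] gs i))"
    using eq by (simp add: eq_neg_iff_add_eq_0)
  then have "pol f \<in> gen"
    using is_ideal_uminus[OF gen_ideal sum] by simp
  moreover have "card (Poly_Mapping.keys (pol f)) \<le> card (Poly_Mapping.nth ` fst ` set f)"
    by (rule card_mono) (auto intro: keys_pol[THEN subsetD])
  moreover have "card (Poly_Mapping.nth ` fst ` set f) \<le> length f"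
    using card_image_le[of "set f" "Poly_Mapping.nth \<circ> fst"] card_length[of f] by (simp add: image_comp)
  ultimately show ?thesis
    using f by (intro bexI[of _ "pol f"]) auto
qed

text \<open>The combinations of the generators form an ideal that contains them, and
  \<open>gen\<close> is the least such ideal.\<close>

lemma gen_combination:
  assumes "f \<in> gen"
  shows "\<exists>h. (\<forall>i. h i \<in> polys_in {..<n}) \<and> f = (\<Sum>i<length gs. h i * pol (nth_default [] gs i))"
proof -
  let ?g = "\<lambda>i. pol (nth_default [] gs i)"
  define J where "J = {f. \<exists>h. (\<forall>i. h i \<in> polys_in {..<n}) \<and> f = (\<Sum>i<length gs. h i * ?g i)}"
  have JI: "(\<Sum>i<length gs. h i * ?g i) \<in> J" if "\<And>i. h i \<in> polys_in {..<n}" for h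
    using that by (auto simp: J_def)
  have "is_ideal n J"
    unfolding is_ideal_def
  proof (intro conjI ballI subsetI)
    show "f \<in> polys_in {..<n}" if "f \<in> J" for f
      using that by (auto simp: J_def intro!: polys_in_sum polys_in_mult pol_polys_in plen_nth_default gs)
    show "0 \<in> J" using JI[of "\<lambda>_. 0"] by simp
    show "f + f' \<in> J" if ff: "f \<in> J" "f' \<in> J" for f f'
    proof -
      obtain h h' where "\<forall>i. h i \<in> polys_in {..<n}" "f = (\<Sum>i<length gs. h i * ?g i)"
        "\<forall>i. h' i \<in> polys_in {..<n}" "f' = (\<Sum>i<length gs. h' i * ?g i)"
        using ff by (auto simp: J_def)
      then show ?thesis
        using JI[of "\<lambda>i. h i + h' i"] by (simp add: polys_in_add distrib_right sum.distrib)
    qed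
    show "x * f \<in> J" if x: "x \<in> polys_in {..<n}" and f: "f \<in> J" for x f
    proof -
      obtain h where "\<forall>i. h i \<in> polys_in {..<n}" "f = (\<Sum>i<length gs. h i * ?g i)"
        using f by (auto simp: J_def)
      then show ?thesis
        using JI[of "\<lambda>i. x * h i"] x by (simp add: polys_in_mult sum_distrib_left mult.assoc)
    qed
  qed
  moreover have "pol ` set gs \<subseteq> J"
  proof clarify
    fix g assume "g \<in> set gs"
    then obtain i where i: "i < length gs" "g = gs ! i" by (auto simp: in_set_conv_nth)
    have "(\<Sum>l<length gs. (if l = i then 1 else 0) * ?g l) = (\<Sum>l<length gs. if l = i then ?g i else 0)"
      by (intro sum.cong) auto
    with i have "(\<Sum>l<length gs. (if l = i then 1 else 0) * ?g l) = pol g"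
      by (simp add: nth_default_nth)
    then show "pol g \<in> J"
      using JI[of "\<lambda>l. if l = i then 1 else 0"] by simp
  qed
  ultimately show ?thesis
    using gen_minimal[of J] assms unfolding J_def by blast
qed

lemma yes_check_complete:
  assumes "f \<in> gen" "f \<noteq> 0" "card (Poly_Mapping.keys f) \<le> k"
  shows "\<exists>hs f. yes_check n k gs hs f"
proof -
  obtain h where h: "\<forall>i. h i \<in> polys_in {..<n}" "f = (\<Sum>i<length gs. h i * pol (nth_default [] gs i))"
    using gen_combination[OF assms(1)] by blast
  obtain p where p: "plen n p" "pol p = f" "length p = card (Poly_Mapping.keys f)"
    using terms_of_poly is_idealD(1)[OF gen_ideal assms(1)] by blast
  have "\<forall>i. \<exists>l. plen n l \<and> pol l = - h i"
    using terms_of_poly polys_in_uminus h(1) by blast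
  then obtain l where l: "\<And>i. plen n (l i)" "\<And>i. pol (l i) = - h i"
    by metis
  let ?hs = "map l [0..<length gs]"
  have "(\<Sum>i<length gs. pol (nth_default [] ?hs i) * pol (nth_default [] gs i)) = - f"
    unfolding h(2) by (simp add: nth_default_def l sum_negf)
  then have "yes_check n k gs ?hs p"
    using p assms l pzero_combination[OF p(1) _ gs, of ?hs] pzero_pol[OF p(1)] by (auto simp: yes_check_def)
  then show ?thesis by blast
qed

text \<open>The common kernel \<open>J\<close> of the blocks is an ideal that contains the
  generators, hence \<open>gen\<close>. It may be larger, yet a short element of \<open>gen\<close>
  would lie in \<open>J\<close> and yield a short element of \<open>J\<close> below the pumping
  bound, which the check has excluded.\<close>

lemma no_check_sound:
  assumes check: "no_check n k gs D M bs" and f: "f \<in> gen" "f \<noteq> 0"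
  shows "card (Poly_Mapping.keys f) > k"
proof (rule ccontr)
  assume "\<not> card (Poly_Mapping.keys f) > k"
  then have k: "card (Poly_Mapping.keys f) \<le> k" by simp
  have blocks: "\<forall>b\<in>set bs. block_bounds n D M b \<and> block_ids n b"
    and gens: "\<forall>b\<in>set bs. \<forall>g\<in>set gs. bzero n b g"
    and small: "\<forall>f\<in>set (tuples k (candidates n (q ^ state_bound n k D M (length bs)))).
      pzero f \<or> \<not> (\<forall>b\<in>set bs. bzero n b f)"
    using check by (auto simp: no_check_def)
  define J where "J = {f \<in> polys_in {..<n}. \<forall>b\<in>set bs. ev n (bm b) (bX b) (bv b) f = (\<lambda>_. 0)}"
  have "is_ideal n J"
    unfolding is_ideal_def J_def
    using ev_mult_eq_0[OF block_facts(1) q frob] blocks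
    by (auto simp: ev_0 ev_add fun_eq_iff[of "ev _ _ _ _ (_ + _)"] fun_eq_iff[of "ev _ _ _ _ 0"]
      intro!: polys_in_add polys_in_mult)
  moreover have "pol ` set gs \<subseteq> J"
    using block_facts(2) blocks gens gs pol_polys_in unfolding J_def by fast
  ultimately have "f \<in> J"
    using gen_minimal f(1) by blast
  then obtain g where g: "g \<in> set (tuples k (candidates n (q ^ state_bound n k D M (length bs))))"
    "pol g \<noteq> 0" "\<forall>b\<in>set bs. ev n (bm b) (bX b) (bv b) (pol g) = (\<lambda>_. 0)"
    using small_counterexample[OF blocks _ f(2) k] unfolding J_def by blast
  have "plen n g"
    using g(1) by (auto simp: set_tuples set_candidates plen_def)
  with small g blocks show False
    using block_facts(2) pzero_pol by metis
qed

end

lemma list_block: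
  fixes b :: "nat \<times> (nat \<Rightarrow> nat \<Rightarrow> nat \<Rightarrow> 'k ratfun) \<times> (nat \<Rightarrow> nat \<Rightarrow> 'k ratfun) \<times> (nat \<Rightarrow> 'k ratfun)"
  assumes "frob_block n q (m, X, U, v)"
  shows "\<exists>l. (\<forall>\<^sub>F D in sequentially. block_bounds n D D l) \<and> block_ids n l \<and>
    (\<forall>f. ev n (bm l) (bX l) (bv l) f = ev n m X v f)"
proof -
  have fm: "frob_module n q m X U v" and
    X: "\<And>j s t. j < n \<Longrightarrow> s < m \<Longrightarrow> X j s t \<in> ratfuns_in {..<n} \<and> (t \<ge> m \<longrightarrow> X j s t = 0)" and
    U: "\<And>s t. s < m \<Longrightarrow> U s t \<in> ratfuns_in {..<n} \<and> (t \<ge> m \<longrightarrow> U s t = 0)" and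
    v: "\<And>t. v t \<in> ratfuns_in {..<n} \<and> (t \<ge> m \<longrightarrow> v t = 0)"
    using assms by (auto simp: frob_block_def)
  \<comment> \<open>The tags 0, 1 and 2 gather the entries of \<open>X\<close>, \<open>U\<close> and
    \<open>v\<close> into one finite family, so that a single denominator serves all three.\<close>
  define z where "z i = (case i of (0, j, s, t) \<Rightarrow> X j s t | (Suc 0, j, s, t) \<Rightarrow> U s t | (_, j, s, t) \<Rightarrow> v t)"
    for i :: "nat \<times> nat \<times> nat \<times> nat"
  let ?A = "{0} \<times> {..<n} \<times> {..<m} \<times> {..<m} \<union> {1} \<times> {0} \<times> {..<m} \<times> {..<m} \<union> {2} \<times> {0} \<times> {0} \<times> {..<m}"
  have "\<exists>h p. h \<in> polys_in {..<n} \<and> h \<noteq> 0 \<and> (\<forall>i\<in>?A. p i \<in> polys_in {..<n} \<and> z i = emb (p i) / emb h)"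
    using X U v by (intro common_denominator_in) (auto simp: z_def numeral_2_eq_2)
  then obtain h p where hp: "h \<in> polys_in {..<n} \<and> h \<noteq> 0 \<and> (\<forall>i\<in>?A. p i \<in> polys_in {..<n} \<and> z i = emb (p i) / emb h)"
    by (elim exE) (rule that)
  then have h: "h \<in> polys_in {..<n}" "h \<noteq> 0"
    by blast+
  from hp have p: "p i \<in> polys_in {..<n} \<and> z i = emb (p i) / emb h" if "i \<in> ?A" for i
    using that by (elim conjE) (rule bspec)
  \<comment> \<open>The numerators are controlled only at indices below \<open>m\<close>; beyond,
    the decoded vectors are zero.\<close>
  define cut where "cut r t = (if t < m then r t else 0)" for r :: "nat \<Rightarrow> 'k mpoly" and t
  have vecs: "\<exists>w. vlen n m w \<and> vec w = cut r" if "\<And>t. t < m \<Longrightarrow> r t \<in> polys_in {..<n}" for r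
    using that by (intro terms_of_vec) (auto simp: cut_def)
  obtain lh where lh: "plen n lh" "pol lh = h"
    using terms_of_poly[OF h(1)] by blast
  obtain lv where lv: "vlen n m lv" "vec lv = cut (\<lambda>t. p (2, 0, 0, t))"
    using vecs[of "\<lambda>t. p (2, 0, 0, t)"] p by auto
  have "\<exists>w. vlen n m w \<and> (s < m \<longrightarrow> vec w = cut (\<lambda>t. p (1, 0, s, t)))" for s
    using vecs[of "\<lambda>t. p (1, 0, s, t)"] p vecs[of "\<lambda>_. 0"] by (cases "s < m") auto
  then obtain wU where wU: "\<And>s. vlen n m (wU s)" "\<And>s. s < m \<Longrightarrow> vec (wU s) = cut (\<lambda>t. p (1, 0, s, t))"
    by metis
  have "\<exists>w. vlen n m w \<and> (j < n \<longrightarrow> s < m \<longrightarrow> vec w = cut (\<lambda>t. p (0, j, s, t)))" for j s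
    using vecs[of "\<lambda>t. p (0, j, s, t)"] p vecs[of "\<lambda>_. 0"] by (cases "j < n \<and> s < m") auto
  then obtain wX where wX: "\<And>j s. vlen n m (wX j s)"
    "\<And>j s. j < n \<Longrightarrow> s < m \<Longrightarrow> vec (wX j s) = cut (\<lambda>t. p (0, j, s, t))"
    by metis
  define lU where "lU = map wU [0..<m]"
  define lX where "lX = map (\<lambda>j. map (wX j) [0..<m]) [0..<n]"
  define l where "l = (lh, lv, lU, lX)"
  have len: "length lU = m" by (simp add: lU_def)
  have bU: "bU l s = U s" if "s < m" for s
    using that p[of "(1, 0, s, _)"] U[OF that]
    by (auto simp: bU_def l_def mat_def lU_def nth_default_def wU(2) cut_def lh z_def fun_eq_iff)
  have bX: "bX l j s = X j s" if "j < n" "s < m" for j s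
    using that p[of "(0, j, s, _)"] X[OF that]
    by (auto simp: bX_def l_def mat_def lX_def nth_default_def wX(2) cut_def lh z_def fun_eq_iff)
  have bv: "bv l = v"
    using p[of "(2, 0, 0, _)"] v
    by (auto simp: bv_def l_def lv cut_def lh z_def fun_eq_iff numeral_2_eq_2)
  have bm: "bm l = m" by (simp add: bm_def l_def len)
  have mlen: "mlen n (length lU) lU" "\<forall>Y\<in>set lX. mlen n (length lU) Y"
    using wU(1) wX(1) by (auto simp: len mlen_def lU_def lX_def)
  have "frob_module n q m (bX l) (bU l) (bv l)"
    using fm frob_module_cong[of n m "bX l" X "bU l" U q v] bX bU by (simp add: bv)
  then have "block_ids n l"
    using block_ids_iff[OF lh(1) _ mlen, of lv] lv(1) lh h(2) by (simp add: len flip: l_def)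
  moreover have "ev n (bm l) (bX l) (bv l) f = ev n m X v f" for f
    unfolding bm bv using bX by (intro ev_mat_cong)
  moreover have "\<forall>\<^sub>F D in sequentially. block_bounds n D D l"
    unfolding block_bounds_def l_def prod.case len
    using lh(1) lv(1) mlen unfolding mlen_def len
    by (intro eventually_conj eventually_pbound eventually_vbound eventually_ball_finite eventually_ge_at_top ballI) auto
  ultimately show ?thesis by blast
qed

text \<open>The blocks supplied by \<open>ideal_frob_blocks\<close> cut out exactly the given ideal.
  If this has no short element, the test of small polynomials succeeds however large the pumping
  bound is.\<close>

lemma no_check_complete:
  assumes gs: "\<forall>g\<in>set gs. plen n g"
    and short: "\<And>f. f \<in> genideal (mpoly_ring n) (pol ` set gs) \<Longrightarrow> f \<noteq> 0 \<Longrightarrow> card (Poly_Mapping.keys f) > k"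
  shows "\<exists>D M bs. no_check n k gs D M bs"
proof -
  let ?I = "genideal (mpoly_ring n) (pol ` set gs)"
  have q0: "q > 0" using q by simp
  obtain as where as: "\<forall>a\<in>set as. frob_block n q a"
    "\<forall>f\<in>polys_in {..<n}. f \<in> ?I \<longleftrightarrow> (\<forall>(m, X, U, v)\<in>set as. ev n m X v f = (\<lambda>_. 0))"
    using ideal_frob_blocks[OF gen_ideal[OF gs] q0 frob] by blast
  define good where "good a l \<longleftrightarrow> (\<forall>\<^sub>F D in sequentially. block_bounds n D D l) \<and> block_ids n l \<and>
      (\<forall>f. ev n (bm l) (bX l) (bv l) f = (case a of (m, X, U, v) \<Rightarrow> ev n m X v f))"
    for a :: "nat \<times> (nat \<Rightarrow> nat \<Rightarrow> nat \<Rightarrow> 'k ratfun) \<times> (nat \<Rightarrow> nat \<Rightarrow> 'k ratfun) \<times> (nat \<Rightarrow> 'k ratfun)" and l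
  have "\<exists>l. good a l" if "a \<in> set as" for a
  proof -
    obtain m X U v where a: "a = (m, X, U, v)" by (metis prod.collapse)
    with as(1) that have "frob_block n q (m, X, U, v)" by blast
    from list_block[OF this] show ?thesis by (simp add: good_def a)
  qed
  then obtain l where l: "\<And>a. a \<in> set as \<Longrightarrow> good a (l a)"
    by metis
  define bs where "bs = map l as"
  have "\<forall>\<^sub>F D in sequentially. \<forall>b\<in>set bs. block_bounds n D D b"
    using l by (intro eventually_ball_finite) (auto simp: bs_def good_def)
  \<comment> \<open>One number serves both as degree bound and as dimension bound.\<close>
  then obtain D where D: "\<forall>b\<in>set bs. block_bounds n D D b"
    by (auto dest!: eventually_happens)
  have ids: "\<forall>b\<in>set bs. block_ids n b"
    using l by (auto simp: bs_def good_def)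
  have ker: "(\<forall>b\<in>set bs. bzero n b f) \<longleftrightarrow> pol f \<in> ?I" if f: "plen n f" for f
  proof -
    have "(\<forall>b\<in>set bs. bzero n b f) \<longleftrightarrow> (\<forall>b\<in>set bs. ev n (bm b) (bX b) (bv b) (pol f) = (\<lambda>_. 0))"
      using block_facts(2)[OF _ _ f] D ids by blast
    also have "\<dots> \<longleftrightarrow> (\<forall>a\<in>set as. (case a of (m, X, U, v) \<Rightarrow> ev n m X v (pol f)) = (\<lambda>_. 0))"
      using l by (simp add: bs_def good_def)
    also have "\<dots> \<longleftrightarrow> pol f \<in> ?I"
      using as(2) pol_polys_in[OF f] by (simp add: case_prod_beta)
    finally show ?thesis .
  qed
  have "no_check n k gs D D bs"
    unfolding no_check_def
  proof (intro conjI ballI)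
    fix b assume b: "b \<in> set bs"
    show "block_bounds n D D b" "block_ids n b" using D ids b by auto
    fix g assume "g \<in> set gs"
    then show "bzero n b g"
      using ker[of g] gs gen_self[OF gs] b by blast
  next
    fix f assume f: "f \<in> set (tuples k (candidates n (q ^ state_bound n k D D (length bs))))"
    have plen: "plen n f"
      using f by (auto simp: set_tuples set_candidates plen_def)
    have "length f = k" using f by (simp add: set_tuples)
    moreover have "card (Poly_Mapping.keys (pol f)) \<le> card (Poly_Mapping.nth ` fst ` set f)"
      by (rule card_mono) (auto intro: keys_pol[THEN subsetD])
    moreover have "card (Poly_Mapping.nth ` fst ` set f) \<le> length f"
      using card_image_le[of "set f" "Poly_Mapping.nth \<circ> fst"] card_length[of f] by (simp add: image_comp)
    ultimately have "pol f = 0 \<or> pol f \<notin> ?I"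
      using short[of "pol f"] by force
    then show "pzero f \<or> \<not> (\<forall>b\<in>set bs. bzero n b f)"
      using ker[OF plen] pzero_pol[OF plen] by blast
  qed
  then show ?thesis by blast
qed

end

section \<open>The decision procedure\<close>

lemma computable_comp2:
  "computable (\<lambda>w. g (fst w) (snd w)) \<Longrightarrow> computable a \<Longrightarrow> computable b \<Longrightarrow> computable (\<lambda>z. g (a z) (b z))"
  using computable_compose[of "\<lambda>w. g (fst w) (snd w)" "\<lambda>z. (a z, b z)"] by (simp add: computable_intros)

lemma computable_comp3:
  "computable (\<lambda>w. g (fst w) (fst (snd w)) (snd (snd w))) \<Longrightarrow> computable a \<Longrightarrow> computable b \<Longrightarrow> computable c \<Longrightarrow>
    computable (\<lambda>z. g (a z) (b z) (c z))"
  using computable_compose[of "\<lambda>w. g (fst w) (fst (snd w)) (snd (snd w))" "\<lambda>z. (a z, b z, c z)"]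
  by (simp add: computable_intros)

lemma decidable_comp2:
  "decidable (\<lambda>w. P (fst w) (snd w)) \<Longrightarrow> computable a \<Longrightarrow> computable b \<Longrightarrow> decidable (\<lambda>z. P (a z) (b z))"
  using decidable_compose[of "\<lambda>w. P (fst w) (snd w)" "\<lambda>z. (a z, b z)"] by (simp add: computable_intros)

lemma decidable_comp3:
  "decidable (\<lambda>w. P (fst w) (fst (snd w)) (snd (snd w))) \<Longrightarrow> computable a \<Longrightarrow> computable b \<Longrightarrow> computable c \<Longrightarrow>
    decidable (\<lambda>z. P (a z) (b z) (c z))"
  using decidable_compose[of "\<lambda>w. P (fst w) (fst (snd w)) (snd (snd w))" "\<lambda>z. (a z, b z, c z)"]
  by (simp add: computable_intros)

section \<open>Computability of the certificate checks\<close>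

lemma computable_eadd [computable_intros]:
  "computable a \<Longrightarrow> computable b \<Longrightarrow> computable c \<Longrightarrow> computable (\<lambda>z. eadd (a z) (b z) (c z))"
  by (rule computable_comp3[of eadd]) (unfold eadd_def, intro computable_intros)

lemma computable_pv [computable_intros]: "computable a \<Longrightarrow> computable (\<lambda>z. pv (a z))"
  unfolding pv_def by (intro computable_intros)

lemma computable_frobv [computable_intros]: "computable a \<Longrightarrow> computable (\<lambda>z. frobv q (a z))"
  unfolding frobv_def by (intro computable_intros)

lemma decidable_plen [computable_intros]:
  "computable a \<Longrightarrow> computable b \<Longrightarrow> decidable (\<lambda>z. plen (a z) (b z))"
  by (rule decidable_comp2[of plen]) (unfold plen_def, intro computable_intros)

lemma decidable_pbound [computable_intros]:
  "computable a \<Longrightarrow> computable b \<Longrightarrow> computable c \<Longrightarrow> decidable (\<lambda>z. pbound (a z) (b z) (c z))"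
  by (rule decidable_comp3[of pbound]) (unfold pbound_def, intro computable_intros)

lemma decidable_vbound [computable_intros]:
  assumes "computable a" "computable b" "computable c" "computable d"
  shows "decidable (\<lambda>z. vbound (a z) (b z) (c z) (d z))"
proof -
  have "decidable (\<lambda>w. vbound (fst w) (fst (snd w)) (fst (snd (snd w))) (snd (snd (snd w))))"
    unfolding vbound_def by (intro computable_intros)
  from decidable_compose[OF this, of "\<lambda>z. (a z, b z, c z, d z)"] show ?thesis
    using assms by (simp add: computable_intros)
qed

context coded_field
begin

lemma computable_dec_case: "computable a \<Longrightarrow> (\<And>c. computable (\<lambda>z. F c z)) \<Longrightarrow> computable (\<lambda>z. F (dec (a z)) z)"
  unfolding dec_def by (rule computable_finite_case)

lemma computable_kadd [computable_intros]: "computable a \<Longrightarrow> computable b \<Longrightarrow> computable (\<lambda>z. kadd (a z) (b z))"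
  unfolding kadd_def
  by (rule computable_dec_case[where F = "\<lambda>c z. enc (c + dec (b z))"], assumption,
      rule computable_dec_case[where F = "\<lambda>d z. enc (_ + d)"]) (auto intro: computable_const)

lemma computable_kmul [computable_intros]: "computable a \<Longrightarrow> computable b \<Longrightarrow> computable (\<lambda>z. kmul (a z) (b z))"
  unfolding kmul_def
  by (rule computable_dec_case[where F = "\<lambda>c z. enc (c * dec (b z))"], assumption,
      rule computable_dec_case[where F = "\<lambda>d z. enc (_ * d)"]) (auto intro: computable_const)

lemma computable_kneg [computable_intros]: "computable a \<Longrightarrow> computable (\<lambda>z. kneg (a z))"
  unfolding kneg_def
  by (rule computable_dec_case[where F = "\<lambda>c z. enc (- c)"]) (auto intro: computable_const)

lemma computable_csum [computable_intros]: "computable a \<Longrightarrow> computable b \<Longrightarrow> computable (\<lambda>z. csum (a z) (b z))"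
  by (rule computable_comp2[of csum]) (unfold csum_def, intro computable_intros)

lemma decidable_pzero [computable_intros]: "computable a \<Longrightarrow> decidable (\<lambda>z. pzero (a z))"
  by (rule decidable_compose[of pzero]) (unfold pzero_def, intro computable_intros)

lemma computable_vneg [computable_intros]: "computable a \<Longrightarrow> computable (\<lambda>z. vneg (a z))"
  unfolding vneg_def by (intro computable_intros)

lemma decidable_veq [computable_intros]: "computable a \<Longrightarrow> computable b \<Longrightarrow> decidable (\<lambda>z. veq (a z) (b z))"
  unfolding veq_def by (intro computable_intros)

lemma computable_vmul [computable_intros]:
  "computable a \<Longrightarrow> computable b \<Longrightarrow> computable c \<Longrightarrow> computable (\<lambda>z. vmul (a z) (b z) (c z))"
  by (rule computable_comp3[of vmul]) (unfold vmul_def, intro computable_intros)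

lemma computable_lapp [computable_intros]:
  "computable a \<Longrightarrow> computable b \<Longrightarrow> computable c \<Longrightarrow> computable (\<lambda>z. lapp (a z) (b z) (c z))"
  by (rule computable_comp3[of lapp]) (unfold lapp_def, intro computable_intros)

lemma computable_lxact [computable_intros]:
  assumes "computable a" "computable b" "computable c" "computable d"
  shows "computable (\<lambda>z. lxact (a z) (b z) (c z) (d z))"
proof -
  have "computable (\<lambda>w. lxact (fst w) (fst (snd w)) (fst (snd (snd w))) (snd (snd (snd w))))"
    unfolding lxact_def by (intro computable_intros)
  from computable_compose[OF this, of "\<lambda>z. (a z, b z, c z, d z)"] show ?thesis
    using assms by (simp add: computable_intros)
qed

lemma computable_hev [computable_intros]:
  assumes "computable a" "computable b" "computable c" "computable d" "computable e"
  shows "computable (\<lambda>z. hev (a z) (b z) (c z) (d z) (e z))"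
proof -
  have "computable (\<lambda>w. hev (fst w) (fst (snd w)) (fst (snd (snd w))) (fst (snd (snd (snd w)))) (snd (snd (snd (snd w)))))"
    unfolding hev_def by (intro computable_intros)
  from computable_compose[OF this, of "\<lambda>z. (a z, b z, c z, d z, e z)"] show ?thesis
    using assms by (simp add: computable_intros)
qed

lemma decidable_bzero [computable_intros]:
  "computable a \<Longrightarrow> computable b \<Longrightarrow> computable c \<Longrightarrow> decidable (\<lambda>z. bzero (a z) (b z) (c z))"
  unfolding bzero_def case_prod_beta by (intro computable_intros)

lemma decidable_block_ids [computable_intros]:
  "computable a \<Longrightarrow> computable b \<Longrightarrow> decidable (\<lambda>z. block_ids (a z) (b z))"
  by (rule decidable_comp2[of block_ids]) (unfold block_ids_def case_prod_beta, intro computable_intros)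

lemma decidable_block_bounds [computable_intros]:
  assumes "computable a" "computable b" "computable c" "computable d"
  shows "decidable (\<lambda>z. block_bounds (a z) (b z) (c z) (d z))"
proof -
  have "decidable (\<lambda>w. block_bounds (fst w) (fst (snd w)) (fst (snd (snd w))) (snd (snd (snd w))))"
    unfolding block_bounds_def case_prod_beta by (intro computable_intros)
  from decidable_compose[OF this, of "\<lambda>z. (a z, b z, c z, d z)"] show ?thesis
    using assms by (simp add: computable_intros)
qed

lemma computable_state_bound [computable_intros]:
  "computable a \<Longrightarrow> computable b \<Longrightarrow> computable c \<Longrightarrow> computable d \<Longrightarrow> computable e \<Longrightarrow>
    computable (\<lambda>z. state_bound (a z) (b z) (c z) (d z) (e z))"
  unfolding state_bound_def by (intro computable_intros)

lemma computable_candidates [computable_intros]: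
  "computable a \<Longrightarrow> computable b \<Longrightarrow> computable (\<lambda>z. candidates (a z) (b z))"
  unfolding candidates_def by (intro computable_intros)

lemma decidable_no_check:
  "decidable (\<lambda>w. no_check (fst (fst w)) (fst (snd (fst w))) (snd (snd (fst w))) (fst (snd w)) (fst (snd (snd w))) (snd (snd (snd w))))"
  unfolding no_check_def by (intro computable_intros)

lemma decidable_yes_check:
  "decidable (\<lambda>w. yes_check (fst (fst w)) (fst (snd (fst w))) (snd (snd (fst w))) (fst (snd w)) (snd (snd w)))"
  unfolding yes_check_def by (intro computable_intros)

text \<open>\<open>post_program\<close> asks for sound and existing witnesses input by input, so
  these are supplied just for generators with exponent lists of length \<open>n\<close>. The
  auxiliary program \<open>e\<close> pairs the three inputs into one code.\<close>

lemma decision_program: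
  "\<exists>p. \<forall>n k gs. (\<forall>g\<in>set gs. plen n g) \<longrightarrow>
    prog_eval p [n, k, code gs] (if shortest_length (genideal (mpoly_ring n) (pol ` set gs)) \<le> enat k then 1 else 0)"
proof -
  define P where "P x \<longleftrightarrow> shortest_length (genideal (mpoly_ring (fst x)) (pol ` set (snd (snd x)))) \<le> enat (fst (snd x))"
    for x :: "nat \<times> nat \<times> lpoly list"
  obtain p where p: "\<And>x :: nat \<times> nat \<times> lpoly list.
    (\<And>w. yes_check (fst x) (fst (snd x)) (snd (snd x)) (fst w) (snd w) \<Longrightarrow> P x) \<Longrightarrow>
    (\<And>w. no_check (fst x) (fst (snd x)) (snd (snd x)) (fst w) (fst (snd w)) (snd (snd w)) \<Longrightarrow> \<not> P x) \<Longrightarrow>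
    (\<exists>w. yes_check (fst x) (fst (snd x)) (snd (snd x)) (fst w) (snd w)) \<or>
    (\<exists>w. no_check (fst x) (fst (snd x)) (snd (snd x)) (fst w) (fst (snd w)) (snd (snd w))) \<Longrightarrow>
    prog_eval p [code x] (if P x then 1 else 0)"
    using post_program[OF decidable_yes_check decidable_no_check, of P] by blast
  obtain e where e: "\<And>xs. length xs = 3 \<Longrightarrow> prog_eval e xs (prod_encode (xs ! 0, prod_encode (xs ! 1, xs ! 2)))"
    using recn_prod_encode[OF recn_nth[of 0 3] recn_prod_encode[OF recn_nth[of 1 3] recn_nth[of 2 3]]]
    by (auto simp: recn_def)
  have "prog_eval (Comp_Prog p [e]) [n, k, code gs] (if P (n, k, gs) then 1 else 0)"
    if gs: "\<forall>g\<in>set gs. plen n g" for n k gs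
  proof (rule prog_eval.Comp)
    show "list_all2 (\<lambda>q. prog_eval q [n, k, code gs]) [e] [code (n, k, gs)]"
      using e[of "[n, k, code gs]"] by (simp add: code_Pair)
    have P_iff: "P (n, k, gs) \<longleftrightarrow> (\<exists>f\<in>genideal (mpoly_ring n) (pol ` set gs). f \<noteq> 0 \<and> card (Poly_Mapping.keys f) \<le> k)"
      by (simp add: P_def shortest_length_le_iff)
    show "prog_eval p [code (n, k, gs)] (if P (n, k, gs) then 1 else 0)"
    proof (rule p)
      show "P (n, k, gs)" if "yes_check (fst (n, k, gs)) (fst (snd (n, k, gs))) (snd (snd (n, k, gs))) (fst w) (snd w)" for w
        using yes_check_sound[OF gs] that unfolding P_iff by auto
      show "\<not> P (n, k, gs)"
        if "no_check (fst (n, k, gs)) (fst (snd (n, k, gs))) (snd (snd (n, k, gs))) (fst w) (fst (snd w)) (snd (snd w))" for w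
      proof
        assume "P (n, k, gs)"
        then obtain f where f: "f \<in> genideal (mpoly_ring n) (pol ` set gs)" "f \<noteq> 0" "card (Poly_Mapping.keys f) \<le> k"
          unfolding P_iff by blast
        have "no_check n k gs (fst w) (fst (snd w)) (snd (snd w))"
          using that by simp
        from no_check_sound[OF gs this f(1,2)] f(3) show False
          by linarith
      qed
      show "(\<exists>w. yes_check (fst (n, k, gs)) (fst (snd (n, k, gs))) (snd (snd (n, k, gs))) (fst w) (snd w)) \<or>
        (\<exists>w. no_check (fst (n, k, gs)) (fst (snd (n, k, gs))) (snd (snd (n, k, gs))) (fst w) (fst (snd w)) (snd (snd w)))"
      proof (cases "P (n, k, gs)")
        case True
        then show ?thesis
          using yes_check_complete[OF gs] unfolding P_iff by fastforce
      next
        case False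
        then have "\<exists>D M bs. no_check n k gs D M bs"
          unfolding P_iff by (intro no_check_complete[OF gs]) (auto simp: not_le)
        then show ?thesis by fastforce
      qed
    qed
  qed
  then show ?thesis
    unfolding P_def by (intro exI[of _ "Comp_Prog p [e]"]) auto
qed

end

section \<open>Characteristic and Frobenius map of a finite field\<close>

lemma CHAR_poly_mapping: "CHAR('a::comm_monoid_add \<Rightarrow>\<^sub>0 'b::comm_semiring_1) = CHAR('b)"
proof (rule CHAR_eqI)
  have 0: "of_nat c = (0 :: 'a \<Rightarrow>\<^sub>0 'b) \<longleftrightarrow> of_nat c = (0 :: 'b)" for c
  proof
    assume "of_nat c = (0 :: 'a \<Rightarrow>\<^sub>0 'b)"
    then have "Poly_Mapping.lookup (of_nat c :: 'a \<Rightarrow>\<^sub>0 'b) 0 = 0" by simp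
    then show "of_nat c = (0 :: 'b)" by (simp add: lookup_of_nat)
  next
    assume "of_nat c = (0 :: 'b)"
    then show "of_nat c = (0 :: 'a \<Rightarrow>\<^sub>0 'b)" by (metis single_of_nat single_zero)
  qed
  show "of_nat CHAR('b) = (0 :: 'a \<Rightarrow>\<^sub>0 'b)"
    by (simp add: 0)
  show "CHAR('b) dvd c" if "of_nat c = (0 :: 'a \<Rightarrow>\<^sub>0 'b)" for c
    using that by (simp add: 0 of_nat_eq_0_iff_char_dvd)
qed

text \<open>The Frobenius map of a finite field has finite order, so some \<open>q = p ^ t\<close> fixes the field.\<close>

lemma frobenius_exponent:
  "\<exists>q>1. (\<forall>x y :: 'k::{finite,field} mpoly. (x + y) ^ q = x ^ q + y ^ q) \<and> (\<forall>c :: 'k. c ^ q = c)"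
proof -
  define p where "p = CHAR('k)"
  have "p > 0"
    unfolding p_def by (intro finite_imp_CHAR_pos) simp
  then have p: "prime p"
    unfolding p_def by (rule prime_CHAR_semidom)
  define F where "F c = c ^ p" for c :: 'k
  have "inj F"
  proof (rule injI)
    fix x y assume "F x = F y"
    moreover have "((x - y) + y) ^ p = (x - y) ^ p + y ^ p"
      using p by (intro freshmans_dream) (auto simp: p_def)
    ultimately show "x = y"
      by (simp add: F_def)
  qed
  \<comment> \<open>There are finitely many maps from K to K, so two iterates of \<open>F\<close>
    coincide; injectivity of \<open>F\<close> cancels the smaller one.\<close>
  have "\<not> inj (\<lambda>i::nat. F ^^ i)"
    using finite_imageD[of "\<lambda>i::nat. F ^^ i" UNIV] by (auto intro: finite_subset[OF subset_UNIV])
  then obtain i j where "F ^^ i = F ^^ j" "i \<noteq> j"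
    by (auto simp: inj_def)
  then obtain i j where ij: "F ^^ i = F ^^ j" "i < j"
    by (metis linorder_neqE_nat)
  define t where "t = j - i"
  have "F ^^ j = (F ^^ i) \<circ> (F ^^ t)"
    using ij(2) by (simp add: t_def flip: funpow_add)
  then have "(F ^^ i) ((F ^^ t) c) = (F ^^ i) c" for c
    using ij(1) by (metis comp_apply)
  then have Ft: "(F ^^ t) c = c" for c
    using inj_fn[OF \<open>inj F\<close>, of i] by (simp add: inj_eq)
  have Fpow: "(F ^^ s) c = c ^ (p ^ s)" for s c
    by (induction s) (simp_all add: F_def mult.commute flip: power_mult)
  have "p ^ t > 1"
    using p ij(2) prime_gt_1_nat[OF p] by (intro one_less_power) (auto simp: t_def)
  moreover have "(x + y) ^ (p ^ t) = x ^ (p ^ t) + y ^ (p ^ t)" for x y :: "'k mpoly"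
    by (rule freshmans_dream'[where n = t]) (use p in \<open>simp_all add: p_def CHAR_poly_mapping\<close>)
  ultimately show ?thesis
    using Ft unfolding Fpow by blast
qed

theorem proposition6p2:
  fixes enc :: "'k::{finite, field} \<Rightarrow> nat"
  assumes "inj enc"
  shows "\<exists>p. \<forall>(n::nat) (k::nat) (gs :: 'k terms list) (I :: 'k mpoly set).
           k > 0 \<longrightarrow> (\<forall>g\<in>set gs. valid_terms n g) \<longrightarrow>
           I = genideal (mpoly_ring n) (poly_of_terms ` set gs) \<longrightarrow>
           prog_eval p [n, k, encode_generators enc gs]
             (if shortest_length I \<le> enat k then 1 else 0)"
proof -
  obtain q where q: "q > 1" "\<And>x y :: 'k mpoly. (x + y) ^ q = x ^ q + y ^ q" "\<And>c :: 'k. c ^ q = c"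
    using frobenius_exponent[where ?'k = 'k] by blast
  interpret coded_field q "TYPE('k)" enc
    by unfold_locales (use q assms in auto)
  define enc_terms where "enc_terms ts = map (\<lambda>(e, c). (e, enc c)) ts" for ts :: "'k terms"
  \<comment> \<open>The prescribed input format is already the canonical \<open>code\<close> of a
    list of term lists, so the program can be applied to the input as it stands.\<close>
  have code: "code (map enc_terms gs) = encode_generators enc gs" for gs
  proof -
    have "code e = list_encode e" for e :: "nat list"
      by (simp add: code_list_def map_idI)
    then have "code (enc_terms ts) = encode_terms enc ts" for ts
      unfolding code_list_def[of "enc_terms ts"]
      by (simp add: code_Pair encode_terms_def enc_terms_def o_def case_prod_unfold)
    then show ?thesis
      unfolding code_list_def[of "map enc_terms gs"]
      by (simp add: encode_generators_def o_def)
  qed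
  have pol: "pol (enc_terms ts) = poly_of_terms ts" for ts
    by (simp add: pol_def enc_terms_def poly_of_terms_def o_def case_prod_unfold)
  have plen: "plen n (enc_terms ts)" if "valid_terms n ts" for n ts
    using that by (auto simp: plen_def enc_terms_def valid_terms_def)
  obtain p where p: "\<And>n k gs. (\<forall>g\<in>set gs. plen n g) \<Longrightarrow>
    prog_eval p [n, k, code gs] (if shortest_length (genideal (mpoly_ring n) (pol ` set gs)) \<le> enat k then 1 else 0)"
    using decision_program by blast
  have "prog_eval p [n, k, encode_generators enc gs]
      (if shortest_length (genideal (mpoly_ring n) (poly_of_terms ` set gs)) \<le> enat k then 1 else 0)"
    if "\<forall>g\<in>set gs. valid_terms n g" for n k gs
    using p[of "map enc_terms gs" n k] that plen by (simp add: code image_image pol)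
  then show ?thesis by blast
qed

end
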